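(* Let $P$ be the Nambu-determinant Poisson bivector on $\mathbb{R}^3$, and let $\mathcal{W}_{3D}$ be the real span of the vector fields $\phi(\Gamma)$, where $\Gamma$ runs over the three-dimensional descendants of the two graphs $\Gamma^{2D}_{11}=[0,1;1,3;1,2]$ and $\Gamma^{2D}_{12}=[0,3;1,3;1,2]$. Let $\vec{X}^{\gamma_3}_{3D}\in\mathcal{W}_{3D}$ be \begin{align*} \vec{X}^{\gamma_3}_{3D}={}&8\,\phi([0,1,4;1,3,5;1,2,6])+24\,\phi([0,1,4;1,6,5;4,2,6])+8\,\phi([0,1,4;4,3,5;4,2,6])\\ &+24\,\phi([0,1,4;4,6,5;4,2,6])+12\,\phi([0,1,4;4,6,5;4,5,6])+16\,\phi([0,2,4;1,3,5;1,2,6])\\ &+16\,\phi([0,2,4;1,3,5;1,5,6])+12\,\phi([0,2,4;1,6,5;1,5,6])+16\,\phi([0,2,4;4,3,5;1,5,6])\\ &+24\,\phi([0,5,4;1,3,5;1,2,6]), \end{align*} which solves the trivialization equation $Q^{\gamma_3}(P)=[\![P,\vec{X}^{\gamma_3}_{3D}]\!]$ for the tetrahedral flow (with $Q^{\gamma_3}$ suitably normalized by a nonzero constant). Then $\vec{X}^{\gamma_3}_{3D}$ is unique modulo Hamiltonian vector fields: for every $\vec{X}\in\mathcal{W}_{3D}$ with $Q^{\gamma_3}(P)=[\![P,\vec{X}]\!]$ there is $H\in\mathcal{H}_{3D}$ such that $\vec{X}-\vec{X}^{\gamma_3}_{3D}=[\![P,H]\!]$.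
   Context: $[\![\cdot,\cdot]\!]$ is the Schouten bracket of multivector fields. The Nambu-determinant Poisson bivector on $\mathbb{R}^3$ is $P=\tfrac12P^{ij}\partial_i\wedge\partial_j$ with $P^{ij}=\sum_k\varrho\,\varepsilon^{ijk}\,\partial_k a$, for smooth functions $\varrho$ and $a$. Tetrahedral flow: let $\gamma_3$ be the complete graph on vertices $1,2,3,4$ with its six edges ordered $12\prec13\prec14\prec23\prec24\prec34$. Write $P=\tfrac12P^{ij}\xi_i\xi_j$ with anticommuting $\xi_i=\partial/\partial x^i$. Up to a nonzero normalization constant, $Q^{\gamma_3}(P)$ is the bivector obtained by applying to $P\otimes P\otimes P\otimes P$, for the edges $(a,b)$ in this order, the operators $\sum_\mu\big(\tfrac{\partial}{\partial\xi_\mu^{(a)}}\tfrac{\partial}{\partial x^\mu_{(b)}}+\tfrac{\partial}{\partial\xi_\mu^{(b)}}\tfrac{\partial}{\partial x^\mu_{(a)}}\big)$ (the label $(a)$ denotes the tensor factor acted on), and then multiplying the four factors. A three-dimensional Nambu micro-graph on $n$ copies of $P$ and at most one sink $0$ is a weakly connected directed graph with Levi-Civita vertices $1,\dots,n$ and Casimir vertices $n+1,\dots,2n$, the vertex $n+k$ belonging to $k$. Each Levi-Civita vertex $k$ issues three ordered edges to three distinct targets, one of which is $n+k$; the other two targets are arbitrary vertices (self-loops allowed). Casimir vertices and the sink issue no edges; the sink, if present, receives exactly one edge. The encoding $[t_{11},t_{12},t_{13};\dots;t_{n1},t_{n2},t_{n3}]$ lists, for each Levi-Civita vertex, the targets of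 its ordered edges. The evaluation $\phi$: decorate the three ordered edges of vertex $k$ with indices $i_{k1},i_{k2},i_{k3}\in\{1,2,3\}$; form $\prod_k\varepsilon^{i_{k1}i_{k2}i_{k3}}$ times the product of $\varrho$ over Levi-Civita vertices and of $a$ over Casimir vertices, each differentiated with respect to $x^i$ for every incoming edge with index $i$, times $\partial_{x^i}$ if the edge with index $i$ enters the sink; sum over all indices. Descendants: a two-dimensional graph $[t_{11},t_{12};t_{21},t_{22};t_{31},t_{32}]$ has sink $0$ and Levi-Civita vertices $1,2,3$ each issuing two ordered edges to the listed targets. Its three-dimensional descendants are all micro-graphs $[t'_{11},t'_{12},4;t'_{21},t'_{22},5;t'_{31},t'_{32},6]$ in which, independently for each edge, $t'=0$ if $t=0$ and $t'\in\{t,t+3\}$ if $t\in\{1,2,3\}$. (Graphs are considered up to isomorphism, i.e. relabeling.) $\mathcal{H}_{3D}$ is the real span of $\phi(\Gamma)$ over three-dimensional Nambu micro-graphs on $2$ copies of $P$ with no sink. A vector field is called Hamiltonian if it equals $[\![P,H]\!]$ for a function $H$ obtained from graphs. The functions $\varrho,a$ are treated as arbitrary (generic): all expressions are differential polynomials in $\varrho,a$ with constant coefficients, and equalities are required to hold identically for all smooth $\varrho,a$. *)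

theory Defs
  imports "HOL-Analysis.Analysis"
begin

section \<open>Smooth functions on three-space\<close>

definition pd :: "3 \<Rightarrow> (real^3 \<Rightarrow> real) \<Rightarrow> real^3 \<Rightarrow> real" where
  "pd i f x = deriv (\<lambda>t. f (x + t *\<^sub>R axis i 1)) 0"

text \<open>Smoothness: every iterated partial derivative exists and is Frechet differentiable
  everywhere (hence continuous).\<close>

definition smooth :: "(real^3 \<Rightarrow> real) \<Rightarrow> bool" where
  "smooth f \<longleftrightarrow> (\<forall>is. foldr pd is f differentiable_on UNIV)"

definition levi_civita :: "3 \<Rightarrow> 3 \<Rightarrow> 3 \<Rightarrow> real" where
  "levi_civita i j k =
     (if (i, j, k) \<in> {(1, 2, 3), (2, 3, 1), (3, 1, 2)} then 1
      else if (i, j, k) \<in> {(1, 3, 2), (3, 2, 1), (2, 1, 3)} then -1 else 0)"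


section \<open>Grassmann calculus\<close>

text \<open>Functions of points \<open>'p\<close> and of anticommuting variables \<open>\<xi>\<^sub>i\<close>, \<open>i :: 'i\<close>, are given by their
  coefficients: \<open>F\<close> stands for \<open>\<Sum>\<^sub>S F S \<xi>\<^sub>S\<close>, where \<open>\<xi>\<^sub>S\<close> is the product of the \<open>\<xi>\<^sub>i\<close>, \<open>i \<in> S\<close>, in
  increasing order with respect to a strict linear order \<open>lt\<close> on \<open>'i\<close>. Another order only changes the
  sign of some basis monomials. (On the type \<open>3\<close> one has \<open>3 = 0 < 1 < 2\<close>.)\<close>

type_synonym ('i, 'p) grassmann = "'i set \<Rightarrow> 'p \<Rightarrow> real"

type_synonym multivector = "(3, real^3) grassmann"

definition left_deriv ::
  "('i \<Rightarrow> 'i \<Rightarrow> bool) \<Rightarrow> 'i \<Rightarrow> ('i, 'p) grassmann \<Rightarrow> ('i, 'p) grassmann" where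
  "left_deriv lt i F = (\<lambda>S x. if i \<in> S then 0
     else (-1) ^ card {j \<in> S. lt j i} * F (insert i S) x)"

definition right_deriv ::
  "('i \<Rightarrow> 'i \<Rightarrow> bool) \<Rightarrow> 'i \<Rightarrow> ('i, 'p) grassmann \<Rightarrow> ('i, 'p) grassmann" where
  "right_deriv lt i F = (\<lambda>S x. if i \<in> S then 0
     else (-1) ^ card {j \<in> S. lt i j} * F (insert i S) x)"

definition xi :: "3 \<Rightarrow> multivector" where
  "xi i = (\<lambda>S x. if S = {i} then 1 else 0)"

definition wedge :: "multivector \<Rightarrow> multivector \<Rightarrow> multivector" where
  "wedge A B = (\<lambda>S x. \<Sum>T\<in>Pow S.
     (-1) ^ card {(i, j). i \<in> T \<and> j \<in> S - T \<and> j < i} * A T x * B (S - T) x)"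

text \<open>\<open>[[A, B]] = \<Sum>\<^sub>i (A \<partial>\<^sup>R/\<partial>\<xi>\<^sub>i) (\<partial>B/\<partial>x\<^sup>i) - (\<partial>A/\<partial>x\<^sup>i) (\<partial>\<^sup>L/\<partial>\<xi>\<^sub>i B)\<close>\<close>

definition schouten :: "multivector \<Rightarrow> multivector \<Rightarrow> multivector" where
  "schouten A B = (\<lambda>S x. \<Sum>i\<in>UNIV.
     wedge (right_deriv (<) i A) (\<lambda>T. pd i (B T)) S x
     - wedge (\<lambda>T. pd i (A T)) (left_deriv (<) i B) S x)"

definition nambu :: "(real^3 \<Rightarrow> real) \<Rightarrow> (real^3 \<Rightarrow> real) \<Rightarrow> multivector" where
  "nambu \<rho> a = (\<lambda>S x. 1/2 * (\<Sum>i\<in>UNIV. \<Sum>j\<in>UNIV.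
     (\<Sum>k\<in>UNIV. \<rho> x * levi_civita i j k * pd k a x) * wedge (xi i) (xi j) S x))"


section \<open>The tetrahedral flow\<close>

text \<open>A fourfold tensor product is a function of four points \<open>p 1, \<dots>, p 4\<close> and of the anticommuting
  variables \<open>\<xi>\<^sub>\<mu>\<close> of the factor \<open>a\<close>, indexed by \<open>(a, \<mu>)\<close>. In a monomial the variables of the first
  factor come first, then those of the second one, and so on. No Koszul signs enter \<open>tensor4\<close>,
  because there the points are ordinary coefficients.\<close>

type_synonym tensor = "(nat \<times> 3, nat \<Rightarrow> real^3) grassmann"

definition lex_less :: "nat \<times> 3 \<Rightarrow> nat \<times> 3 \<Rightarrow> bool" where
  "lex_less u v \<longleftrightarrow> fst u < fst v \<or> fst u = fst v \<and> snd u < snd v"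

definition tensor4 :: "multivector \<Rightarrow> tensor" where
  "tensor4 A = (\<lambda>T p. if fst ` T \<subseteq> {1..4} then \<Prod>a\<in>{1..4}. A {\<mu>. (a, \<mu>) \<in> T} (p a) else 0)"

definition tensor_pd :: "nat \<Rightarrow> 3 \<Rightarrow> tensor \<Rightarrow> tensor" where
  "tensor_pd b \<mu> F = (\<lambda>T p. deriv (\<lambda>t. F T (p(b := p b + t *\<^sub>R axis \<mu> 1))) 0)"

definition edge_op :: "nat \<times> nat \<Rightarrow> tensor \<Rightarrow> tensor" where
  "edge_op = (\<lambda>(a, b) F T p. \<Sum>\<mu>\<in>UNIV.
     left_deriv lex_less (a, \<mu>) (tensor_pd b \<mu> F) T p
     + left_deriv lex_less (b, \<mu>) (tensor_pd a \<mu> F) T p)"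

text \<open>Multiplication of the four factors: all points become \<open>x\<close> and all \<open>\<xi>\<^sub>\<mu>\<close> of the factors become
  \<open>\<xi>\<^sub>\<mu>\<close>; monomials with a repeated \<open>\<xi>\<^sub>\<mu>\<close> vanish, the others are sorted.\<close>

definition multiply4 :: "tensor \<Rightarrow> multivector" where
  "multiply4 F = (\<lambda>S x. \<Sum>T | T \<subseteq> {1..4} \<times> S \<and> bij_betw snd T S.
     (-1) ^ card {(u, v). u \<in> T \<and> v \<in> T \<and> lex_less u v \<and> snd v < snd u} * F T (\<lambda>_. x))"

definition tetrahedral_flow :: "multivector \<Rightarrow> multivector" where
  "tetrahedral_flow P =
     multiply4 (fold edge_op [(1,2), (1,3), (1,4), (2,3), (2,4), (3,4)] (tensor4 P))"


section \<open>Nambu micro-graphs\<close>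

text \<open>An encoding lists the targets of the ordered edges issued by the vertices \<open>1, 2, \<dots>\<close>; the
  vertex \<open>k\<close> and its edge number \<open>e\<close> are counted from \<open>1\<close>.\<close>

type_synonym graph = "nat list list"

definition target :: "graph \<Rightarrow> nat \<Rightarrow> nat \<Rightarrow> nat" where
  "target G k e = G ! (k - 1) ! (e - 1)"

definition incoming :: "graph \<Rightarrow> nat \<Rightarrow> (nat \<times> nat) list" where
  "incoming G v = [(k, e) \<leftarrow> List.product [1..<length G + 1] [1..<4]. target G k e = v]"

definition adjacency :: "graph \<Rightarrow> (nat \<times> nat) set" where
  "adjacency G = {(k, v). k \<in> {1..length G} \<and> v \<in> set (G ! (k - 1))}"

definition vertices :: "bool \<Rightarrow> nat \<Rightarrow> nat set" where
  "vertices sink n = (if sink then {0..2 * n} else {1..2 * n})"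

definition nambu_micrograph :: "bool \<Rightarrow> nat \<Rightarrow> graph \<Rightarrow> bool" where
  "nambu_micrograph sink n G \<longleftrightarrow>
     length G = n \<and>
     (\<forall>k\<in>{1..n}. length (G ! (k - 1)) = 3 \<and> distinct (G ! (k - 1)) \<and>
        n + k \<in> set (G ! (k - 1)) \<and> set (G ! (k - 1)) \<subseteq> vertices sink n) \<and>
     (sink \<longrightarrow> length (incoming G 0) = 1) \<and>
     (\<forall>u\<in>vertices sink n. \<forall>v\<in>vertices sink n. (u, v) \<in> (adjacency G \<union> (adjacency G)\<inverse>)\<^sup>*)"

text \<open>A multivector-valued expression in \<open>\<rho>\<close> and \<open>a\<close>.\<close>

type_synonym expression = "(real^3 \<Rightarrow> real) \<Rightarrow> (real^3 \<Rightarrow> real) \<Rightarrow> multivector"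

text \<open>The decoration \<open>D (k, e)\<close> is the index of the edge number \<open>e\<close> of \<open>k\<close>. At most one edge enters
  the sink, so the last factor is the coefficient at \<open>\<xi>\<^sub>S\<close> of \<open>\<partial>/\<partial>x\<^sup>i = \<xi>\<^sub>i\<close> if the edge with index \<open>i\<close>
  enters the sink, and of \<open>1\<close> if there is no sink.\<close>

definition phi :: "graph \<Rightarrow> expression" where
  "phi G \<rho> a = (\<lambda>S x. \<Sum>D \<in> ({1..length G} \<times> {1..3}) \<rightarrow>\<^sub>E UNIV.
     (\<Prod>k = 1..length G. levi_civita (D (k, 1)) (D (k, 2)) (D (k, 3))) *
     (\<Prod>k = 1..length G. foldr pd (map D (incoming G k)) \<rho> x) *
     (\<Prod>k = 1..length G. foldr pd (map D (incoming G (length G + k))) a x) *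
     (if S = set (map D (incoming G 0)) then 1 else 0))"

definition generic_eq :: "expression \<Rightarrow> expression \<Rightarrow> bool" where
  "generic_eq X Y \<longleftrightarrow> (\<forall>\<rho> a. smooth \<rho> \<longrightarrow> smooth a \<longrightarrow> X \<rho> a = Y \<rho> a)"

text \<open>Membership in a span is up to equality on smooth \<open>\<rho>\<close> and \<open>a\<close>: on other functions iterated
  partial derivatives need not commute and \<open>phi\<close> carries no information.\<close>

definition graph_span :: "graph set \<Rightarrow> expression set" where
  "graph_span \<G> = {X. \<exists>F c. finite F \<and> F \<subseteq> \<G> \<and>
     generic_eq X (\<lambda>\<rho> a S x. \<Sum>\<Gamma>\<in>F. c \<Gamma> * phi \<Gamma> \<rho> a S x)}"

definition descendants :: "graph \<Rightarrow> graph set" where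
  "descendants g = {G. nambu_micrograph True 3 G \<and>
     (\<forall>k\<in>{1..3}. target G k 3 = 3 + k \<and>
        (\<forall>e\<in>{1, 2}. target G k e \<in>
           (if target g k e = 0 then {0} else {target g k e, target g k e + 3})))}"

text \<open>No closure under isomorphism is needed in the following two spans: relabeling the Levi-Civita
  vertices (and their Casimirs accordingly) does not change \<open>phi\<close> on smooth
  functions.\<close>

definition W3D :: "expression set" where
  "W3D = graph_span (descendants [[0,1],[1,3],[1,2]] \<union> descendants [[0,3],[1,3],[1,2]])"

definition H3D :: "expression set" where
  "H3D = graph_span {\<Gamma>. nambu_micrograph False 2 \<Gamma>}"

definition X3D :: expression where
  "X3D \<rho> a = (\<lambda>S x.
      8 * phi [[0,1,4],[1,3,5],[1,2,6]] \<rho> a S x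
    + 24 * phi [[0,1,4],[1,6,5],[4,2,6]] \<rho> a S x
    + 8 * phi [[0,1,4],[4,3,5],[4,2,6]] \<rho> a S x
    + 24 * phi [[0,1,4],[4,6,5],[4,2,6]] \<rho> a S x
    + 12 * phi [[0,1,4],[4,6,5],[4,5,6]] \<rho> a S x
    + 16 * phi [[0,2,4],[1,3,5],[1,2,6]] \<rho> a S x
    + 16 * phi [[0,2,4],[1,3,5],[1,5,6]] \<rho> a S x
    + 12 * phi [[0,2,4],[1,6,5],[1,5,6]] \<rho> a S x
    + 16 * phi [[0,2,4],[4,3,5],[1,5,6]] \<rho> a S x
    + 24 * phi [[0,5,4],[1,3,5],[1,2,6]] \<rho> a S x)"

end

(*
  All brackets are evaluated on the jets of \<rho> and a. For a vector field X put f = X.grad \<rho> - \<rho> div X and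
  g = X.grad a; the bracket of P with X then has the coefficients -(f a_k + \<rho> \<partial>_k g). Modulo the polynomial
  identities between micro-graphs the descendants span a space of dimension 20, and evaluating this
  bracket on a few sparse polynomial pairs (\<rho>, a) cuts the kernel down to dimension 3. The kernel is
  then exhausted by the Hamiltonian vector fields of three micro-graphs on two copies of P.

  That the given field solves the equation is a polynomial identity in the jets. For it P is written as
  the rotation of \<rho> grad a; both sides are split according to the number of undifferentiated and
  of once differentiated factors \<rho>, which keeps each identity small.
*)
theory Submission imports Defs begin

section \<open>Iterated partial derivatives\<close>

text \<open>Contraction with the volume form turns P into the one-form rho da, and L_X(rho da) -
  (div X) rho da = f da + rho dg. This is why a vector field enters its bracket with P only through
  the two scalars f and g. Evaluations of graphs are polynomials in symbols \<open>R w\<close>,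
  \<open>A w\<close> for the derivatives of rho and a along a word w. The locale \<open>jets\<close>
  records the one property used, symmetry in the letters of w, so an identity is proved once and
  then read at every point of space. The obstacle is size. Two devices keep the expansions feasible.
  The Levi-Civita symbol is invariant under the cyclic shift of the coordinates, so a graph identity
  is expanded for one component only and the others follow by shifting the symbols. And tensor
  expressions are normalized piecewise before they are compared. Uniqueness works with necessary
  conditions: one coefficient of the bracket, at the origin only. They are sharp because a
  combination of graphs satisfying them is literally Hamiltonian, at every point.\<close>

lemma smooth_pd: "smooth f \<Longrightarrow> smooth (pd i f)"
  unfolding smooth_def
proof
  fix w assume "\<forall>w. foldr pd w f differentiable_on UNIV"
  then have "foldr pd (w @ [i]) f differentiable_on UNIV" by blast
  then show "foldr pd w (pd i f) differentiable_on UNIV" by simp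
qed

lemma smooth_foldr_pd: "smooth f \<Longrightarrow> smooth (foldr pd w f)"
  by (induction w) (simp_all add: smooth_pd)

lemma smooth_differentiable: "smooth f \<Longrightarrow> f differentiable (at x)"
  unfolding smooth_def by (metis UNIV_I differentiable_on_def foldr_Nil id_apply)

lemma smooth_isCont: "smooth f \<Longrightarrow> isCont f x"
  by (simp add: smooth_differentiable differentiable_imp_continuous_within)

text \<open>\<open>pd\<close> is a derivative at parameter 0 of a line through its argument. Moving
  the base point of the line to x + s e_i gives the derivative at parameter s, which is the form
  required by the mean value theorem.\<close>

lemma differentiable_line:
  fixes f :: "real^3 \<Rightarrow> real"
  assumes "f differentiable (at (x + s *\<^sub>R axis i 1))"
  shows "((\<lambda>t. f (x + t *\<^sub>R axis i 1)) has_real_derivative pd i f (x + s *\<^sub>R axis i 1)) (at s)"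
proof -
  obtain f' where f': "(f has_derivative f') (at (x + s *\<^sub>R axis i 1))"
    using assms by (auto simp: differentiable_def)
  have line: "((\<lambda>t. f (y + t *\<^sub>R axis i 1)) has_real_derivative f' (axis i 1)) (at r)"
    if "y + r *\<^sub>R axis i 1 = x + s *\<^sub>R axis i 1" for y r
  proof -
    have "((\<lambda>t. y + t *\<^sub>R axis i 1) has_derivative (\<lambda>t. t *\<^sub>R axis i 1)) (at r)"
      by (auto intro!: derivative_eq_intros)
    then have "((\<lambda>t. f (y + t *\<^sub>R axis i 1)) has_derivative (\<lambda>t. f' (t *\<^sub>R axis i 1))) (at r)"
      using f' that by (intro has_derivative_compose[of _ _ r UNIV f f', simplified]) simp_all
    moreover have "f' (t *\<^sub>R axis i 1) = f' (axis i 1) * t" for t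
      using has_derivative_linear[OF f'] by (simp add: linear_cmul)
    ultimately show ?thesis
      by (simp add: has_field_derivative_def)
  qed
  from line[of "x + s *\<^sub>R axis i 1" 0] have "pd i f (x + s *\<^sub>R axis i 1) = f' (axis i 1)"
    unfolding pd_def by (simp add: DERIV_imp_deriv)
  with line[of x s] show ?thesis by simp
qed

lemma smooth_line:
  "smooth f \<Longrightarrow>
    ((\<lambda>t. f (x + t *\<^sub>R axis i 1)) has_real_derivative pd i f (x + s *\<^sub>R axis i 1)) (at s)"
  by (simp add: differentiable_line smooth_differentiable)

lemma pd_eqI:
  "((\<lambda>t. f (x + t *\<^sub>R axis i 1)) has_real_derivative c) (at 0) \<Longrightarrow> pd i f x = c"
  by (simp add: pd_def DERIV_imp_deriv)

lemma differentiable_line0: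
  "f differentiable (at x) \<Longrightarrow>
    ((\<lambda>t. f (x + t *\<^sub>R axis i 1)) has_real_derivative pd i f x) (at 0)"
  using differentiable_line[of f x 0 i] by simp

section \<open>Sum and product rules, closure properties of smooth functions\<close>

lemma pd_add:
  assumes "f differentiable (at x)" "g differentiable (at x)"
  shows "pd i (\<lambda>x. f x + g x) x = pd i f x + pd i g x"
  by (rule pd_eqI) (auto intro!: derivative_eq_intros differentiable_line0 assms)

lemma pd_mult:
  assumes "f differentiable (at x)" "g differentiable (at x)"
  shows "pd i (\<lambda>x. f x * g x) x = pd i f x * g x + f x * pd i g x"
  by (rule pd_eqI) (auto intro!: derivative_eq_intros differentiable_line0 assms)

lemma pd_cmult:
  assumes "f differentiable (at x)"
  shows "pd i (\<lambda>x. c * f x) x = c * pd i f x"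
  by (rule pd_eqI) (auto intro!: derivative_eq_intros differentiable_line0 assms)

lemma pd_const [simp]: "pd i (\<lambda>x. c) x = 0"
  by (rule pd_eqI) simp

text \<open>Smoothness to finite order, made for induction. The product rule turns a product of
  order n+1 into products whose factors are smooth to order n, which the induction hypothesis
  covers; words of derivatives offer no such recursion.\<close>

fun smooth_upto :: "nat \<Rightarrow> (real^3 \<Rightarrow> real) \<Rightarrow> bool" where
  "smooth_upto 0 f \<longleftrightarrow> f differentiable_on UNIV"
| "smooth_upto (Suc n) f \<longleftrightarrow> f differentiable_on UNIV \<and> (\<forall>i. smooth_upto n (pd i f))"

lemma smooth_iff_upto: "smooth f \<longleftrightarrow> (\<forall>n. smooth_upto n f)"
proof -
  have "smooth_upto n f \<longleftrightarrow> (\<forall>w. length w \<le> n \<longrightarrow> foldr pd w f differentiable_on UNIV)" for n f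
  proof (induction n arbitrary: f)
    case (Suc n)
    \<comment> \<open>The last letter of a word is the derivative applied first, so words are split
      at their end to match the recursion through \<open>pd i f\<close>.\<close>
    have "(\<forall>w. length w \<le> Suc n \<longrightarrow> foldr pd w f differentiable_on UNIV) \<longleftrightarrow>
      f differentiable_on UNIV \<and>
      (\<forall>i w. length w \<le> n \<longrightarrow> foldr pd (w @ [i]) f differentiable_on UNIV)" (is "?L \<longleftrightarrow> ?R")
    proof
      assume L: ?L
      then show ?R
        by (metis L append_Nil foldr_Nil id_apply le0 length_append_singleton list.size(3) not_less_eq_eq)
    next
      assume R: ?R
      show ?L
      proof (intro allI impI)
        fix w :: "3 list" assume "length w \<le> Suc n"
        with R show "foldr pd w f differentiable_on UNIV" by (cases w rule: rev_cases) auto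
      qed
    qed
    with Suc show ?case by auto
  qed simp
  then show ?thesis by (auto simp: smooth_def)
qed

lemma smooth_upto_Suc_D: "smooth_upto (Suc n) f \<Longrightarrow> smooth_upto n f"
  by (induction n arbitrary: f) auto

lemma smooth_upto_add:
  "smooth_upto n f \<Longrightarrow> smooth_upto n g \<Longrightarrow> smooth_upto n (\<lambda>x. f x + g x)"
proof (induction n arbitrary: f g)
  case (Suc n)
  then have "f differentiable_on UNIV" "g differentiable_on UNIV" by auto
  then have "pd i (\<lambda>x. f x + g x) = (\<lambda>x. pd i f x + pd i g x)" for i
    by (intro ext pd_add) (auto simp: differentiable_on_def)
  with Suc show ?case by (auto intro: differentiable_on_add)
qed (auto intro: differentiable_on_add)

lemma smooth_upto_mult:
  "smooth_upto n f \<Longrightarrow> smooth_upto n g \<Longrightarrow> smooth_upto n (\<lambda>x. f x * g x)"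
proof (induction n arbitrary: f g)
  case (Suc n)
  then have "f differentiable_on UNIV" "g differentiable_on UNIV" by auto
  then have "pd i (\<lambda>x. f x * g x) = (\<lambda>x. pd i f x * g x + f x * pd i g x)" for i
    by (intro ext pd_mult) (auto simp: differentiable_on_def)
  moreover have "smooth_upto n f" "smooth_upto n g"
    using Suc.prems smooth_upto_Suc_D by blast+
  ultimately show ?case
    using Suc by (auto intro!: differentiable_on_mult smooth_upto_add)
qed (auto intro: differentiable_on_mult)

lemma smooth_add: "smooth f \<Longrightarrow> smooth g \<Longrightarrow> smooth (\<lambda>x. f x + g x)"
  and smooth_mult: "smooth f \<Longrightarrow> smooth g \<Longrightarrow> smooth (\<lambda>x. f x * g x)"
  by (simp_all add: smooth_iff_upto smooth_upto_add smooth_upto_mult)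

lemma smooth_const: "smooth (\<lambda>x. c)"
proof -
  have "smooth_upto n (\<lambda>x. c)" for n c
    by (induction n arbitrary: c) (auto simp: pd_const[abs_def])
  then show ?thesis by (simp add: smooth_iff_upto)
qed

lemma smooth_uminus: "smooth f \<Longrightarrow> smooth (\<lambda>x. - f x)"
  using smooth_mult[OF smooth_const[of "-1"], of f] by simp

section \<open>Symmetry of mixed partial derivatives\<close>

lemma pd_mean_value:
  assumes "smooth f" "h > 0"
  obtains s where "0 < s" "s < h" "f (x + h *\<^sub>R axis i 1) - f x = h * pd i f (x + s *\<^sub>R axis i 1)"
  using MVT2[OF assms(2), of "\<lambda>t. f (x + t *\<^sub>R axis i 1)" "\<lambda>t. pd i f (x + t *\<^sub>R axis i 1)"]
    smooth_line[OF assms(1)] by auto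

lemma smooth_shift: "smooth f \<Longrightarrow> smooth (\<lambda>x. f (x + v))"
  and pd_shift: "pd i (\<lambda>x. f (x + v)) x = pd i f (x + v)"
proof -
  show shift: "pd i (\<lambda>x. f (x + v)) x = pd i f (x + v)" for i f x
    by (simp add: pd_def algebra_simps)
  have diff: "(\<lambda>x. f (x + v)) differentiable_on UNIV" if "f differentiable_on UNIV" for f :: "real^3 \<Rightarrow> real"
  proof -
    have "f \<circ> (\<lambda>x. x + v) differentiable (at x)" for x
      using that by (intro differentiable_chain_at) (auto simp: differentiable_on_def)
    then show ?thesis by (simp add: differentiable_on_def o_def)
  qed
  have "smooth_upto n f \<Longrightarrow> smooth_upto n (\<lambda>x. f (x + v))" for n
    by (induction n arbitrary: f) (auto simp: diff shift[abs_def])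
  then show "smooth f \<Longrightarrow> smooth (\<lambda>x. f (x + v))" by (auto simp: smooth_iff_upto)
qed

text \<open>The mean value theorem is applied twice: in direction i to the difference of f and its
  shift by h e_j, then in direction j to \<open>pd i f\<close>. The left side is symmetric in i and
  j, the right side is not visibly so.\<close>

lemma mixed_difference:
  assumes f: "smooth f" and h: "h > 0"
  obtains s t where "0 < s" "s < h" "0 < t" "t < h"
    "f (x + h *\<^sub>R axis i 1 + h *\<^sub>R axis j 1) - f (x + h *\<^sub>R axis i 1) - f (x + h *\<^sub>R axis j 1) + f x
      = h * h * pd j (pd i f) (x + s *\<^sub>R axis i 1 + t *\<^sub>R axis j 1)"
proof -
  let ?F = "\<lambda>y. f (y + h *\<^sub>R axis j 1) + - f y"
  have F: "smooth ?F" by (intro smooth_add smooth_shift smooth_uminus f)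
  obtain s where s: "0 < s" "s < h" "?F (x + h *\<^sub>R axis i 1) - ?F x = h * pd i ?F (x + s *\<^sub>R axis i 1)"
    using pd_mean_value[OF F h] by blast
  let ?y = "x + s *\<^sub>R axis i 1"
  have d: "g differentiable (at y)" if "smooth g" for g y
    using that by (rule smooth_differentiable)
  have "pd i ?F ?y = pd i (\<lambda>y. f (y + h *\<^sub>R axis j 1)) ?y + pd i (\<lambda>y. - f y) ?y"
    by (intro pd_add d smooth_shift smooth_uminus f)
  also have "pd i (\<lambda>y. - f y) ?y = - pd i f ?y"
    using pd_cmult[OF d[OF f], of i "-1" ?y] by simp
  finally have F': "pd i ?F ?y = pd i f (?y + h *\<^sub>R axis j 1) - pd i f ?y" by (simp add: pd_shift)
  obtain t where t: "0 < t" "t < h"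
    "pd i f (?y + h *\<^sub>R axis j 1) - pd i f ?y = h * pd j (pd i f) (?y + t *\<^sub>R axis j 1)"
    using pd_mean_value[OF smooth_pd[OF f] h] by blast
  show ?thesis by (rule that[OF s(1,2) t(1,2)]) (use s(3) t(3) F' in \<open>simp add: algebra_simps\<close>)
qed

text \<open>Both mixed derivatives, taken at suitable points of an arbitrarily small square at x,
  equal the same second difference divided by h * h; continuity at x forces them to agree
  there.\<close>

lemma pd_commute:
  assumes f: "smooth f"
  shows "pd i (pd j f) x = pd j (pd i f) x"
proof (rule ccontr)
  assume ne: "pd i (pd j f) x \<noteq> pd j (pd i f) x"
  define e where "e = \<bar>pd i (pd j f) x - pd j (pd i f) x\<bar> / 2"
  have e: "e > 0" using ne by (simp add: e_def)
  have near: "\<exists>d>0. \<forall>y. dist y x < d \<longrightarrow> \<bar>g y - g x\<bar> < e" if "smooth g" for g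
    using smooth_isCont[OF that, of x] e
    by (auto simp: continuous_at_eps_delta dist_real_def dist_commute)
  obtain d1 where d1: "d1 > 0" "\<And>y. dist y x < d1 \<Longrightarrow> \<bar>pd i (pd j f) y - pd i (pd j f) x\<bar> < e"
    using near[of "pd i (pd j f)"] f by (auto intro: smooth_pd)
  obtain d2 where d2: "d2 > 0" "\<And>y. dist y x < d2 \<Longrightarrow> \<bar>pd j (pd i f) y - pd j (pd i f) x\<bar> < e"
    using near[of "pd j (pd i f)"] f by (auto intro: smooth_pd)
  \<comment> \<open>A sample point differs from x by two steps shorter than h, so a third of the
    radius keeps it inside both neighbourhoods.\<close>
  define h where "h = min d1 d2 / 3"
  have h: "h > 0" using d1 d2 by (simp add: h_def)
  have close: "dist (x + s *\<^sub>R axis k 1 + t *\<^sub>R axis l 1) x < min d1 d2"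
    if "0 < s" "s < h" "0 < t" "t < h" for s t k l
  proof -
    have "norm (s *\<^sub>R axis k (1::real) + t *\<^sub>R axis l 1 :: real^3) \<le> s + t"
      using that by (intro norm_triangle_le) simp
    moreover have "s + t < min d1 d2" using that d1(1) d2(1) by (simp add: h_def)
    ultimately show ?thesis by (simp add: dist_norm algebra_simps)
  qed
  obtain s t where st: "0 < s" "s < h" "0 < t" "t < h"
    "f (x + h *\<^sub>R axis i 1 + h *\<^sub>R axis j 1) - f (x + h *\<^sub>R axis i 1) - f (x + h *\<^sub>R axis j 1) + f x
      = h * h * pd j (pd i f) (x + s *\<^sub>R axis i 1 + t *\<^sub>R axis j 1)"
    using mixed_difference[OF f h] by blast
  obtain s' t' where st': "0 < s'" "s' < h" "0 < t'" "t' < h"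
    "f (x + h *\<^sub>R axis j 1 + h *\<^sub>R axis i 1) - f (x + h *\<^sub>R axis j 1) - f (x + h *\<^sub>R axis i 1) + f x
      = h * h * pd i (pd j f) (x + s' *\<^sub>R axis j 1 + t' *\<^sub>R axis i 1)"
    using mixed_difference[OF f h] by blast
  have "h * h * pd j (pd i f) (x + s *\<^sub>R axis i 1 + t *\<^sub>R axis j 1)
      = h * h * pd i (pd j f) (x + s' *\<^sub>R axis j 1 + t' *\<^sub>R axis i 1)"
    using st(5) st'(5) by (simp add: algebra_simps)
  with h have "pd j (pd i f) (x + s *\<^sub>R axis i 1 + t *\<^sub>R axis j 1)
      = pd i (pd j f) (x + s' *\<^sub>R axis j 1 + t' *\<^sub>R axis i 1)" by simp
  moreover have "\<bar>pd j (pd i f) (x + s *\<^sub>R axis i 1 + t *\<^sub>R axis j 1) - pd j (pd i f) x\<bar> < e"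
    using close[OF st(1-4)] by (intro d2) simp
  moreover have "\<bar>pd i (pd j f) (x + s' *\<^sub>R axis j 1 + t' *\<^sub>R axis i 1) - pd i (pd j f) x\<bar> < e"
    using close[OF st'(1-4)] by (intro d1) simp
  ultimately have "\<bar>pd i (pd j f) x - pd j (pd i f) x\<bar> < e + e"
    by linarith
  then show False by (simp add: e_def)
qed

lemma foldr_pd_swap:
  assumes "smooth f"
  shows "foldr pd (u @ i # j # w) f = foldr pd (u @ j # i # w) f"
proof -
  have "pd i (pd j (foldr pd w f)) = pd j (pd i (foldr pd w f))"
    by (rule ext) (rule pd_commute[OF smooth_foldr_pd[OF assms]])
  then show ?thesis by simp
qed

section \<open>The Schouten bracket with the Nambu bivector\<close>

text \<open>Elements are listed increasingly for 3 < 1 < 2. The bivector coefficients thus live at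
  \<open>{3, 1}\<close>, \<open>{3, 2}\<close>, \<open>{1, 2}\<close>; the pair (3,2) is the only
  one that is not cyclic, which is the source of all its minus signs below.\<close>

lemma set3_cases:
  fixes S :: "3 set"
  obtains "S = {}" | "S = {1}" | "S = {2}" | "S = {3}" | "S = {3, 1}" | "S = {3, 2}" | "S = {1, 2}"
    | "S = {3, 1, 2}"
proof -
  have "S \<in> Pow {1, 2, 3}" by (simp add: UNIV_3[symmetric])
  then show ?thesis using that unfolding Pow_insert Pow_empty image_insert image_empty by (elim UnE insertE emptyE) (auto simp: insert_commute)
qed

lemma less_3 [simp]: "(3::3) < 1" "(3::3) < 2" "(1::3) < 2" "\<not> (1::3) < 3" "\<not> (2::3) < 3" "\<not> (2::3) < 1"
  by (simp_all add: less_bit1_def bit1.Rep_numeral bit1.Rep_1)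

definition shuffle_sign :: "3 set \<Rightarrow> 3 set \<Rightarrow> real" where
  "shuffle_sign T S = (-1) ^ card {(i, j). i \<in> T \<and> j \<in> S - T \<and> j < i}"

lemma wedge_shuffle: "wedge A B S x = (\<Sum>T\<in>Pow S. shuffle_sign T S * A T x * B (S - T) x)"
  by (simp add: wedge_def shuffle_sign_def)

lemma shuffle_sign_simps [simp]: "shuffle_sign {} S = 1" "shuffle_sign S S = 1"
  by (simp_all add: shuffle_sign_def)

lemma shuffle_sign_2:
  assumes "p < q"
  shows "shuffle_sign {p} {p, q} = 1" "shuffle_sign {q} {p, q} = -1"
proof -
  have eq: "{(i, j). i \<in> {p} \<and> j \<in> {p, q} - {p} \<and> j < i} = {}"
    "{(i, j). i \<in> {q} \<and> j \<in> {p, q} - {q} \<and> j < i} = {(q, p)}"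
    using assms by auto
  show "shuffle_sign {p} {p, q} = 1" "shuffle_sign {q} {p, q} = -1"
    unfolding shuffle_sign_def eq by simp_all
qed

lemma wedge_1: "wedge A B {p} x = A {} x * B {p} x + A {p} x * B {} x"
proof -
  have "Pow {p} = {{}, {p}}" by auto
  then show ?thesis by (simp add: wedge_shuffle)
qed

lemma wedge_2:
  assumes "p < q"
  shows "wedge A B {p, q} x =
    A {} x * B {p, q} x + A {p} x * B {q} x - A {q} x * B {p} x + A {p, q} x * B {} x"
proof -
  have "{p, q} - {p} = {q}" "{p, q} - {q} = {p}" "p \<noteq> q" using assms by auto
  moreover have "Pow {p, q} = {{}, {p}, {q}, {p, q}}" by auto
  ultimately show ?thesis
    by (simp add: wedge_shuffle shuffle_sign_2[OF assms] doubleton_eq_iff)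
qed

text \<open>Degrees add: the two parts into which S is split cannot both have the right
  size.\<close>

lemma wedge_eq_0:
  assumes "\<And>T. card T \<noteq> m \<Longrightarrow> A T x = 0" "\<And>T. card T \<noteq> n \<Longrightarrow> B T x = 0" "card S \<noteq> m + n"
  shows "wedge A B S x = 0"
  unfolding wedge_def
proof (rule sum.neutral, rule ballI)
  fix T assume "T \<in> Pow S"
  then have "card S = card T + card (S - T)"
    by (metis PowD card_Diff_subset card_mono finite le_add_diff_inverse)
  with assms(3) have "card T \<noteq> m \<or> card (S - T) \<noteq> n" by auto
  with assms(1,2) show "(-1) ^ card {(i, j). i \<in> T \<and> j \<in> S - T \<and> j < i} * A T x * B (S - T) x = 0"
    by auto
qed

lemma wedge_xi: "wedge (xi i) (xi j) S x =
    (if i \<noteq> j \<and> S = {i, j} then if j < i then -1 else 1 else 0)"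
proof (cases "card S = 2")
  case True
  then obtain p q where S: "S = {p, q}" "p < q"
    by (metis card_2_iff insert_commute linorder_neqE)
  show ?thesis
    unfolding S(1) wedge_2[OF S(2)] using S(2) by (auto simp: xi_def doubleton_eq_iff)
next
  case False
  then have "\<not> (i \<noteq> j \<and> S = {i, j})" by auto
  moreover have "wedge (xi i) (xi j) S x = 0"
    by (rule wedge_eq_0[of 1 _ _ 1]) (use False in \<open>auto simp: xi_def\<close>)
  ultimately show ?thesis by auto
qed

lemma nambu_eq_0:
  assumes "card S \<noteq> 2"
  shows "nambu \<rho> a S x = 0"
proof -
  have "wedge (xi i) (xi j) S x = 0" for i j
    using assms by (auto simp: wedge_xi)
  then show ?thesis by (simp add: nambu_def)
qed

lemma nambu_simps:
  "nambu \<rho> a {3, 1} x = \<rho> x * pd 2 a x"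
  "nambu \<rho> a {3, 2} x = - \<rho> x * pd 1 a x"
  "nambu \<rho> a {1, 2} x = \<rho> x * pd 3 a x"
  by (simp_all add: nambu_def wedge_xi sum_3 levi_civita_def doubleton_eq_iff algebra_simps)

lemma pd_nambu:
  assumes "smooth \<rho>" "smooth a"
  shows "pd i (nambu \<rho> a {3, 1}) x = pd i \<rho> x * pd 2 a x + \<rho> x * pd i (pd 2 a) x"
    "pd i (nambu \<rho> a {3, 2}) x = - (pd i \<rho> x * pd 1 a x + \<rho> x * pd i (pd 1 a) x)"
    "pd i (nambu \<rho> a {1, 2}) x = pd i \<rho> x * pd 3 a x + \<rho> x * pd i (pd 3 a) x"
proof -
  have m: "pd i (\<lambda>x. \<rho> x * pd k a x) x = pd i \<rho> x * pd k a x + \<rho> x * pd i (pd k a) x" for k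
    by (intro pd_mult smooth_differentiable smooth_pd assms)
  have "nambu \<rho> a {3, 2} = (\<lambda>x. (-1) * (\<rho> x * pd 1 a x))" by (simp add: fun_eq_iff nambu_simps)
  then have "pd i (nambu \<rho> a {3, 2}) x = (-1) * pd i (\<lambda>x. \<rho> x * pd 1 a x) x"
    by (simp only:) (intro pd_cmult smooth_differentiable smooth_mult smooth_pd assms)
  with m show "pd i (nambu \<rho> a {3, 2}) x = - (pd i \<rho> x * pd 1 a x + \<rho> x * pd i (pd 1 a) x)"
    by simp
qed (use assms in \<open>simp_all add: nambu_simps[abs_def] pd_mult smooth_differentiable smooth_pd\<close>)

lemma smooth_nambu:
  assumes "smooth \<rho>" "smooth a"
  shows "smooth (nambu \<rho> a S)"
proof -
  have "smooth (\<lambda>x. \<rho> x * pd k a x)" "smooth (\<lambda>x. - \<rho> x * pd k a x)" for k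
    using assms by (auto intro!: smooth_mult smooth_uminus smooth_pd)
  moreover have "nambu \<rho> a S = (\<lambda>x. 0)" if "card S \<noteq> 2" for S
    using that by (simp add: fun_eq_iff nambu_eq_0)
  ultimately show ?thesis
    by (cases S rule: set3_cases) (simp_all add: nambu_simps[abs_def] smooth_const)
qed

definition vector_field :: "multivector \<Rightarrow> bool" where
  "vector_field X \<longleftrightarrow> (\<forall>S. card S \<noteq> 1 \<longrightarrow> X S = (\<lambda>x. 0)) \<and> (\<forall>i x. X {i} differentiable (at x))"

lemma pd_zero: "pd i (\<lambda>x. 0) = (\<lambda>x. 0)"
  by (simp add: fun_eq_iff)

lemma schouten_vector_field_eq_0:
  assumes "vector_field X" "card S \<noteq> 2"
  shows "schouten (nambu \<rho> a) X S x = 0"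
proof -
  have X: "X T = (\<lambda>x. 0)" if "card T \<noteq> 1" for T
    using assms(1) that by (auto simp: vector_field_def)
  have N: "nambu \<rho> a T = (\<lambda>x. 0)" if "card T \<noteq> 2" for T
    using that by (simp add: fun_eq_iff nambu_eq_0)
  have "wedge (right_deriv (<) i (nambu \<rho> a)) (\<lambda>T. pd i (X T)) S x = 0" for i
    by (rule wedge_eq_0[of 1 _ _ 1])
      (use assms(2) in \<open>auto simp: right_deriv_def X pd_zero nambu_eq_0\<close>)
  moreover have "wedge (\<lambda>T. pd i (nambu \<rho> a T)) (left_deriv (<) i X) S x = 0" for i
    by (rule wedge_eq_0[of 2 _ _ 0])
      (use assms(2) in \<open>auto simp: left_deriv_def X N pd_zero\<close>)
  ultimately show ?thesis by (simp add: schouten_def)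
qed

text \<open>Minus the k-th coefficient of the one-form f da + rho dg, where f = X.grad rho - rho div
  X is the first sum and g = X.grad a has been differentiated by the product rule.\<close>

definition bracket_coeff ::
  "(real^3 \<Rightarrow> real) \<Rightarrow> (real^3 \<Rightarrow> real) \<Rightarrow> (3 \<Rightarrow> real^3 \<Rightarrow> real) \<Rightarrow> 3 \<Rightarrow> real^3 \<Rightarrow> real" where
  "bracket_coeff \<rho> a X k x =
     - ((\<Sum>i\<in>UNIV. X i x * pd i \<rho> x - \<rho> x * pd i (X i) x) * pd k a x
        + \<rho> x * (\<Sum>i\<in>UNIV. pd k (X i) x * pd i a x + X i x * pd i (pd k a) x))"

lemma singleton_filter: "{j. j = c \<and> P j} = (if P c then {c} else {})"
  by auto

lemma schouten_vector_field:
  assumes \<rho>: "smooth \<rho>" and a: "smooth a" and X: "vector_field X"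
  shows "schouten (nambu \<rho> a) X {3, 1} x = bracket_coeff \<rho> a (\<lambda>i. X {i}) 2 x"
    "schouten (nambu \<rho> a) X {3, 2} x = - bracket_coeff \<rho> a (\<lambda>i. X {i}) 1 x"
    "schouten (nambu \<rho> a) X {1, 2} x = bracket_coeff \<rho> a (\<lambda>i. X {i}) 3 x"
proof -
  have X0: "X {} = (\<lambda>x. 0)" "X {3, 1} = (\<lambda>x. 0)" "X {3, 2} = (\<lambda>x. 0)" "X {1, 2} = (\<lambda>x. 0)"
    using X by (auto simp: vector_field_def)
  have N0: "nambu \<rho> a {} = (\<lambda>x. 0)" "nambu \<rho> a {i} = (\<lambda>x. 0)" for i
    by (simp_all add: fun_eq_iff nambu_eq_0)
  have c: "{1, 3} = {3, 1::3}" "{2, 3} = {3, 2::3}" "{2, 1} = {1, 2::3}" by auto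
  note s = schouten_def sum_3 wedge_2[OF less_3(1)] wedge_2[OF less_3(2)] wedge_2[OF less_3(3)] right_deriv_def
    left_deriv_def X0 N0 pd_zero pd_nambu[OF \<rho> a] nambu_simps bracket_coeff_def c singleton_filter
    pd_commute[OF a, of 1 2] pd_commute[OF a, of 1 3] pd_commute[OF a, of 2 3]
  show "schouten (nambu \<rho> a) X {3, 1} x = bracket_coeff \<rho> a (\<lambda>i. X {i}) 2 x"
    by (simp add: s) algebra
  show "schouten (nambu \<rho> a) X {3, 2} x = - bracket_coeff \<rho> a (\<lambda>i. X {i}) 1 x"
    by (simp add: s) algebra
  show "schouten (nambu \<rho> a) X {1, 2} x = bracket_coeff \<rho> a (\<lambda>i. X {i}) 3 x"
    by (simp add: s) algebra
qed

text \<open>A function contains no xi, so only the half of the bracket with a derivative of H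
  survives. The outcome is rho times the cross product of grad H and grad a.\<close>

lemma schouten_function:
  assumes H: "\<And>S. S \<noteq> {} \<Longrightarrow> H S = (\<lambda>x. 0)"
  shows "card S \<noteq> 1 \<Longrightarrow> schouten (nambu \<rho> a) H S x = 0"
    "schouten (nambu \<rho> a) H {1} x = \<rho> x * (pd 3 a x * pd 2 (H {}) x - pd 2 a x * pd 3 (H {}) x)"
    "schouten (nambu \<rho> a) H {2} x = \<rho> x * (pd 1 a x * pd 3 (H {}) x - pd 3 a x * pd 1 (H {}) x)"
    "schouten (nambu \<rho> a) H {3} x = \<rho> x * (pd 2 a x * pd 1 (H {}) x - pd 1 a x * pd 2 (H {}) x)"
proof -
  have N: "nambu \<rho> a T = (\<lambda>x. 0)" if "card T \<noteq> 2" for T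
    using that by (simp add: fun_eq_iff nambu_eq_0)
  have L: "left_deriv (<) i H = (\<lambda>S x. 0)" for i
    by (auto simp: left_deriv_def H fun_eq_iff)
  have W: "wedge A (\<lambda>S x. 0) S x = 0" for A S
    by (simp add: wedge_def)
  show "schouten (nambu \<rho> a) H S x = 0" if S: "card S \<noteq> 1"
  proof -
    have "wedge (right_deriv (<) i (nambu \<rho> a)) (\<lambda>T. pd i (H T)) S x = 0" for i
      by (rule wedge_eq_0[of 1 _ _ 0])
        (use S in \<open>auto simp: right_deriv_def H pd_zero nambu_eq_0\<close>)
    then show ?thesis by (simp add: schouten_def L W)
  qed
  have c: "{1, 3} = {3, 1::3}" "{2, 3} = {3, 2::3}" "{2, 1} = {1, 2::3}" by auto
  note s = schouten_def sum_3 wedge_1 right_deriv_def L W H pd_zero nambu_eq_0 nambu_simps c singleton_filter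
  show "schouten (nambu \<rho> a) H {1} x = \<rho> x * (pd 3 a x * pd 2 (H {}) x - pd 2 a x * pd 3 (H {}) x)"
    by (simp add: s) algebra
  show "schouten (nambu \<rho> a) H {2} x = \<rho> x * (pd 1 a x * pd 3 (H {}) x - pd 3 a x * pd 1 (H {}) x)"
    by (simp add: s) algebra
  show "schouten (nambu \<rho> a) H {3} x = \<rho> x * (pd 2 a x * pd 1 (H {}) x - pd 1 a x * pd 2 (H {}) x)"
    by (simp add: s) algebra
qed

section \<open>Evaluation of micro-graphs\<close>

text \<open>Contraction with the Levi-Civita symbol, reduced to its six nonzero entries;
  \<open>eps2\<close> has the first index held fixed. Nested contractions replace the 3^9
  decorations of a graph on three copies of P by 6^3 signed terms.\<close>

definition eps3 :: "(3 \<Rightarrow> 3 \<Rightarrow> 3 \<Rightarrow> real) \<Rightarrow> real" where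
  "eps3 h = h 1 2 3 + h 2 3 1 + h 3 1 2 - h 1 3 2 - h 3 2 1 - h 2 1 3"

definition eps2 :: "3 \<Rightarrow> (3 \<Rightarrow> 3 \<Rightarrow> real) \<Rightarrow> real" where
  "eps2 i h = (if i = 1 then h 2 3 - h 3 2 else if i = 2 then h 3 1 - h 1 3 else h 1 2 - h 2 1)"

lemma eps3_levi_civita: "(\<Sum>i\<in>UNIV. \<Sum>j\<in>UNIV. \<Sum>k\<in>UNIV. levi_civita i j k * h i j k) = eps3 h"
  by (simp add: sum_3 levi_civita_def eps3_def)

lemma eps3_eps2: "eps3 (\<lambda>i j k. if i = l then h j k else 0) = eps2 l h"
  using exhaust_3[of l] by (auto simp: eps3_def eps2_def)

lemma eps3_0 [simp]: "eps3 (\<lambda>_ _ _. 0) = 0"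
  by (simp add: eps3_def)

text \<open>With \<open>ts\<close> the flattened encoding and \<open>is\<close> the indices of its
  edges, this is the derivative word of the vertex \<open>v\<close>, in the same edge order as
  \<open>incoming\<close>.\<close>

definition word :: "nat \<Rightarrow> nat list \<Rightarrow> 3 list \<Rightarrow> 3 list" where
  "word v ts is = map fst (filter (\<lambda>(i, t). t = v) (zip is ts))"

lemma word_map: "word v (map f es) (map D es) = map D (filter (\<lambda>e. f e = v) es)"
  by (induction es) (simp_all add: word_def)

lemma sum_PiE_insert:
  assumes "finite K" "k \<notin> K"
  shows "(\<Sum>D\<in>insert k K \<rightarrow>\<^sub>E (UNIV :: 'b::finite set). g D) =
    (\<Sum>i\<in>UNIV. \<Sum>D\<in>K \<rightarrow>\<^sub>E UNIV. g (D(k := i)) :: real)"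
proof -
  have "(\<Sum>D\<in>insert k K \<rightarrow>\<^sub>E (UNIV :: 'b set). g D) =
    (\<Sum>(i, D)\<in>UNIV \<times> (K \<rightarrow>\<^sub>E UNIV). g (D(k := i)))"
    unfolding PiE_insert_eq
    by (subst sum.reindex)
      (use inj_combinator[OF assms(2), of "\<lambda>_. UNIV"] in \<open>simp_all add: case_prod_unfold o_def\<close>)
  then show ?thesis by (simp add: sum.cartesian_product)
qed

lemma sum_PiE_levi_civita:
  assumes "finite K" "e1 \<notin> K" "e2 \<notin> K" "e3 \<notin> K"
    "e1 \<noteq> e2" "e2 \<noteq> e1" "e1 \<noteq> e3" "e3 \<noteq> e1" "e2 \<noteq> e3" "e3 \<noteq> e2"
  shows "(\<Sum>D\<in>insert e1 (insert e2 (insert e3 K)) \<rightarrow>\<^sub>E UNIV. levi_civita (D e1) (D e2) (D e3) * g D) =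
    eps3 (\<lambda>i j k. \<Sum>D\<in>K \<rightarrow>\<^sub>E UNIV. g (D(e3 := k, e2 := j, e1 := i)))"
  using assms by (simp add: sum_PiE_insert sum_distrib_left[symmetric] eps3_levi_civita)

fun eps_nest :: "nat \<Rightarrow> (3 list \<Rightarrow> real) \<Rightarrow> real" where
  "eps_nest 0 F = F []"
| "eps_nest (Suc n) F = eps3 (\<lambda>i j k. eps_nest n (\<lambda>r. F (i # j # k # r)))"

text \<open>A triple in \<open>bs\<close> holds the edges of one Levi-Civita vertex. The symbol of
  that vertex sees only its own triple, so the sum over all decorations becomes one nested
  contraction per vertex.\<close>

lemma sum_decorations:
  assumes "distinct (concat (map (\<lambda>(e1, e2, e3). [e1, e2, e3]) bs))" (is "distinct (?flat bs)")
  shows "(\<Sum>D\<in>set (?flat bs) \<rightarrow>\<^sub>E UNIV.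
      prod_list (map (\<lambda>(e1, e2, e3). levi_civita (D e1) (D e2) (D e3)) bs) * F (map D (?flat bs))) =
    eps_nest (length bs) F"
  using assms
proof (induction bs arbitrary: F)
  case (Cons b bs)
  obtain e1 e2 e3 where b: "b = (e1, e2, e3)" by (cases b)
  have new: "e1 \<notin> set (?flat bs)" "e2 \<notin> set (?flat bs)" "e3 \<notin> set (?flat bs)"
    "e1 \<noteq> e2" "e2 \<noteq> e1" "e1 \<noteq> e3" "e3 \<noteq> e1" "e2 \<noteq> e3" "e3 \<noteq> e2"
    using Cons.prems b by auto
  let ?L = "\<lambda>D. prod_list (map (\<lambda>(e1, e2, e3). levi_civita (D e1) (D e2) (D e3)) bs)"
  have upd: "(D(e3 := k, e2 := j, e1 := i)) e = D e" if "e \<in> set (?flat bs)" for D i j k e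
    using new that by (auto simp del: set_concat)
  have at: "(D(e3 := k, e2 := j, e1 := i)) e1 = i" "(D(e3 := k, e2 := j, e1 := i)) e2 = j"
    "(D(e3 := k, e2 := j, e1 := i)) e3 = k" for D i j k
    using new by auto
  have old: "?L (D(e3 := k, e2 := j, e1 := i)) = ?L D"
    "map (D(e3 := k, e2 := j, e1 := i)) (?flat bs) = map D (?flat bs)" for D i j k
  proof -
    have "(case b of (e1', e2', e3') \<Rightarrow> levi_civita ((D(e3 := k, e2 := j, e1 := i)) e1')
        ((D(e3 := k, e2 := j, e1 := i)) e2') ((D(e3 := k, e2 := j, e1 := i)) e3')) =
      (case b of (e1', e2', e3') \<Rightarrow> levi_civita (D e1') (D e2') (D e3'))" if "b \<in> set bs" for b
    proof -
      obtain a1 a2 a3 where a: "b = (a1, a2, a3)" by (cases b)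
      with that have "{a1, a2, a3} \<subseteq> set (?flat bs)" by force
      then show ?thesis by (simp only: a case_prod_conv upd insert_subset)
    qed
    then show "?L (D(e3 := k, e2 := j, e1 := i)) = ?L D"
      by (intro arg_cong[of _ _ prod_list] map_cong refl)
    show "map (D(e3 := k, e2 := j, e1 := i)) (?flat bs) = map D (?flat bs)"
      by (rule map_cong[OF refl upd])
  qed
  have "(\<Sum>D\<in>set (?flat (b # bs)) \<rightarrow>\<^sub>E UNIV.
      prod_list (map (\<lambda>(e1, e2, e3). levi_civita (D e1) (D e2) (D e3)) (b # bs)) * F (map D (?flat (b # bs)))) =
    (\<Sum>D\<in>insert e1 (insert e2 (insert e3 (set (?flat bs)))) \<rightarrow>\<^sub>E UNIV.
      levi_civita (D e1) (D e2) (D e3) * (?L D * F (D e1 # D e2 # D e3 # map D (?flat bs))))"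
    by (simp add: b mult.assoc)
  also have "\<dots> = eps3 (\<lambda>i j k. \<Sum>D\<in>set (?flat bs) \<rightarrow>\<^sub>E UNIV.
      ?L D * F (i # j # k # map D (?flat bs)))"
    by (subst sum_PiE_levi_civita[OF finite_set new]) (simp only: old at)
  also have "\<dots> = eps3 (\<lambda>i j k. eps_nest (length bs) (\<lambda>r. F (i # j # k # r)))"
    using Cons.prems b by (intro arg_cong[of _ _ eps3] ext Cons.IH) auto
  finally show ?case by simp
qed simp

lemma sum_decorations_3:
  "(\<Sum>D\<in>{1..3::nat} \<times> {1..3::nat} \<rightarrow>\<^sub>E (UNIV :: 3 set).
      levi_civita (D (1, 1)) (D (1, 2)) (D (1, 3)) * levi_civita (D (2, 1)) (D (2, 2)) (D (2, 3)) *
      levi_civita (D (3, 1)) (D (3, 2)) (D (3, 3)) *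
      F (map D [(1,1), (1,2), (1,3), (2,1), (2,2), (2,3), (3,1), (3,2), (3,3)])) =
   eps3 (\<lambda>i1 i2 i3. eps3 (\<lambda>i4 i5 i6. eps3 (\<lambda>i7 i8 i9. F [i1, i2, i3, i4, i5, i6, i7, i8, i9])))"
proof -
  have "{1..3::nat} = set [1, 2, 3]" by auto
  then have "{1..3::nat} \<times> {1..3::nat} =
    set [(1,1), (1,2), (1,3), (2,1), (2,2), (2,3), (3,1), (3,2), (3,3)]"
    by (simp only: set_product[symmetric]) simp
  with sum_decorations[of
    "[((1,1), (1,2), (1,3)), ((2,1), (2,2), (2,3)), ((3,1), (3,2), (3,3))]
      :: ((nat \<times> nat) \<times> (nat \<times> nat) \<times> (nat \<times> nat)) list" F]
  show ?thesis by (simp only: list.map concat.simps append.simps prod_list.Cons prod_list.Nil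
      case_prod_conv mult.assoc mult_1_right list.size add_0 plus_nat.simps eps_nest.simps) simp
qed

lemma sum_decorations_2:
  "(\<Sum>D\<in>{1..2::nat} \<times> {1..3::nat} \<rightarrow>\<^sub>E (UNIV :: 3 set).
      levi_civita (D (1, 1)) (D (1, 2)) (D (1, 3)) * levi_civita (D (2, 1)) (D (2, 2)) (D (2, 3)) *
      F (map D [(1,1), (1,2), (1,3), (2,1), (2,2), (2,3)])) =
   eps3 (\<lambda>i1 i2 i3. eps3 (\<lambda>i4 i5 i6. F [i1, i2, i3, i4, i5, i6]))"
proof -
  have "{1..2::nat} = set [1, 2]" "{1..3::nat} = set [1, 2, 3]" by auto
  then have "{1..2::nat} \<times> {1..3::nat} = set [(1,1), (1,2), (1,3), (2,1), (2,2), (2,3)]"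
    by (simp only: set_product[symmetric]) simp
  with sum_decorations[of
    "[((1,1), (1,2), (1,3)), ((2,1), (2,2), (2,3))]
      :: ((nat \<times> nat) \<times> (nat \<times> nat) \<times> (nat \<times> nat)) list" F]
  show ?thesis by (simp only: list.map concat.simps append.simps prod_list.Cons prod_list.Nil
      case_prod_conv mult.assoc mult_1_right list.size add_0 plus_nat.simps eps_nest.simps) simp
qed

definition mono3 :: "nat list \<Rightarrow> (3 list \<Rightarrow> real) \<Rightarrow> (3 list \<Rightarrow> real) \<Rightarrow> 3 list \<Rightarrow> real" where
  "mono3 ts R A is = R (word 1 ts is) * R (word 2 ts is) * R (word 3 ts is) *
     (A (word 4 ts is) * A (word 5 ts is) * A (word 6 ts is))"

definition mono2 :: "nat list \<Rightarrow> (3 list \<Rightarrow> real) \<Rightarrow> (3 list \<Rightarrow> real) \<Rightarrow> 3 list \<Rightarrow> real" where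
  "mono2 ts R A is = R (word 1 ts is) * R (word 2 ts is) * (A (word 3 ts is) * A (word 4 ts is))"

lemma phi_3:
  assumes "G = [[t1, t2, t3], [t4, t5, t6], [t7, t8, t9]]"
  shows "phi G \<rho> a S x =
    eps3 (\<lambda>i1 i2 i3. eps3 (\<lambda>i4 i5 i6. eps3 (\<lambda>i7 i8 i9.
      mono3 (concat G) (\<lambda>w. foldr pd w \<rho> x) (\<lambda>w. foldr pd w a x) [i1, i2, i3, i4, i5, i6, i7, i8, i9] *
      (if S = set (word 0 (concat G) [i1, i2, i3, i4, i5, i6, i7, i8, i9]) then 1 else 0))))"
proof -
  let ?es = "[(1,1), (1,2), (1,3), (2,1), (2,2), (2,3), (3,1), (3,2), (3,3)] :: (nat \<times> nat) list"
  have es: "List.product [1..<length G + 1] [1..<4] = ?es"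
    by (simp add: assms upt_rec)
  have ts: "concat G = map (\<lambda>(k, e). target G k e) ?es"
    by (simp add: assms target_def)
  have inc: "map D (incoming G v) = word v (concat G) (map D ?es)" for D v
    unfolding ts word_map incoming_def es by (simp add: case_prod_unfold)
  have "phi G \<rho> a S x = (\<Sum>D\<in>{1..3} \<times> {1..3} \<rightarrow>\<^sub>E UNIV.
      levi_civita (D (1, 1)) (D (1, 2)) (D (1, 3)) * levi_civita (D (2, 1)) (D (2, 2)) (D (2, 3)) *
      levi_civita (D (3, 1)) (D (3, 2)) (D (3, 3)) *
      (mono3 (concat G) (\<lambda>w. foldr pd w \<rho> x) (\<lambda>w. foldr pd w a x) (map D ?es) *
      (if S = set (word 0 (concat G) (map D ?es)) then 1 else 0)))"
  proof -
    have "length G = 3" "{1..3::nat} = {1, 2, 3}" by (auto simp: assms)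
    then show ?thesis
      unfolding phi_def inc by (simp add: mono3_def mult.assoc)
  qed
  then show ?thesis
    unfolding sum_decorations_3[where F = "\<lambda>is. mono3 (concat G) (\<lambda>w. foldr pd w \<rho> x) (\<lambda>w. foldr pd w a x) is *
      (if S = set (word 0 (concat G) is) then 1 else 0)"] .
qed

lemma phi_2:
  assumes "G = [[t1, t2, t3], [t4, t5, t6]]" "0 \<notin> {t1, t2, t3, t4, t5, t6}"
  shows "phi G \<rho> a S x = (if S = {} then
    eps3 (\<lambda>i1 i2 i3. eps3 (\<lambda>i4 i5 i6.
      mono2 (concat G) (\<lambda>w. foldr pd w \<rho> x) (\<lambda>w. foldr pd w a x) [i1, i2, i3, i4, i5, i6])) else 0)"
proof -
  let ?es = "[(1,1), (1,2), (1,3), (2,1), (2,2), (2,3)] :: (nat \<times> nat) list"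
  have es: "List.product [1..<length G + 1] [1..<4] = ?es"
    by (simp add: assms upt_rec)
  have ts: "concat G = map (\<lambda>(k, e). target G k e) ?es"
    by (simp add: assms target_def)
  have inc: "map D (incoming G v) = word v (concat G) (map D ?es)" for D v
    unfolding ts word_map incoming_def es by (simp add: case_prod_unfold)
  have no_sink: "word 0 (concat G) (map D ?es) = []" for D
    using assms by (simp add: word_def)
  let ?m = "\<lambda>is. mono2 (concat G) (\<lambda>w. foldr pd w \<rho> x) (\<lambda>w. foldr pd w a x) is"
  have m: "(\<Prod>k = 1..2. foldr pd (word k (concat G) is) \<rho> x) *
      (\<Prod>k = 1..2. foldr pd (word (2 + k) (concat G) is) a x) = ?m is" for "is"
  proof -
    have "{1..2::nat} = {1, 2}" "(2::nat) + 1 = 3" "(2::nat) + 2 = 4" by auto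
    then show ?thesis by (simp add: mono2_def numeral_eq_Suc)
  qed
  have l: "(\<Prod>k = 1..2. levi_civita (D (k, 1)) (D (k, 2)) (D (k, 3))) =
      levi_civita (D (1, 1)) (D (1, 2)) (D (1, 3)) * levi_civita (D (2, 1)) (D (2, 2)) (D (2, 3))"
    for D :: "nat \<times> nat \<Rightarrow> 3"
  proof -
    have "{1..2::nat} = {1, 2}" by auto
    then show ?thesis by simp
  qed
  have "length G = 2" by (simp add: assms)
  then have "phi G \<rho> a S x = (\<Sum>D\<in>{1..2} \<times> {1..3} \<rightarrow>\<^sub>E UNIV.
      levi_civita (D (1, 1)) (D (1, 2)) (D (1, 3)) * levi_civita (D (2, 1)) (D (2, 2)) (D (2, 3)) *
      (?m (map D ?es) * (if S = {} then 1 else 0)))"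
    unfolding phi_def inc no_sink l[symmetric] m[symmetric] by (simp only: list.set mult.assoc)
  also have "\<dots> = eps3 (\<lambda>i1 i2 i3. eps3 (\<lambda>i4 i5 i6. ?m [i1, i2, i3, i4, i5, i6] * (if S = {} then 1 else 0)))"
    by (rule sum_decorations_2[where F = "\<lambda>is. ?m is * (if S = {} then 1 else 0)"])
  finally show ?thesis by simp
qed

definition comp3 :: "graph \<Rightarrow> (3 list \<Rightarrow> real) \<Rightarrow> (3 list \<Rightarrow> real) \<Rightarrow> 3 \<Rightarrow> real" where
  "comp3 G R A i = eps2 i (\<lambda>i2 i3. eps3 (\<lambda>i4 i5 i6. eps3 (\<lambda>i7 i8 i9.
     mono3 (concat G) R A [i, i2, i3, i4, i5, i6, i7, i8, i9])))"

definition comp2 :: "graph \<Rightarrow> (3 list \<Rightarrow> real) \<Rightarrow> (3 list \<Rightarrow> real) \<Rightarrow> real" where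
  "comp2 G R A = eps3 (\<lambda>i1 i2 i3. eps3 (\<lambda>i4 i5 i6. mono2 (concat G) R A [i1, i2, i3, i4, i5, i6]))"

text \<open>With the sink edge as first edge of vertex 1, taking the component at i just fixes the
  first index, and vertex 1 contributes \<open>eps2 i\<close>.\<close>

definition sink_first :: "graph \<Rightarrow> bool" where
  "sink_first G \<longleftrightarrow> (\<exists>t2 t3 t4 t5 t6 t7 t8 t9. G = [[0, t2, t3], [t4, t5, t6], [t7, t8, t9]] \<and>
     0 \<notin> {t2, t3, t4, t5, t6, t7, t8, t9})"

lemma phi_comp3:
  assumes "sink_first G"
  shows "phi G \<rho> a {i} x = comp3 G (\<lambda>w. foldr pd w \<rho> x) (\<lambda>w. foldr pd w a x) i"
    "card S \<noteq> 1 \<Longrightarrow> phi G \<rho> a S x = 0"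
proof -
  obtain t2 t3 t4 t5 t6 t7 t8 t9 where G: "G = [[0, t2, t3], [t4, t5, t6], [t7, t8, t9]]"
    and t: "0 \<notin> {t2, t3, t4, t5, t6, t7, t8, t9}"
    using assms by (auto simp: sink_first_def)
  have w: "word 0 (concat G) [i1, i2, i3, i4, i5, i6, i7, i8, i9] = [i1]" for i1 i2 i3 i4 i5 i6 i7 i8 i9
    using t by (simp add: G word_def)
  note p = phi_3[OF G, of \<rho> a _ x, unfolded w]
  show "phi G \<rho> a S x = 0" if "card S \<noteq> 1"
  proof -
    have "S \<noteq> set [i1]" for i1 using that by auto
    then show ?thesis unfolding p by (simp add: eps3_def)
  qed
  have "phi G \<rho> a {i} x = eps3 (\<lambda>i1 i2 i3. if i1 = i then eps3 (\<lambda>i4 i5 i6. eps3 (\<lambda>i7 i8 i9.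
      mono3 (concat G) (\<lambda>w. foldr pd w \<rho> x) (\<lambda>w. foldr pd w a x) [i, i2, i3, i4, i5, i6, i7, i8, i9])) else 0)"
    unfolding p by (intro arg_cong[of _ _ eps3] ext) (auto simp: eps3_def)
  then show "phi G \<rho> a {i} x = comp3 G (\<lambda>w. foldr pd w \<rho> x) (\<lambda>w. foldr pd w a x) i"
    by (simp only: eps3_eps2 comp3_def)
qed

section \<open>Invariance of graph evaluations under the cyclic shift of coordinates\<close>

definition rot :: "3 \<Rightarrow> 3" where
  "rot i = (if i = 1 then 2 else if i = 2 then 3 else 1)"

lemma rot_simps [simp]: "rot 1 = 2" "rot 2 = 3" "rot 3 = 1"
  by (simp_all add: rot_def)

definition rotj :: "(3 list \<Rightarrow> real) \<Rightarrow> 3 list \<Rightarrow> real" where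
  "rotj R w = R (map rot w)"

lemma eps3_rot: "eps3 (\<lambda>i j k. h (rot i) (rot j) (rot k)) = eps3 h"
  by (simp add: eps3_def)

lemma eps2_rot: "eps2 i (\<lambda>j k. h (rot j) (rot k)) = eps2 (rot i) h"
  using exhaust_3[of i] by (auto simp: eps2_def)

lemma word_rot: "map rot (word v ts is) = word v ts (map rot is)"
  by (simp add: word_def zip_map1 filter_map o_def case_prod_unfold)

lemma mono3_rot: "mono3 ts (rotj R) (rotj A) is = mono3 ts R A (map rot is)"
  by (simp add: mono3_def rotj_def word_rot)

text \<open>The shift is an even permutation and preserves every contraction with the Levi-Civita
  symbol; it is pushed inwards one vertex at a time. Identities for component 1 thereby yield those
  for components 2 and 3.\<close>

lemma comp3_rot: "comp3 G (rotj R) (rotj A) i = comp3 G R A (rot i)"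
proof -
  let ?m = "mono3 (concat G) R A"
  let ?h1 = "\<lambda>i2 i3. eps3 (\<lambda>i4 i5 i6. eps3 (\<lambda>i7 i8 i9. ?m [rot i, i2, i3, i4, i5, i6, i7, i8, i9]))"
  let ?h2 = "\<lambda>i2 i3 i4 i5 i6. eps3 (\<lambda>i7 i8 i9. ?m [rot i, i2, i3, i4, i5, i6, i7, i8, i9])"
  let ?h3 = "\<lambda>i2 i3 i4 i5 i6 i7 i8 i9. ?m [rot i, i2, i3, i4, i5, i6, i7, i8, i9]"
  have h1: "?h1 i2 i3 = eps3 (\<lambda>i4 i5 i6. ?h2 i2 i3 (rot i4) (rot i5) (rot i6))" for i2 i3
    by (rule eps3_rot[of "?h2 i2 i3", symmetric])
  have h2: "?h2 i2 i3 i4 i5 i6 = eps3 (\<lambda>i7 i8 i9. ?h3 i2 i3 i4 i5 i6 (rot i7) (rot i8) (rot i9))"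
    for i2 i3 i4 i5 i6
    by (rule eps3_rot[of "?h3 i2 i3 i4 i5 i6", symmetric])
  have "comp3 G R A (rot i) = eps2 i (\<lambda>i2 i3. ?h1 (rot i2) (rot i3))"
    unfolding comp3_def by (rule eps2_rot[of i ?h1, symmetric])
  also have "\<dots> = eps2 i (\<lambda>i2 i3. eps3 (\<lambda>i4 i5 i6. ?h2 (rot i2) (rot i3) (rot i4) (rot i5) (rot i6)))"
    by (rule arg_cong[of _ _ "eps2 i"]) (intro ext h1)
  also have "\<dots> = eps2 i (\<lambda>i2 i3. eps3 (\<lambda>i4 i5 i6. eps3 (\<lambda>i7 i8 i9.
      ?h3 (rot i2) (rot i3) (rot i4) (rot i5) (rot i6) (rot i7) (rot i8) (rot i9))))"
    by (rule arg_cong[of _ _ "eps2 i"], rule ext, rule ext, rule arg_cong[of _ _ eps3]) (intro ext h2)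
  finally show ?thesis by (simp only: comp3_def mono3_rot list.map)
qed

section \<open>The tetrahedral flow\<close>

text \<open>The value at \<open>(T, p)\<close> of the tensor obtained by applying the edges \<open>es\<close>, the last one first, after
  the factor \<open>a\<close> has been differentiated along \<open>\<alpha> a\<close>.\<close>

fun contract ::
  "multivector \<Rightarrow> (nat \<times> nat) list \<Rightarrow> (nat \<times> 3) set \<Rightarrow> (nat \<Rightarrow> 3 list) \<Rightarrow> (nat \<Rightarrow> real^3) \<Rightarrow> real" where
  "contract P [] T \<alpha> p =
     (if fst ` T \<subseteq> {1..4} then \<Prod>a\<in>{1..4}. foldr pd (\<alpha> a) (P {\<mu>. (a, \<mu>) \<in> T}) (p a) else 0)"
| "contract P ((a, b) # es) T \<alpha> p = (\<Sum>\<mu>\<in>UNIV.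
     (if (a, \<mu>) \<in> T then 0 else (-1) ^ card {j \<in> T. lex_less j (a, \<mu>)} *
        contract P es (insert (a, \<mu>) T) (\<alpha>(b := \<alpha> b @ [\<mu>])) p) +
     (if (b, \<mu>) \<in> T then 0 else (-1) ^ card {j \<in> T. lex_less j (b, \<mu>)} *
        contract P es (insert (b, \<mu>) T) (\<alpha>(a := \<alpha> a @ [\<mu>])) p))"

lemma DERIV_if_zero:
  "(\<not> Q \<Longrightarrow> (f has_real_derivative D) (at r)) \<Longrightarrow>
    ((\<lambda>t. if Q then 0 else c * f t) has_real_derivative (if Q then 0 else c * D)) (at r)"
  by (auto intro: DERIV_cmult)

text \<open>The first letter of a word is the outermost derivative. The recursion appends the
  letters of edges further inside, a derivative taken outside everything is prepended, and the two
  updates do not interfere.\<close>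

lemma contract_derivative:
  assumes "\<And>S. smooth (P S)" "c \<in> {1..4}"
  shows "((\<lambda>t. contract P es T \<alpha> (p(c := p c + t *\<^sub>R axis \<nu> 1))) has_real_derivative
    contract P es T (\<alpha>(c := \<nu> # \<alpha> c)) p) (at 0)"
proof (induction es arbitrary: T \<alpha>)
  case Nil
  let ?f = "\<lambda>a. foldr pd (\<alpha> a) (P {\<mu>. (a, \<mu>) \<in> T})"
  have "((\<lambda>t. ?f c (p c + t *\<^sub>R axis \<nu> 1)) has_real_derivative pd \<nu> (?f c) (p c)) (at 0)"
    by (intro differentiable_line0 smooth_differentiable smooth_foldr_pd assms(1))
  then have "((\<lambda>t. ?f c (p c + t *\<^sub>R axis \<nu> 1) * (\<Prod>a\<in>{1..4} - {c}. ?f a (p a)))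
    has_real_derivative pd \<nu> (?f c) (p c) * (\<Prod>a\<in>{1..4} - {c}. ?f a (p a))) (at 0)"
    by (rule DERIV_cmult_right)
  moreover have "(\<Prod>a\<in>{1..4}. g a) = g c * (\<Prod>a\<in>{1..4} - {c}. g a)" for g :: "nat \<Rightarrow> real"
    using assms(2) by (intro prod.remove) auto
  ultimately show ?case by simp
next
  case (Cons e es)
  obtain a b where e: "e = (a, b)" by (cases e)
  have upd: "(\<alpha>(c := \<nu> # \<alpha> c))(b := (\<alpha>(c := \<nu> # \<alpha> c)) b @ [\<mu>]) =
    (\<alpha>(b := \<alpha> b @ [\<mu>]))(c := \<nu> # (\<alpha>(b := \<alpha> b @ [\<mu>])) c)" for b \<mu>
    by (auto simp: fun_eq_iff)
  show ?case
    unfolding e contract.simps upd by (intro DERIV_sum DERIV_add DERIV_if_zero Cons.IH)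
qed

lemma foldr_edge_op:
  assumes "\<And>S. smooth (P S)" "set es \<subseteq> {1..4} \<times> {1..4}"
  shows "foldr edge_op es (tensor4 P) T p = contract P es T (\<lambda>_. []) p"
  using assms(2)
proof (induction es arbitrary: T p)
  case Nil
  then show ?case by (simp add: tensor4_def)
next
  case (Cons e es)
  obtain a b where e: "e = (a, b)" and ab: "a \<in> {1..4}" "b \<in> {1..4}"
    using Cons.prems by (cases e) auto
  have F: "foldr edge_op es (tensor4 P) = (\<lambda>T p. contract P es T (\<lambda>_. []) p)"
    using Cons by (intro ext) auto
  have D: "tensor_pd c \<mu> (\<lambda>T p. contract P es T (\<lambda>_. []) p) T p = contract P es T ((\<lambda>_. [])(c := [\<mu>])) p"
    if "c \<in> {1..4}" for c \<mu> T p
    unfolding tensor_pd_def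
    by (rule DERIV_imp_deriv)
      (rule contract_derivative[OF assms(1) that, where es = es and \<alpha> = "\<lambda>_. []"])
  have "foldr edge_op (e # es) (tensor4 P) T p = edge_op (a, b) (\<lambda>T p. contract P es T (\<lambda>_. []) p) T p"
    by (simp only: e foldr_Cons o_apply F)
  with ab show ?case
    by (simp add: e edge_op_def D left_deriv_def cong: if_cong)
qed

text \<open>Each edge puts one more variable into T, and four factors of degree two hold exactly
  eight.\<close>

lemma contract_eq_0:
  assumes "\<And>S. card S \<noteq> 2 \<Longrightarrow> P S = (\<lambda>x. 0)" "finite T" "card T + length es \<noteq> 8"
  shows "contract P es T \<alpha> p = 0"
  using assms(2,3)
proof (induction es arbitrary: T \<alpha>)
  case Nil
  show ?case
  proof (cases "fst ` T \<subseteq> {1..4}")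
    case True
    have "T = (\<Union>a\<in>{1..4}. Pair a ` {\<mu>. (a, \<mu>) \<in> T})"
      using True by force
    then have "card T = card (\<Union>a\<in>{1..4}. Pair a ` {\<mu>. (a, \<mu>) \<in> T})" by simp
    also have "\<dots> = (\<Sum>a\<in>{1..4}. card (Pair a ` {\<mu>. (a, \<mu>) \<in> T}))"
      by (rule card_UN_disjoint) auto
    also have "\<dots> = (\<Sum>a\<in>{1..4}. card {\<mu>. (a, \<mu>) \<in> T})"
      by (simp add: card_image inj_on_def)
    finally have c: "card T = (\<Sum>a\<in>{1..4}. card {\<mu>. (a, \<mu>) \<in> T})" .
    have "\<exists>a\<in>{1..4}. card {\<mu>. (a, \<mu>) \<in> T} \<noteq> 2"
    proof (rule ccontr)
      assume "\<not> ?thesis"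
      then have "card T = (\<Sum>a\<in>{1..4::nat}. 2)" using c by simp
      with Nil show False by simp
    qed
    then obtain a where a: "a \<in> {1..4}" "P {\<mu>. (a, \<mu>) \<in> T} = (\<lambda>x. 0)" using assms(1) by blast
    have "foldr pd w (\<lambda>x. 0) = (\<lambda>x. 0)" for w
      by (induction w) (simp_all add: pd_zero)
    with a show ?thesis by (auto intro!: prod_zero bexI[of _ a])
  qed simp
next
  case (Cons e es)
  then show ?case
    by (cases e) (auto intro!: sum.neutral)
qed

text \<open>Variables are only ever added to T, so a factor that already has all three keeps them,
  whereas P has degree two.\<close>

lemma contract_full:
  assumes "\<And>S. card S \<noteq> 2 \<Longrightarrow> P S = (\<lambda>x. 0)" "c \<in> {1..4}" "\<And>\<mu>. (c, \<mu>) \<in> T"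
  shows "contract P es T \<alpha> p = 0"
  using assms(3)
proof (induction es arbitrary: T \<alpha>)
  case Nil
  have "card (UNIV :: 3 set) \<noteq> 2" by simp
  moreover have "foldr pd w (\<lambda>x. 0) = (\<lambda>x. 0)" for w
    by (induction w) (simp_all add: pd_zero)
  ultimately have "foldr pd (\<alpha> c) (P {\<mu>. (c, \<mu>) \<in> T}) (p c) = 0"
    using Nil assms(1)[of "{\<mu>. (c, \<mu>) \<in> T}"] by simp
  with assms(2) show ?case by (auto intro: prod_zero)
next
  case (Cons e es)
  then show ?case
    by (cases e) (auto intro!: sum.neutral)
qed

text \<open>The admissible T choose a factor a to carry xi_i and a factor b to carry xi_j. Sorting
  costs a sign precisely when the carrier of the larger variable comes first.\<close>

lemma multiply4_pair:
  assumes ij: "i < j"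
  shows "multiply4 F {i, j} x =
    (\<Sum>a\<in>{1..4}. \<Sum>b\<in>{1..4}. (if b < a then -1 else 1) * F {(a, i), (b, j)} (\<lambda>_. x))"
proof -
  let ?g = "\<lambda>(a, b). {(a, i), (b, j)}"
  have inj: "inj_on ?g ({1..4::nat} \<times> {1..4::nat})"
    using ij by (auto simp: inj_on_def doubleton_eq_iff)
  have img: "?g ` ({1..4} \<times> {1..4}) = {T. T \<subseteq> {1..4::nat} \<times> {i, j} \<and> bij_betw snd T {i, j}}"
  proof (intro equalityI subsetI)
    fix T :: "(nat \<times> 3) set" assume "T \<in> ?g ` ({1..4} \<times> {1..4})"
    then show "T \<in> {T. T \<subseteq> {1..4::nat} \<times> {i, j} \<and> bij_betw snd T {i, j}}"
      using ij by (auto simp: bij_betw_def inj_on_def)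
  next
    fix T :: "(nat \<times> 3) set" assume "T \<in> {T. T \<subseteq> {1..4::nat} \<times> {i, j} \<and> bij_betw snd T {i, j}}"
    then have T: "T \<subseteq> {1..4} \<times> {i, j}" and inj: "inj_on snd T" and im: "snd ` T = {i, j}"
      by (auto simp: bij_betw_def)
    from im obtain a b where ab: "(a, i) \<in> T" "(b, j) \<in> T" by (metis imageE insertI1 insertI2 prod.collapse)
    have "T = {(a, i), (b, j)}"
    proof (intro equalityI subsetI)
      fix t assume t: "t \<in> T"
      then have "snd t = i \<or> snd t = j" using T by auto
      then show "t \<in> {(a, i), (b, j)}"
        using inj_onD[OF inj _ t ab(1)] inj_onD[OF inj _ t ab(2)] by auto
    qed (use ab in auto)
    with ab T show "T \<in> ?g ` ({1..4} \<times> {1..4})" by (intro image_eqI[of _ _ "(a, b)"]) auto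
  qed
  have sign: "{(u, v). u \<in> {(a, i), (b, j)} \<and> v \<in> {(a, i), (b, j)} \<and> lex_less u v \<and> snd v < snd u} =
    (if b < a then {((b, j), (a, i))} else {})" for a b :: nat
    using ij by (auto simp: lex_less_def)
  have "multiply4 F {i, j} x = (\<Sum>T\<in>?g ` ({1..4} \<times> {1..4}).
      (-1) ^ card {(u, v). u \<in> T \<and> v \<in> T \<and> lex_less u v \<and> snd v < snd u} * F T (\<lambda>_. x))"
    by (simp only: multiply4_def img)
  also have "\<dots> = (\<Sum>(a, b)\<in>{1..4} \<times> {1..4}. (if b < a then -1 else 1) * F {(a, i), (b, j)} (\<lambda>_. x))"
    unfolding sum.reindex[OF inj] o_def by (rule sum.cong[OF refl]) (clarsimp simp only: case_prod_conv sign, simp)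
  finally show ?thesis by (simp add: sum.cartesian_product)
qed

section \<open>Contraction with the four tensor factors kept apart\<close>

definition quad :: "'a \<Rightarrow> 'a \<Rightarrow> 'a \<Rightarrow> 'a \<Rightarrow> nat \<Rightarrow> 'a" where
  "quad a b c d n = (if n = 1 then a else if n = 2 then b else if n = 3 then c else d)"

definition slots :: "3 set \<Rightarrow> 3 set \<Rightarrow> 3 set \<Rightarrow> 3 set \<Rightarrow> (nat \<times> 3) set" where
  "slots s1 s2 s3 s4 = {1} \<times> s1 \<union> {2} \<times> s2 \<union> {3} \<times> s3 \<union> {4} \<times> s4"

definition slot_deriv :: "3 \<Rightarrow> 3 set \<Rightarrow> (3 set \<Rightarrow> real) \<Rightarrow> real" where
  "slot_deriv \<mu> s f = (if \<mu> \<in> s then 0 else (-1) ^ card {\<nu> \<in> s. \<nu> < \<mu>} * f (insert \<mu> s))"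

text \<open>The Koszul sign for moving an odd derivative past a whole factor. By
  \<open>lex_slots\<close>, the global sign of a left derivative is a product of these and of the
  sign inside the factor that is hit.\<close>

definition parity :: "3 set \<Rightarrow> real" where
  "parity s = (-1) ^ card s"

text \<open>The factors \<open>a\<close> contribute \<open>\<xi>\<^sub>S\<close> for \<open>S = s1, \<dots>, s4\<close> and are differentiated along \<open>w1, \<dots>, w4\<close>;
  all points are \<open>x\<close>.\<close>

definition contract4 where
  "contract4 P x es s1 s2 s3 s4 w1 w2 w3 w4 =
     contract P es (slots s1 s2 s3 s4) (\<lambda>a. if a \<in> {1..4} then quad w1 w2 w3 w4 a else []) (\<lambda>_. x)"

lemma lex_slots:
  "card {j \<in> slots s1 s2 s3 s4. lex_less j (1, \<mu>)} = card {\<nu> \<in> s1. \<nu> < \<mu>}"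
  "card {j \<in> slots s1 s2 s3 s4. lex_less j (2, \<mu>)} = card s1 + card {\<nu> \<in> s2. \<nu> < \<mu>}"
  "card {j \<in> slots s1 s2 s3 s4. lex_less j (3, \<mu>)} = card s1 + (card s2 + card {\<nu> \<in> s3. \<nu> < \<mu>})"
  "card {j \<in> slots s1 s2 s3 s4. lex_less j (4, \<mu>)} = card s1 + (card s2 + (card s3 + card {\<nu> \<in> s4. \<nu> < \<mu>}))"
proof -
  have c: "card ({n} \<times> A \<union> B) = card A + card B" if "\<And>\<nu>. (n, \<nu>) \<notin> B" "finite B"
    for n :: nat and A :: "3 set" and B
    using that by (subst card_Un_disjoint) (auto simp: card_cartesian_product)
  have "{j \<in> slots s1 s2 s3 s4. lex_less j (1, \<mu>)} = {1} \<times> {\<nu> \<in> s1. \<nu> < \<mu>} \<union> {}"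
    "{j \<in> slots s1 s2 s3 s4. lex_less j (2, \<mu>)} = {1} \<times> s1 \<union> ({2} \<times> {\<nu> \<in> s2. \<nu> < \<mu>} \<union> {})"
    "{j \<in> slots s1 s2 s3 s4. lex_less j (3, \<mu>)} =
      {1} \<times> s1 \<union> ({2} \<times> s2 \<union> ({3} \<times> {\<nu> \<in> s3. \<nu> < \<mu>} \<union> {}))"
    "{j \<in> slots s1 s2 s3 s4. lex_less j (4, \<mu>)} =
      {1} \<times> s1 \<union> ({2} \<times> s2 \<union> ({3} \<times> s3 \<union> ({4} \<times> {\<nu> \<in> s4. \<nu> < \<mu>} \<union> {})))"
    by (auto simp: slots_def lex_less_def)
  then show "card {j \<in> slots s1 s2 s3 s4. lex_less j (1, \<mu>)} = card {\<nu> \<in> s1. \<nu> < \<mu>}"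
    "card {j \<in> slots s1 s2 s3 s4. lex_less j (2, \<mu>)} = card s1 + card {\<nu> \<in> s2. \<nu> < \<mu>}"
    "card {j \<in> slots s1 s2 s3 s4. lex_less j (3, \<mu>)} = card s1 + (card s2 + card {\<nu> \<in> s3. \<nu> < \<mu>})"
    "card {j \<in> slots s1 s2 s3 s4. lex_less j (4, \<mu>)} = card s1 + (card s2 + (card s3 + card {\<nu> \<in> s4. \<nu> < \<mu>}))"
    by (simp_all add: c finite_cartesian_product)
qed

lemma insert_slots:
  "insert (1, \<mu>) (slots s1 s2 s3 s4) = slots (insert \<mu> s1) s2 s3 s4"
  "insert (2, \<mu>) (slots s1 s2 s3 s4) = slots s1 (insert \<mu> s2) s3 s4"
  "insert (3, \<mu>) (slots s1 s2 s3 s4) = slots s1 s2 (insert \<mu> s3) s4"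
  "insert (4, \<mu>) (slots s1 s2 s3 s4) = slots s1 s2 s3 (insert \<mu> s4)"
  by (auto simp: slots_def)

lemma in_slots:
  "(1, \<mu>) \<in> slots s1 s2 s3 s4 \<longleftrightarrow> \<mu> \<in> s1" "(2, \<mu>) \<in> slots s1 s2 s3 s4 \<longleftrightarrow> \<mu> \<in> s2"
  "(3, \<mu>) \<in> slots s1 s2 s3 s4 \<longleftrightarrow> \<mu> \<in> s3" "(4, \<mu>) \<in> slots s1 s2 s3 s4 \<longleftrightarrow> \<mu> \<in> s4"
  by (auto simp: slots_def)

lemma words_upd:
  fixes w1 w2 w3 w4 :: "'b list"
  defines "f \<equiv> \<lambda>w1 w2 w3 w4 a. if a \<in> {1..4} then quad w1 w2 w3 w4 a else []"
  shows "(f w1 w2 w3 w4)(1 := f w1 w2 w3 w4 1 @ [\<mu>]) = f (w1 @ [\<mu>]) w2 w3 w4"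
    "(f w1 w2 w3 w4)(2 := f w1 w2 w3 w4 2 @ [\<mu>]) = f w1 (w2 @ [\<mu>]) w3 w4"
    "(f w1 w2 w3 w4)(3 := f w1 w2 w3 w4 3 @ [\<mu>]) = f w1 w2 (w3 @ [\<mu>]) w4"
    "(f w1 w2 w3 w4)(4 := f w1 w2 w3 w4 4 @ [\<mu>]) = f w1 w2 w3 (w4 @ [\<mu>])"
  by (auto simp: f_def quad_def fun_eq_iff)

lemma power_minus_one_if:
  "(if \<mu> \<in> s then 0 else (-1) ^ card {\<nu> \<in> s. \<nu> < \<mu>} * f (insert \<mu> s)) = slot_deriv \<mu> s f"
  "(if \<mu> \<in> s then 0 else (-1) ^ (n + m) * c) = (-1) ^ n * (if \<mu> \<in> s then 0 else (-1) ^ m * c :: real)"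
  by (simp_all add: slot_deriv_def power_add)

lemma contract4_Nil:
  "contract4 P x [] s1 s2 s3 s4 w1 w2 w3 w4 =
    foldr pd w1 (P s1) x * foldr pd w2 (P s2) x * (foldr pd w3 (P s3) x * foldr pd w4 (P s4) x)"
proof -
  have "{1..4::nat} = {1, 2, 3, 4}" by auto
  moreover have "fst ` slots s1 s2 s3 s4 \<subseteq> {1..4}" by (auto simp: slots_def)
  ultimately show ?thesis
    by (simp add: contract4_def in_slots in_slots(1)[unfolded One_nat_def] quad_def)
qed

lemma contract4_Cons:
  "contract4 P x ((1, 2) # es) s1 s2 s3 s4 w1 w2 w3 w4 = (\<Sum>\<mu>\<in>UNIV.
    slot_deriv \<mu> s1 (\<lambda>s. contract4 P x es s s2 s3 s4 w1 (w2 @ [\<mu>]) w3 w4) +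
    parity s1 * slot_deriv \<mu> s2 (\<lambda>s. contract4 P x es s1 s s3 s4 (w1 @ [\<mu>]) w2 w3 w4))"
  "contract4 P x ((1, 3) # es) s1 s2 s3 s4 w1 w2 w3 w4 = (\<Sum>\<mu>\<in>UNIV.
    slot_deriv \<mu> s1 (\<lambda>s. contract4 P x es s s2 s3 s4 w1 w2 (w3 @ [\<mu>]) w4) +
    parity s1 * (parity s2 * slot_deriv \<mu> s3 (\<lambda>s. contract4 P x es s1 s2 s s4 (w1 @ [\<mu>]) w2 w3 w4)))"
  "contract4 P x ((1, 4) # es) s1 s2 s3 s4 w1 w2 w3 w4 = (\<Sum>\<mu>\<in>UNIV.
    slot_deriv \<mu> s1 (\<lambda>s. contract4 P x es s s2 s3 s4 w1 w2 w3 (w4 @ [\<mu>])) +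
    parity s1 * (parity s2 * (parity s3 *
      slot_deriv \<mu> s4 (\<lambda>s. contract4 P x es s1 s2 s3 s (w1 @ [\<mu>]) w2 w3 w4))))"
  "contract4 P x ((2, 3) # es) s1 s2 s3 s4 w1 w2 w3 w4 = (\<Sum>\<mu>\<in>UNIV.
    parity s1 * slot_deriv \<mu> s2 (\<lambda>s. contract4 P x es s1 s s3 s4 w1 w2 (w3 @ [\<mu>]) w4) +
    parity s1 * (parity s2 * slot_deriv \<mu> s3 (\<lambda>s. contract4 P x es s1 s2 s s4 w1 (w2 @ [\<mu>]) w3 w4)))"
  "contract4 P x ((2, 4) # es) s1 s2 s3 s4 w1 w2 w3 w4 = (\<Sum>\<mu>\<in>UNIV.
    parity s1 * slot_deriv \<mu> s2 (\<lambda>s. contract4 P x es s1 s s3 s4 w1 w2 w3 (w4 @ [\<mu>])) +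
    parity s1 * (parity s2 * (parity s3 *
      slot_deriv \<mu> s4 (\<lambda>s. contract4 P x es s1 s2 s3 s w1 (w2 @ [\<mu>]) w3 w4))))"
  "contract4 P x ((3, 4) # es) s1 s2 s3 s4 w1 w2 w3 w4 = (\<Sum>\<mu>\<in>UNIV.
    parity s1 * (parity s2 * slot_deriv \<mu> s3 (\<lambda>s. contract4 P x es s1 s2 s s4 w1 w2 w3 (w4 @ [\<mu>]))) +
    parity s1 * (parity s2 * (parity s3 *
      slot_deriv \<mu> s4 (\<lambda>s. contract4 P x es s1 s2 s3 s w1 w2 (w3 @ [\<mu>]) w4))))"
  unfolding contract4_def contract.simps lex_slots insert_slots in_slots words_upd
    power_minus_one_if(2) slot_deriv_def parity_def by (rule refl)+

lemma slot_deriv_simps: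
  "slot_deriv 1 {} f = f {1}" "slot_deriv 2 {} f = f {2}" "slot_deriv 3 {} f = f {3}"
  "slot_deriv 1 {1} f = 0" "slot_deriv 2 {1} f = - f {1, 2}" "slot_deriv 3 {1} f = f {3, 1}"
  "slot_deriv 1 {2} f = f {1, 2}" "slot_deriv 2 {2} f = 0" "slot_deriv 3 {2} f = f {3, 2}"
  "slot_deriv 1 {3} f = - f {3, 1}" "slot_deriv 2 {3} f = - f {3, 2}" "slot_deriv 3 {3} f = 0"
  "slot_deriv 1 {3, 1} f = 0" "slot_deriv 2 {3, 1} f = f {3, 1, 2}" "slot_deriv 3 {3, 1} f = 0"
  "slot_deriv 1 {3, 2} f = - f {3, 1, 2}" "slot_deriv 2 {3, 2} f = 0" "slot_deriv 3 {3, 2} f = 0"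
  "slot_deriv 1 {1, 2} f = 0" "slot_deriv 2 {1, 2} f = 0" "slot_deriv 3 {1, 2} f = f {3, 1, 2}"
proof -
  have c: "{\<nu>. (\<nu> = a \<or> \<nu> = b) \<and> \<nu> < \<mu>} = (if a < \<mu> then {a} else {}) \<union> (if b < \<mu> then {b} else {})"
    for a b \<mu> :: 3 by auto
  show "slot_deriv 1 {} f = f {1}" "slot_deriv 2 {} f = f {2}" "slot_deriv 3 {} f = f {3}"
    "slot_deriv 1 {1} f = 0" "slot_deriv 2 {1} f = - f {1, 2}" "slot_deriv 3 {1} f = f {3, 1}"
    "slot_deriv 1 {2} f = f {1, 2}" "slot_deriv 2 {2} f = 0" "slot_deriv 3 {2} f = f {3, 2}"
    "slot_deriv 1 {3} f = - f {3, 1}" "slot_deriv 2 {3} f = - f {3, 2}" "slot_deriv 3 {3} f = 0"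
    "slot_deriv 1 {3, 1} f = 0" "slot_deriv 2 {3, 1} f = f {3, 1, 2}" "slot_deriv 3 {3, 1} f = 0"
    "slot_deriv 1 {3, 2} f = - f {3, 1, 2}" "slot_deriv 2 {3, 2} f = 0" "slot_deriv 3 {3, 2} f = 0"
    "slot_deriv 1 {1, 2} f = 0" "slot_deriv 2 {1, 2} f = 0" "slot_deriv 3 {1, 2} f = f {3, 1, 2}"
    by (simp_all add: slot_deriv_def c singleton_filter insert_commute)
qed

lemma parity_simps:
  "parity {} = 1" "parity {1} = -1" "parity {2} = -1" "parity {3} = -1"
  "parity {3, 1} = 1" "parity {3, 2} = 1" "parity {1, 2} = 1"
  by (simp_all add: parity_def)

lemma foldr_pd_nambu:
  assumes "smooth \<rho>" "smooth a"
  defines "V \<equiv> \<lambda>k w x. foldr pd w (\<lambda>x. \<rho> x * pd k a x) x"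
  shows "foldr pd w (nambu \<rho> a {}) x = 0" "foldr pd w (nambu \<rho> a {i}) x = 0"
    "foldr pd w (nambu \<rho> a {3, 1, 2}) x = 0" "foldr pd w (nambu \<rho> a {3, 1}) x = V 2 w x"
    "foldr pd w (nambu \<rho> a {3, 2}) x = - V 1 w x" "foldr pd w (nambu \<rho> a {1, 2}) x = V 3 w x"
proof -
  have z: "foldr pd w (\<lambda>x. 0) = (\<lambda>x. 0)" for w
    by (induction w) (simp_all add: pd_zero)
  have n: "nambu \<rho> a S = (\<lambda>x. 0)" if "card S \<noteq> 2" for S
    using that by (simp add: fun_eq_iff nambu_eq_0)
  show "foldr pd w (nambu \<rho> a {}) x = 0" "foldr pd w (nambu \<rho> a {i}) x = 0"
    "foldr pd w (nambu \<rho> a {3, 1, 2}) x = 0"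
    by (simp_all add: n z)
  have m: "foldr pd w (\<lambda>x. - f x) = (\<lambda>x. - foldr pd w f x)" if "smooth f" for f
  proof (induction w)
    case (Cons i w)
    have "pd i (\<lambda>x. (-1) * foldr pd w f x) x = (-1) * pd i (foldr pd w f) x" for x
      by (intro pd_cmult smooth_differentiable smooth_foldr_pd that)
    then have "pd i (\<lambda>x. - foldr pd w f x) = (\<lambda>x. - pd i (foldr pd w f) x)" by (simp add: fun_eq_iff)
    with Cons.IH show ?case by simp
  qed simp
  have "nambu \<rho> a {3, 1} = (\<lambda>x. \<rho> x * pd 2 a x)" "nambu \<rho> a {1, 2} = (\<lambda>x. \<rho> x * pd 3 a x)"
    "nambu \<rho> a {3, 2} = (\<lambda>x. - (\<rho> x * pd 1 a x))"
    by (simp_all add: fun_eq_iff nambu_simps)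
  then show "foldr pd w (nambu \<rho> a {3, 1}) x = V 2 w x"
    "foldr pd w (nambu \<rho> a {3, 2}) x = - V 1 w x" "foldr pd w (nambu \<rho> a {1, 2}) x = V 3 w x"
    using assms by (simp_all add: V_def m smooth_mult smooth_pd)
qed

text \<open>The edge order is reversed because \<open>fold\<close> applies the edge 12 first, while
  \<open>contract\<close> peels off the operator applied last.\<close>

definition tetra_edges :: "(nat \<times> nat) list" where
  "tetra_edges = [(3,4), (2,4), (2,3), (1,4), (1,3), (1,2)]"

lemma tetrahedral_flow_contract:
  assumes "smooth \<rho>" "smooth a"
  shows "tetrahedral_flow (nambu \<rho> a) = multiply4 (\<lambda>T p. contract (nambu \<rho> a) tetra_edges T (\<lambda>_. []) p)"
proof -
  have "fold edge_op [(1,2), (1,3), (1,4), (2,3), (2,4), (3,4)] (tensor4 (nambu \<rho> a)) =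
    foldr edge_op tetra_edges (tensor4 (nambu \<rho> a))"
    by (simp add: tetra_edges_def)
  also have "\<dots> = (\<lambda>T p. contract (nambu \<rho> a) tetra_edges T (\<lambda>_. []) p)"
    by (intro ext foldr_edge_op smooth_nambu assms) (simp add: tetra_edges_def)
  finally show ?thesis by (simp add: tetrahedral_flow_def)
qed

lemma tetrahedral_flow_eq_0:
  assumes "smooth \<rho>" "smooth a" "card S \<noteq> 2"
  shows "tetrahedral_flow (nambu \<rho> a) S x = 0"
  unfolding tetrahedral_flow_contract[OF assms(1,2)] multiply4_def
proof (intro sum.neutral ballI)
  fix T assume T: "T \<in> {T. T \<subseteq> {1..4::nat} \<times> S \<and> bij_betw snd T S}"
  then have "T \<subseteq> {1..4} \<times> S" by simp
  then have "finite T" by (rule finite_subset) simp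
  moreover have "card T = card S" using T by (auto dest: bij_betw_same_card)
  ultimately have "contract (nambu \<rho> a) tetra_edges T (\<lambda>_. []) (\<lambda>_. x) = 0"
    using assms(3) by (intro contract_eq_0) (auto simp: tetra_edges_def fun_eq_iff nambu_eq_0)
  then show "(-1) ^ card {(u, v). u \<in> T \<and> v \<in> T \<and> lex_less u v \<and> snd v < snd u} *
      contract (nambu \<rho> a) tetra_edges T (\<lambda>_. []) (\<lambda>_. x) = 0"
    by simp
qed

text \<open>The sixteen terms are the placements of the two surviving variables on four factors; a
  minus sign marks those with xi_j in an earlier factor than xi_i.\<close>

lemma tetrahedral_flow_pair:
  fixes x :: "real^3"
  assumes "smooth \<rho>" "smooth a" "i < j"
  defines "C \<equiv> \<lambda>s1 s2 s3 s4. contract4 (nambu \<rho> a) x tetra_edges s1 s2 s3 s4 [] [] [] []"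
  shows "tetrahedral_flow (nambu \<rho> a) {i, j} x =
    C {i, j} {} {} {} + C {i} {j} {} {} + C {i} {} {j} {} + C {i} {} {} {j}
    - C {j} {i} {} {} + C {} {i, j} {} {} + C {} {i} {j} {} + C {} {i} {} {j}
    - C {j} {} {i} {} - C {} {j} {i} {} + C {} {} {i, j} {} + C {} {} {i} {j}
    - C {j} {} {} {i} - C {} {j} {} {i} - C {} {} {j} {i} + C {} {} {} {i, j}"
proof -
  have "(\<lambda>a. if a \<in> {1..4} then quad [] [] [] [] a else []) = (\<lambda>_. [] :: 3 list)"
    by (auto simp: quad_def)
  then have C: "C s1 s2 s3 s4 = contract (nambu \<rho> a) tetra_edges (slots s1 s2 s3 s4) (\<lambda>_. []) (\<lambda>_. x)"
    for s1 s2 s3 s4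
    by (simp only: C_def contract4_def)
  have s: "(\<Sum>a\<in>{1..4::nat}. f a) = f 1 + f 2 + f 3 + f 4" for f :: "nat \<Rightarrow> real"
    by (simp add: eval_nat_numeral)
  have T: "{(a, i), (b, j)} = insert (a, i) (insert (b, j) (slots {} {} {} {}))" for a b :: nat
    by (simp add: slots_def)
  show ?thesis
    unfolding tetrahedral_flow_contract[OF assms(1,2)] multiply4_pair[OF assms(3)] s T insert_slots C
    by simp
qed

lemma contract4_full:
  assumes "\<And>S. card S \<noteq> 2 \<Longrightarrow> P S = (\<lambda>x. 0)"
  shows "contract4 P x es {3, 1, 2} s2 s3 s4 w1 w2 w3 w4 = 0" "contract4 P x es s1 {3, 1, 2} s3 s4 w1 w2 w3 w4 = 0"
    "contract4 P x es s1 s2 {3, 1, 2} s4 w1 w2 w3 w4 = 0" "contract4 P x es s1 s2 s3 {3, 1, 2} w1 w2 w3 w4 = 0"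
proof -
  have m: "\<mu> \<in> {3, 1, 2}" for \<mu> :: 3 using exhaust_3[of \<mu>] by auto
  show "contract4 P x es {3, 1, 2} s2 s3 s4 w1 w2 w3 w4 = 0"
    unfolding contract4_def by (rule contract_full[OF assms, where c = 1]) (use m in \<open>auto simp: slots_def\<close>)
  show "contract4 P x es s1 {3, 1, 2} s3 s4 w1 w2 w3 w4 = 0"
    unfolding contract4_def by (rule contract_full[OF assms, where c = 2]) (use m in \<open>auto simp: slots_def\<close>)
  show "contract4 P x es s1 s2 {3, 1, 2} s4 w1 w2 w3 w4 = 0"
    unfolding contract4_def by (rule contract_full[OF assms, where c = 3]) (use m in \<open>auto simp: slots_def\<close>)
  show "contract4 P x es s1 s2 s3 {3, 1, 2} w1 w2 w3 w4 = 0"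
    unfolding contract4_def by (rule contract_full[OF assms, where c = 4]) (use m in \<open>auto simp: slots_def\<close>)
qed

text \<open>The expanded coefficient of xi_1 xi_2 in the flow, up to the exchange of 1 and 2, in
  terms of the derivatives V k w of rho a_k along w; terms are grouped by a common first factor. A
  vertex of the tetrahedron has three edges but P only two variables, so every factor is
  differentiated one to three times, six times altogether.\<close>

definition q_terms :: "((3 \<times> 3 list) \<times> (real \<times> (3 \<times> 3 list) list) list) list" where
  "q_terms = [
    ((3,[3,3,3]), [(24,[(1,[1]),(1,[2]),(2,[2])]), (-8,[(1,[2]),(1,[2]),(1,[2])])]), ((3,[2,3,3]),
    [(-24,[(1,[1]),(1,[2]),(2,[3])]), (-24,[(1,[1]),(1,[2]),(3,[2])]),
    (-24,[(1,[1]),(1,[3]),(2,[2])]), (24,[(1,[1]),(2,[1]),(2,[3])]),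
    (24,[(1,[1]),(2,[1]),(3,[2])]), (24,[(1,[1]),(2,[2]),(3,[1])]),
    (24,[(1,[2]),(1,[2]),(1,[3])])]), ((3,[2,2,3]), [(24,[(1,[1]),(1,[2]),(3,[3])]),
    (24,[(1,[1]),(1,[3]),(2,[3])]), (24,[(1,[1]),(1,[3]),(3,[2])]),
    (-24,[(1,[1]),(2,[1]),(3,[3])]), (-24,[(1,[1]),(2,[3]),(3,[1])]),
    (-24,[(1,[1]),(3,[1]),(3,[2])]), (-24,[(1,[2]),(1,[3]),(1,[3])])]), ((2,[2,3]),
    [(24,[(3,[3,3]),(1,[1]),(1,[2])]), (24,[(3,[2,3]),(1,[1]),(1,[3])]),
    (-24,[(3,[3,3]),(1,[1]),(2,[1])]), (-24,[(3,[1,3]),(1,[1]),(2,[3])]),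
    (-24,[(3,[2,3]),(1,[1]),(3,[1])]), (-24,[(3,[1,3]),(1,[1]),(3,[2])])]), ((2,[3,3]),
    [(-24,[(3,[2,3]),(1,[1]),(1,[2])]), (24,[(3,[2,3]),(1,[1]),(2,[1])])]), ((3,[2,2]),
    [(24,[(3,[3,3]),(1,[1]),(1,[2])]), (-24,[(3,[3,3]),(1,[1]),(2,[1])])]), ((3,[2,3]),
    [(-24,[(3,[2,3]),(1,[1]),(1,[2])]), (24,[(3,[2,3]),(1,[1]),(2,[1])])]), ((3,[2,2,2]),
    [(-24,[(1,[1]),(1,[3]),(3,[3])]), (24,[(1,[1]),(3,[1]),(3,[3])]),
    (8,[(1,[3]),(1,[3]),(1,[3])]), (-8,[(3,[1]),(3,[1]),(3,[1])])]), ((2,[2,2]),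
    [(-24,[(3,[3,3]),(1,[1]),(1,[3])]), (24,[(3,[3,3]),(1,[1]),(3,[1])]),
    (24,[(3,[1,3]),(1,[1]),(3,[3])]), (-24,[(3,[1,3]),(3,[1]),(3,[1])])]), ((1,[2,3]),
    [(24,[(3,[3,3]),(1,[1]),(2,[2])]), (-48,[(2,[3,3]),(1,[1]),(2,[3])]),
    (-24,[(3,[2,3]),(1,[1]),(2,[3])]), (24,[(3,[2,3]),(1,[1]),(3,[2])]),
    (24,[(3,[2,2]),(1,[1]),(3,[3])]), (-24,[(3,[3,3]),(1,[2]),(1,[2])]),
    (48,[(2,[3,3]),(1,[2]),(1,[3])]), (24,[(3,[1,3]),(1,[2]),(2,[3])]),
    (24,[(3,[1,3]),(1,[2]),(3,[2])]), (-24,[(2,[1,3]),(1,[2]),(3,[3])]),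
    (-24,[(3,[1,2]),(1,[2]),(3,[3])]), (-24,[(3,[2,2]),(1,[3]),(1,[3])]),
    (48,[(3,[1,2]),(1,[3]),(2,[3])]), (-48,[(2,[1,3]),(1,[3]),(3,[2])]),
    (24,[(2,[1,2]),(1,[3]),(3,[3])]), (-24,[(2,[1,2]),(3,[1]),(3,[3])])]), ((1,[3,3]),
    [(-24,[(3,[2,3]),(1,[1]),(2,[2])]), (48,[(2,[2,3]),(1,[1]),(2,[3])]),
    (-24,[(2,[2,2]),(1,[1]),(3,[3])]), (24,[(3,[2,3]),(1,[2]),(1,[2])]),
    (-48,[(2,[2,3]),(1,[2]),(1,[3])]), (24,[(2,[1,2]),(1,[2]),(3,[3])]),
    (24,[(2,[2,2]),(1,[3]),(1,[3])])]), ((3,[1,2,3]), [(-24,[(1,[1]),(2,[3]),(2,[3])]),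
    (24,[(1,[1]),(3,[2]),(3,[2])]), (-24,[(1,[2]),(1,[2]),(3,[3])]),
    (24,[(1,[2]),(1,[3]),(2,[3])]), (-24,[(1,[2]),(1,[3]),(3,[2])]),
    (24,[(1,[2]),(2,[3]),(3,[1])]), (24,[(1,[2]),(3,[1]),(3,[2])])]), ((3,[1,2,2]),
    [(24,[(1,[1]),(2,[3]),(3,[3])]), (-24,[(1,[1]),(3,[2]),(3,[3])]),
    (24,[(1,[2]),(1,[3]),(3,[3])]), (-24,[(1,[2]),(3,[1]),(3,[3])]),
    (-24,[(1,[3]),(1,[3]),(2,[3])]), (24,[(3,[1]),(3,[1]),(3,[2])])]), ((1,[2,2]),
    [(24,[(3,[3,3]),(1,[1]),(2,[3])]), (-24,[(3,[3,3]),(1,[1]),(3,[2])]),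
    (24,[(2,[3,3]),(1,[1]),(3,[3])]), (-24,[(3,[2,3]),(1,[1]),(3,[3])]),
    (-24,[(2,[3,3]),(1,[3]),(1,[3])]), (24,[(3,[2,3]),(1,[3]),(1,[3])]),
    (-24,[(3,[1,3]),(1,[3]),(2,[3])]), (24,[(3,[1,3]),(1,[3]),(3,[2])]),
    (24,[(2,[1,3]),(1,[3]),(3,[3])]), (-24,[(3,[1,2]),(1,[3]),(3,[3])]),
    (24,[(3,[1,3]),(3,[1]),(3,[2])]), (-24,[(2,[1,3]),(3,[1]),(3,[3])]),
    (24,[(3,[1,2]),(3,[1]),(3,[3])])]), ((2,[1,3]), [(24,[(3,[2,3]),(1,[1]),(2,[3])]),
    (24,[(3,[2,3]),(1,[1]),(3,[2])]), (-24,[(3,[2,2]),(1,[1]),(3,[3])]),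
    (-24,[(3,[2,3]),(1,[2]),(1,[3])]), (24,[(3,[2,3]),(1,[2]),(3,[1])]),
    (24,[(3,[1,2]),(1,[2]),(3,[3])]), (24,[(3,[2,2]),(1,[3]),(1,[3])])]), ((3,[1,3,3]),
    [(24,[(1,[2]),(1,[2]),(3,[2])])]), ((3,[1,2]), [(-24,[(3,[3,3]),(1,[2]),(1,[2])]),
    (24,[(3,[2,3]),(1,[2]),(1,[3])]), (24,[(3,[1,3]),(1,[2]),(2,[3])]),
    (24,[(3,[2,3]),(1,[2]),(3,[1])]), (24,[(3,[1,3]),(1,[2]),(3,[2])]),
    (-24,[(3,[1,2]),(1,[2]),(3,[3])])]), ((3,[1,3]), [(24,[(3,[2,3]),(1,[2]),(1,[2])]),
    (-24,[(3,[2,2]),(1,[2]),(1,[3])]), (-24,[(3,[2,2]),(1,[2]),(3,[1])])]), ((2,[1,2]),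
    [(24,[(3,[3,3]),(1,[2]),(1,[3])]), (-24,[(3,[3,3]),(1,[2]),(3,[1])]),
    (-24,[(3,[1,3]),(1,[2]),(3,[3])]), (-24,[(3,[2,3]),(1,[3]),(1,[3])]),
    (-24,[(3,[1,3]),(1,[3]),(3,[2])]), (24,[(3,[1,2]),(1,[3]),(3,[3])]),
    (24,[(3,[2,3]),(3,[1]),(3,[1])]), (-24,[(3,[1,2]),(3,[1]),(3,[3])])]), ((3,[1,1,2]),
    [(-24,[(1,[2]),(2,[3]),(3,[3])]), (24,[(1,[2]),(3,[2]),(3,[3])])]), ((1,[1,2]),
    [(-24,[(3,[3,3]),(1,[2]),(2,[3])]), (24,[(3,[3,3]),(1,[2]),(3,[2])]),
    (-24,[(2,[3,3]),(1,[2]),(3,[3])]), (24,[(3,[2,3]),(1,[2]),(3,[3])]),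
    (48,[(2,[3,3]),(1,[3]),(2,[3])]), (-24,[(3,[2,3]),(1,[3]),(2,[3])]),
    (-24,[(3,[2,3]),(1,[3]),(3,[2])]), (-24,[(2,[2,3]),(1,[3]),(3,[3])]),
    (24,[(3,[2,2]),(1,[3]),(3,[3])]), (-24,[(3,[2,3]),(3,[1]),(3,[2])]),
    (24,[(2,[2,3]),(3,[1]),(3,[3])]), (-24,[(3,[2,2]),(3,[1]),(3,[3])])]), ((3,[1,1]),
    [(-24,[(3,[2,3]),(1,[2]),(2,[3])]), (-24,[(3,[2,3]),(1,[2]),(3,[2])]),
    (24,[(3,[2,2]),(1,[2]),(3,[3])])]), ((3,[1,1,3]), [(-24,[(1,[2]),(3,[2]),(3,[2])])]),
    ((1,[1,3]), [(-48,[(3,[2,3]),(1,[2]),(3,[2])]), (24,[(2,[2,3]),(1,[2]),(3,[3])]),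
    (48,[(2,[2,3]),(1,[3]),(3,[2])]), (-24,[(2,[2,2]),(1,[3]),(3,[3])]),
    (24,[(2,[2,2]),(3,[1]),(3,[3])])]), ((2,[1,1]), [(24,[(3,[2,3]),(1,[3]),(3,[2])]),
    (-24,[(3,[2,2]),(1,[3]),(3,[3])]), (24,[(3,[2,2]),(3,[1]),(3,[3])])])]"

definition swap12 :: "3 \<Rightarrow> 3" where
  "swap12 i = (if i = 1 then 2 else if i = 2 then 1 else 3)"

text \<open>Exchanging the coordinates 1 and 2 reverses xi_1 xi_2. It also reverses the sign with
  which the components of rho grad a enter P, but the flow is quartic in P. Hence the coefficient is
  antisymmetric, and one term of each mirror pair needs to be listed.\<close>

definition q_alternate :: "((3 \<times> 3 list) list \<Rightarrow> real) \<Rightarrow> real" where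
  "q_alternate F = (\<Sum>(v, ts)\<leftarrow>q_terms. \<Sum>(c, vs)\<leftarrow>ts.
     c * (F (v # vs) - F (map (\<lambda>(k, w). (swap12 k, map swap12 w)) (v # vs))))"

definition q_poly :: "(3 \<Rightarrow> 3 list \<Rightarrow> real) \<Rightarrow> real" where
  "q_poly V = q_alternate (\<lambda>vs. \<Prod>(k, w)\<leftarrow>vs. V k w)"

text \<open>As \<open>slot_deriv\<close>, but a factor that has received three variables is discarded.\<close>

definition grow :: "3 \<Rightarrow> 3 set \<Rightarrow> (3 set \<Rightarrow> real) \<Rightarrow> real" where
  "grow \<mu> s f = (if insert \<mu> s = {3, 1, 2} then 0 else slot_deriv \<mu> s f)"

lemma grow_eq: "f {3, 1, 2} = 0 \<Longrightarrow> slot_deriv \<mu> s f = grow \<mu> s f"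
  by (simp add: grow_def slot_deriv_def)

lemma contract4_grow:
  assumes "\<forall>S. card S \<noteq> 2 \<longrightarrow> P S = (\<lambda>x. 0)"
  shows
      "contract4 P x ((1, 2) # es) s1 s2 s3 s4 w1 w2 w3 w4 = (\<Sum>\<mu>\<in>UNIV.
    grow \<mu> s1 (\<lambda>s. contract4 P x es s s2 s3 s4 w1 (w2 @ [\<mu>]) w3 w4) +
    parity s1 * grow \<mu> s2 (\<lambda>s. contract4 P x es s1 s s3 s4 (w1 @ [\<mu>]) w2 w3 w4))"
  "contract4 P x ((1, 3) # es) s1 s2 s3 s4 w1 w2 w3 w4 = (\<Sum>\<mu>\<in>UNIV.
    grow \<mu> s1 (\<lambda>s. contract4 P x es s s2 s3 s4 w1 w2 (w3 @ [\<mu>]) w4) +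
    parity s1 * (parity s2 * grow \<mu> s3 (\<lambda>s. contract4 P x es s1 s2 s s4 (w1 @ [\<mu>]) w2 w3 w4)))"
  "contract4 P x ((1, 4) # es) s1 s2 s3 s4 w1 w2 w3 w4 = (\<Sum>\<mu>\<in>UNIV.
    grow \<mu> s1 (\<lambda>s. contract4 P x es s s2 s3 s4 w1 w2 w3 (w4 @ [\<mu>])) +
    parity s1 * (parity s2 * (parity s3 *
      grow \<mu> s4 (\<lambda>s. contract4 P x es s1 s2 s3 s (w1 @ [\<mu>]) w2 w3 w4))))"
  "contract4 P x ((2, 3) # es) s1 s2 s3 s4 w1 w2 w3 w4 = (\<Sum>\<mu>\<in>UNIV.
    parity s1 * grow \<mu> s2 (\<lambda>s. contract4 P x es s1 s s3 s4 w1 w2 (w3 @ [\<mu>]) w4) +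
    parity s1 * (parity s2 * grow \<mu> s3 (\<lambda>s. contract4 P x es s1 s2 s s4 w1 (w2 @ [\<mu>]) w3 w4)))"
  "contract4 P x ((2, 4) # es) s1 s2 s3 s4 w1 w2 w3 w4 = (\<Sum>\<mu>\<in>UNIV.
    parity s1 * grow \<mu> s2 (\<lambda>s. contract4 P x es s1 s s3 s4 w1 w2 w3 (w4 @ [\<mu>])) +
    parity s1 * (parity s2 * (parity s3 *
      grow \<mu> s4 (\<lambda>s. contract4 P x es s1 s2 s3 s w1 (w2 @ [\<mu>]) w3 w4))))"
  "contract4 P x ((3, 4) # es) s1 s2 s3 s4 w1 w2 w3 w4 = (\<Sum>\<mu>\<in>UNIV.
    parity s1 * (parity s2 * grow \<mu> s3 (\<lambda>s. contract4 P x es s1 s2 s s4 w1 w2 w3 (w4 @ [\<mu>]))) +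
    parity s1 * (parity s2 * (parity s3 *
      grow \<mu> s4 (\<lambda>s. contract4 P x es s1 s2 s3 s w1 w2 (w3 @ [\<mu>]) w4))))"
proof -
  have full: "contract4 P x es {3, 1, 2} s2 s3 s4 w1 w2 w3 w4 = 0"
    "contract4 P x es s1 {3, 1, 2} s3 s4 w1 w2 w3 w4 = 0"
    "contract4 P x es s1 s2 {3, 1, 2} s4 w1 w2 w3 w4 = 0"
    "contract4 P x es s1 s2 s3 {3, 1, 2} w1 w2 w3 w4 = 0" for es s1 s2 s3 s4 w1 w2 w3 w4
    by (intro contract4_full; simp add: assms)+
  show 
      "contract4 P x ((1, 2) # es) s1 s2 s3 s4 w1 w2 w3 w4 = (\<Sum>\<mu>\<in>UNIV.
    grow \<mu> s1 (\<lambda>s. contract4 P x es s s2 s3 s4 w1 (w2 @ [\<mu>]) w3 w4) +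
    parity s1 * grow \<mu> s2 (\<lambda>s. contract4 P x es s1 s s3 s4 (w1 @ [\<mu>]) w2 w3 w4))"
  "contract4 P x ((1, 3) # es) s1 s2 s3 s4 w1 w2 w3 w4 = (\<Sum>\<mu>\<in>UNIV.
    grow \<mu> s1 (\<lambda>s. contract4 P x es s s2 s3 s4 w1 w2 (w3 @ [\<mu>]) w4) +
    parity s1 * (parity s2 * grow \<mu> s3 (\<lambda>s. contract4 P x es s1 s2 s s4 (w1 @ [\<mu>]) w2 w3 w4)))"
  "contract4 P x ((1, 4) # es) s1 s2 s3 s4 w1 w2 w3 w4 = (\<Sum>\<mu>\<in>UNIV.
    grow \<mu> s1 (\<lambda>s. contract4 P x es s s2 s3 s4 w1 w2 w3 (w4 @ [\<mu>])) +
    parity s1 * (parity s2 * (parity s3 *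
      grow \<mu> s4 (\<lambda>s. contract4 P x es s1 s2 s3 s (w1 @ [\<mu>]) w2 w3 w4))))"
  "contract4 P x ((2, 3) # es) s1 s2 s3 s4 w1 w2 w3 w4 = (\<Sum>\<mu>\<in>UNIV.
    parity s1 * grow \<mu> s2 (\<lambda>s. contract4 P x es s1 s s3 s4 w1 w2 (w3 @ [\<mu>]) w4) +
    parity s1 * (parity s2 * grow \<mu> s3 (\<lambda>s. contract4 P x es s1 s2 s s4 w1 (w2 @ [\<mu>]) w3 w4)))"
  "contract4 P x ((2, 4) # es) s1 s2 s3 s4 w1 w2 w3 w4 = (\<Sum>\<mu>\<in>UNIV.
    parity s1 * grow \<mu> s2 (\<lambda>s. contract4 P x es s1 s s3 s4 w1 w2 w3 (w4 @ [\<mu>])) +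
    parity s1 * (parity s2 * (parity s3 *
      grow \<mu> s4 (\<lambda>s. contract4 P x es s1 s2 s3 s w1 (w2 @ [\<mu>]) w3 w4))))"
  "contract4 P x ((3, 4) # es) s1 s2 s3 s4 w1 w2 w3 w4 = (\<Sum>\<mu>\<in>UNIV.
    parity s1 * (parity s2 * grow \<mu> s3 (\<lambda>s. contract4 P x es s1 s2 s s4 w1 w2 w3 (w4 @ [\<mu>]))) +
    parity s1 * (parity s2 * (parity s3 *
      grow \<mu> s4 (\<lambda>s. contract4 P x es s1 s2 s3 s w1 w2 (w3 @ [\<mu>]) w4))))"
  unfolding contract4_Cons by (simp_all add: grow_eq full)
qed

lemma grow_simps:
  "grow 1 {} f = f {1}" "grow 2 {} f = f {2}" "grow 3 {} f = f {3}"
  "grow 1 {1} f = 0" "grow 2 {1} f = - f {1, 2}" "grow 3 {1} f = f {3, 1}"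
  "grow 1 {2} f = f {1, 2}" "grow 2 {2} f = 0" "grow 3 {2} f = f {3, 2}"
  "grow 1 {3} f = - f {3, 1}" "grow 2 {3} f = - f {3, 2}" "grow 3 {3} f = 0"
  "grow 1 {3, 1} f = 0" "grow 2 {3, 1} f = 0" "grow 3 {3, 1} f = 0"
  "grow 1 {3, 2} f = 0" "grow 2 {3, 2} f = 0" "grow 3 {3, 2} f = 0"
  "grow 1 {1, 2} f = 0" "grow 2 {1, 2} f = 0" "grow 3 {1, 2} f = 0"
proof -
  have "{1} \<noteq> {3, 1, 2::3}" "{2} \<noteq> {3, 1, 2::3}" "{3} \<noteq> {3, 1, 2::3}" "{2, 1} \<noteq> {3, 1, 2::3}"
    "{3, 1} \<noteq> {3, 1, 2::3}" "{1, 2} \<noteq> {3, 1, 2::3}" "{3, 2} \<noteq> {3, 1, 2::3}" "{1, 3} \<noteq> {3, 1, 2::3}"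
    "{2, 3} \<noteq> {3, 1, 2::3}"
    by (auto simp: set_eq_iff forall_3)
  moreover have "{2, 3, 1} = {3, 1, 2::3}" "{1, 3, 2} = {3, 1, 2::3}" by auto
  ultimately show "grow 1 {} f = f {1}" "grow 2 {} f = f {2}" "grow 3 {} f = f {3}"
    "grow 1 {1} f = 0" "grow 2 {1} f = - f {1, 2}" "grow 3 {1} f = f {3, 1}"
    "grow 1 {2} f = f {1, 2}" "grow 2 {2} f = 0" "grow 3 {2} f = f {3, 2}"
    "grow 1 {3} f = - f {3, 1}" "grow 2 {3} f = - f {3, 2}" "grow 3 {3} f = 0"
    "grow 1 {3, 1} f = 0" "grow 2 {3, 1} f = 0" "grow 3 {3, 1} f = 0"
    "grow 1 {3, 2} f = 0" "grow 2 {3, 2} f = 0" "grow 3 {3, 2} f = 0"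
    "grow 1 {1, 2} f = 0" "grow 2 {1, 2} f = 0" "grow 3 {1, 2} f = 0"
    by (simp_all only: grow_def slot_deriv_simps if_True if_False simp_thms if_cancel)
qed

text \<open>Meant as a congruence rule: it hides the continuation \<open>f\<close> from the
  simplifier until \<open>\<mu>\<close> and \<open>s\<close> have decided the branch, so vanishing
  branches are never expanded.\<close>

lemma grow_cong: "\<mu> = \<mu>' \<Longrightarrow> s = s' \<Longrightarrow> grow \<mu> s f = grow \<mu>' s' f"
  by simp

lemmas contract4_evaluate = sum_3 grow_simps parity_simps append.simps
  mult_1_left mult_minus_left minus_minus add_0_left add_0_right minus_zero mult_zero_right

text \<open>The shift sends (1,2) to (2,3), whose sorted form \<open>{3, 2}\<close> costs a sign,
  and applied twice it gives (3,1). The three coefficients are expanded separately since the order 3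
  < 1 < 2 of the variables is not cyclically invariant.\<close>

lemma tetrahedral_flow_q_poly:
  fixes x :: "real^3"
  assumes \<rho>: "smooth \<rho>" and a: "smooth a"
  defines "V \<equiv> \<lambda>k w. foldr pd w (\<lambda>x. \<rho> x * pd k a x) x"
  shows "tetrahedral_flow (nambu \<rho> a) {1, 2} x = q_poly V"
    "tetrahedral_flow (nambu \<rho> a) {3, 2} x = - q_poly (\<lambda>k w. V (rot k) (map rot w))"
    "tetrahedral_flow (nambu \<rho> a) {3, 1} x = q_poly (\<lambda>k w. V (rot (rot k)) (map rot (map rot w)))"
proof -
  have sm: "smooth (\<lambda>x. \<rho> x * pd k a x)" for k by (intro smooth_mult smooth_pd \<rho> a)
  have swap: "V k (u @ i # j # w) = V k (u @ j # i # w)" for k u i j w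
    unfolding V_def by (simp only: foldr_pd_swap[OF sm])
  \<comment> \<open>Commutation of derivatives, oriented towards increasing letters 1, 2, 3, at both
    positions of words of at most three letters.\<close>
  note sort =
    swap[of _ "[]" 2 1, simplified append.simps] swap[of _ "[]" 3 1, simplified append.simps]
    swap[of _ "[]" 3 2, simplified append.simps]
    swap[of _ "[y]" 2 1 for y, simplified append.simps] swap[of _ "[y]" 3 1 for y, simplified append.simps]
    swap[of _ "[y]" 3 2 for y, simplified append.simps]
  have step: "\<forall>S. card S \<noteq> 2 \<longrightarrow> nambu \<rho> a S = (\<lambda>x. 0)"
    by (simp add: fun_eq_iff nambu_eq_0)
  note step = contract4_grow[OF step]
  have leaf: "contract4 (nambu \<rho> a) x [] s1 s2 s3 s4 w1 w2 w3 w4 =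
    foldr pd w1 (nambu \<rho> a s1) x * foldr pd w2 (nambu \<rho> a s2) x *
      (foldr pd w3 (nambu \<rho> a s3) x * foldr pd w4 (nambu \<rho> a s4) x)" for s1 s2 s3 s4 w1 w2 w3 w4
    by (rule contract4_Nil)
  have V: "foldr pd w (\<lambda>x. \<rho> x * pd k a x) x = V k w" for k w by (simp add: V_def)
  note jets = foldr_pd_nambu[OF \<rho> a, unfolded V]
  define C where "C s1 s2 s3 s4 =
    contract4 (nambu \<rho> a) x [(3,4), (2,4), (2,3), (1,4), (1,3), (1,2)] s1 s2 s3 s4 [] [] [] []" for s1 s2 s3 s4
  note [cong] = grow_cong
  note flow = tetrahedral_flow_pair[OF \<rho> a, of _ _ x, unfolded tetra_edges_def, folded C_def]
  note q = q_poly_def q_alternate_def q_terms_def swap12_def rot_def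
  \<comment> \<open>Each placement of the two variables is normalized on its own, so that only
    reduced polynomials meet in the closing comparison.\<close>
  note C12 =
    C_def[of "{1, 2}" "{}" "{}" "{}", simplified contract4_evaluate step leaf jets V sort]
    C_def[of "{1}" "{2}" "{}" "{}", simplified contract4_evaluate step leaf jets V sort]
    C_def[of "{1}" "{}" "{2}" "{}", simplified contract4_evaluate step leaf jets V sort]
    C_def[of "{1}" "{}" "{}" "{2}", simplified contract4_evaluate step leaf jets V sort]
    C_def[of "{2}" "{1}" "{}" "{}", simplified contract4_evaluate step leaf jets V sort]
    C_def[of "{}" "{1, 2}" "{}" "{}", simplified contract4_evaluate step leaf jets V sort]
    C_def[of "{}" "{1}" "{2}" "{}", simplified contract4_evaluate step leaf jets V sort]
    C_def[of "{}" "{1}" "{}" "{2}", simplified contract4_evaluate step leaf jets V sort]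
    C_def[of "{2}" "{}" "{1}" "{}", simplified contract4_evaluate step leaf jets V sort]
    C_def[of "{}" "{2}" "{1}" "{}", simplified contract4_evaluate step leaf jets V sort]
    C_def[of "{}" "{}" "{1, 2}" "{}", simplified contract4_evaluate step leaf jets V sort]
    C_def[of "{}" "{}" "{1}" "{2}", simplified contract4_evaluate step leaf jets V sort]
    C_def[of "{2}" "{}" "{}" "{1}", simplified contract4_evaluate step leaf jets V sort]
    C_def[of "{}" "{2}" "{}" "{1}", simplified contract4_evaluate step leaf jets V sort]
    C_def[of "{}" "{}" "{2}" "{1}", simplified contract4_evaluate step leaf jets V sort]
    C_def[of "{}" "{}" "{}" "{1, 2}", simplified contract4_evaluate step leaf jets V sort]
  show "tetrahedral_flow (nambu \<rho> a) {1, 2} x = q_poly V"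
    unfolding flow[OF less_3(3)]
    apply (simp add: q del: mult_minus_left mult_minus_right)
    apply (simp only: sort)
    apply (unfold C12)
    apply algebra
    done
  note C32 =
    C_def[of "{3, 2}" "{}" "{}" "{}", simplified contract4_evaluate step leaf jets V sort]
    C_def[of "{3}" "{2}" "{}" "{}", simplified contract4_evaluate step leaf jets V sort]
    C_def[of "{3}" "{}" "{2}" "{}", simplified contract4_evaluate step leaf jets V sort]
    C_def[of "{3}" "{}" "{}" "{2}", simplified contract4_evaluate step leaf jets V sort]
    C_def[of "{2}" "{3}" "{}" "{}", simplified contract4_evaluate step leaf jets V sort]
    C_def[of "{}" "{3, 2}" "{}" "{}", simplified contract4_evaluate step leaf jets V sort]
    C_def[of "{}" "{3}" "{2}" "{}", simplified contract4_evaluate step leaf jets V sort]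
    C_def[of "{}" "{3}" "{}" "{2}", simplified contract4_evaluate step leaf jets V sort]
    C_def[of "{2}" "{}" "{3}" "{}", simplified contract4_evaluate step leaf jets V sort]
    C_def[of "{}" "{2}" "{3}" "{}", simplified contract4_evaluate step leaf jets V sort]
    C_def[of "{}" "{}" "{3, 2}" "{}", simplified contract4_evaluate step leaf jets V sort]
    C_def[of "{}" "{}" "{3}" "{2}", simplified contract4_evaluate step leaf jets V sort]
    C_def[of "{2}" "{}" "{}" "{3}", simplified contract4_evaluate step leaf jets V sort]
    C_def[of "{}" "{2}" "{}" "{3}", simplified contract4_evaluate step leaf jets V sort]
    C_def[of "{}" "{}" "{2}" "{3}", simplified contract4_evaluate step leaf jets V sort]
    C_def[of "{}" "{}" "{}" "{3, 2}", simplified contract4_evaluate step leaf jets V sort]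
  show "tetrahedral_flow (nambu \<rho> a) {3, 2} x = - q_poly (\<lambda>k w. V (rot k) (map rot w))"
    unfolding flow[OF less_3(2)]
    apply (simp add: q del: mult_minus_left mult_minus_right)
    apply (simp only: sort)
    apply (unfold C32)
    apply algebra
    done
  note C31 =
    C_def[of "{3, 1}" "{}" "{}" "{}", simplified contract4_evaluate step leaf jets V sort]
    C_def[of "{3}" "{1}" "{}" "{}", simplified contract4_evaluate step leaf jets V sort]
    C_def[of "{3}" "{}" "{1}" "{}", simplified contract4_evaluate step leaf jets V sort]
    C_def[of "{3}" "{}" "{}" "{1}", simplified contract4_evaluate step leaf jets V sort]
    C_def[of "{1}" "{3}" "{}" "{}", simplified contract4_evaluate step leaf jets V sort]
    C_def[of "{}" "{3, 1}" "{}" "{}", simplified contract4_evaluate step leaf jets V sort]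
    C_def[of "{}" "{3}" "{1}" "{}", simplified contract4_evaluate step leaf jets V sort]
    C_def[of "{}" "{3}" "{}" "{1}", simplified contract4_evaluate step leaf jets V sort]
    C_def[of "{1}" "{}" "{3}" "{}", simplified contract4_evaluate step leaf jets V sort]
    C_def[of "{}" "{1}" "{3}" "{}", simplified contract4_evaluate step leaf jets V sort]
    C_def[of "{}" "{}" "{3, 1}" "{}", simplified contract4_evaluate step leaf jets V sort]
    C_def[of "{}" "{}" "{3}" "{1}", simplified contract4_evaluate step leaf jets V sort]
    C_def[of "{1}" "{}" "{}" "{3}", simplified contract4_evaluate step leaf jets V sort]
    C_def[of "{}" "{1}" "{}" "{3}", simplified contract4_evaluate step leaf jets V sort]
    C_def[of "{}" "{}" "{1}" "{3}", simplified contract4_evaluate step leaf jets V sort]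
    C_def[of "{}" "{}" "{}" "{3, 1}", simplified contract4_evaluate step leaf jets V sort]
  show "tetrahedral_flow (nambu \<rho> a) {3, 1} x = q_poly (\<lambda>k w. V (rot (rot k)) (map rot (map rot w)))"
    unfolding flow[OF less_3(1)]
    apply (simp add: q del: mult_minus_left mult_minus_right)
    apply (simp only: sort)
    apply (unfold C31)
    apply algebra
    done
qed

section \<open>Linear relations between the descendants\<close>

lemma word_Nil: "word v ts [] = []"
  and word_Cons: "word v (t # ts) (i # is) = (if t = v then i # word v ts is else word v ts is)"
  by (simp_all add: word_def)

lemmas comp_unfold = comp3_def mono3_def word_Nil word_Cons

section \<open>Jet polynomials, their total derivatives and the explicit data\<close>

fun dwords :: "3 \<Rightarrow> 3 list list \<Rightarrow> 3 list list list" where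
  "dwords l [] = []"
| "dwords l (w # ws) = ((l # w) # ws) # map ((#) w) (dwords l ws)"

text \<open>A term consists of a coefficient, the derivative words of its factors rho and those of
  its factors a. A concrete list lets the simplifier compute derivatives and permutations.\<close>

type_synonym jpoly = "(real \<times> 3 list list \<times> 3 list list) list"

definition jeval :: "(3 list \<Rightarrow> real) \<Rightarrow> (3 list \<Rightarrow> real) \<Rightarrow> jpoly \<Rightarrow> real" where
  "jeval R A p = (\<Sum>(c, us, vs)\<leftarrow>p. c * (prod_list (map R us) * prod_list (map A vs)))"

definition jderiv :: "3 \<Rightarrow> jpoly \<Rightarrow> jpoly" where
  "jderiv l p = concat (map (\<lambda>(c, us, vs).
     map (\<lambda>us'. (c, us', vs)) (dwords l us) @ map (\<lambda>vs'. (c, us, vs')) (dwords l vs)) p)"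

definition permute :: "3 \<Rightarrow> 3 \<Rightarrow> 3 \<Rightarrow> 3 \<Rightarrow> 3" where
  "permute i j k = (\<lambda>l. if l = 1 then i else if l = 2 then j else k)"

definition jmap :: "real \<Rightarrow> (3 \<Rightarrow> 3) \<Rightarrow> jpoly \<Rightarrow> jpoly" where
  "jmap s f p = map (\<lambda>(c, us, vs). (s * c, map (map f) us, map (map f) vs)) p"

text \<open>Signed sum over all permutations of the coordinates. The scalars f and g contain three
  Levi-Civita symbols each and so change sign under odd permutations; orbit representatives
  determine them.\<close>

definition alternate :: "jpoly \<Rightarrow> jpoly" where
  "alternate p = jmap 1 (permute 1 2 3) p @ jmap 1 (permute 2 3 1) p @ jmap 1 (permute 3 1 2) p
     @ jmap (-1) (permute 1 3 2) p @ jmap (-1) (permute 3 2 1) p @ jmap (-1) (permute 2 1 3) p"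

definition dmono3 :: "3 \<Rightarrow> nat list \<Rightarrow> (3 list \<Rightarrow> real) \<Rightarrow> (3 list \<Rightarrow> real) \<Rightarrow> 3 list \<Rightarrow> real" where
  "dmono3 l ts R A is =
     (R (l # word 1 ts is) * R (word 2 ts is) * R (word 3 ts is) +
      R (word 1 ts is) * R (l # word 2 ts is) * R (word 3 ts is) +
      R (word 1 ts is) * R (word 2 ts is) * R (l # word 3 ts is)) *
     (A (word 4 ts is) * A (word 5 ts is) * A (word 6 ts is)) +
     R (word 1 ts is) * R (word 2 ts is) * R (word 3 ts is) *
     (A (l # word 4 ts is) * A (word 5 ts is) * A (word 6 ts is) +
      A (word 4 ts is) * A (l # word 5 ts is) * A (word 6 ts is) +
      A (word 4 ts is) * A (word 5 ts is) * A (l # word 6 ts is))"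

definition dcomp3 :: "3 \<Rightarrow> graph \<Rightarrow> (3 list \<Rightarrow> real) \<Rightarrow> (3 list \<Rightarrow> real) \<Rightarrow> 3 \<Rightarrow> real" where
  "dcomp3 l G R A i = eps2 i (\<lambda>i2 i3. eps3 (\<lambda>i4 i5 i6. eps3 (\<lambda>i7 i8 i9.
     dmono3 l (concat G) R A [i, i2, i3, i4, i5, i6, i7, i8, i9])))"

text \<open>Twenty of the 48 descendant encodings; \<open>jets.relations\<close> expresses the other
  28 through them.\<close>

definition basis :: "graph list" where
  "basis = [
    [[0,1,4],[1,3,5],[1,2,6]], [[0,1,4],[1,3,5],[1,5,6]], [[0,1,4],[1,3,5],[4,2,6]],
    [[0,1,4],[1,3,5],[4,5,6]], [[0,1,4],[1,6,5],[1,5,6]], [[0,1,4],[1,6,5],[4,2,6]],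
    [[0,1,4],[4,3,5],[4,2,6]], [[0,1,4],[4,3,5],[4,5,6]], [[0,1,4],[4,6,5],[4,5,6]],
    [[0,3,4],[1,3,5],[1,2,6]], [[0,3,4],[1,3,5],[1,5,6]], [[0,3,4],[1,6,5],[1,2,6]],
    [[0,3,4],[1,6,5],[1,5,6]], [[0,3,4],[1,6,5],[4,2,6]], [[0,3,4],[4,3,5],[4,2,6]],
    [[0,3,4],[4,3,5],[4,5,6]], [[0,6,4],[1,3,5],[1,2,6]], [[0,6,4],[1,6,5],[1,2,6]],
    [[0,6,4],[1,6,5],[1,5,6]], [[0,6,4],[1,6,5],[4,2,6]]]"

text \<open>The field \<open>X3D\<close> with five of its graphs relabelled by exchanging the
  vertices 2 and 3. In these five the second edge of vertex 1 ends at 2 or 5, so their encodings as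
  given are not literally among the descendants. Not every graph here lies in
  \<open>basis\<close>.\<close>

definition X_terms :: "(real \<times> graph) list" where
  "X_terms = [
    (8, [[0,1,4],[1,3,5],[1,2,6]]), (24, [[0,1,4],[1,6,5],[4,2,6]]),
    (8, [[0,1,4],[4,3,5],[4,2,6]]), (24, [[0,1,4],[4,6,5],[4,2,6]]),
    (12, [[0,1,4],[4,6,5],[4,5,6]]), (16, [[0,3,4],[1,3,5],[1,2,6]]),
    (16, [[0,3,4],[1,6,5],[1,2,6]]), (12, [[0,3,4],[1,6,5],[1,5,6]]),
    (16, [[0,3,4],[1,6,5],[4,2,6]]), (24, [[0,6,4],[1,3,5],[1,2,6]])]"

text \<open>The digits in \<open>g21\<close>, \<open>g12\<close>, \<open>g03\<close> count the
  undifferentiated and the once differentiated factors rho, and these are all three factors rho of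
  g. In \<open>f21\<close>, \<open>f12\<close>, \<open>f03\<close> the digits mean the same, and
  exactly one further factor rho is differentiated at least twice.\<close>

definition g21 :: jpoly where
  "g21 = [
    (-24,[[],[],[3]],[[2],[1,1],[2,2],[1,3,3]]), (24,[[],[],[1]],[[2],[1,1],[2,2],[3,3,3]]),
    (48,[[],[],[3]],[[2],[1,3],[2,2],[1,1,3]]), (24,[[],[],[3]],[[2],[1,2],[1,2],[1,3,3]]),
    (-24,[[],[],[1]],[[2],[1,2],[1,2],[3,3,3]]), (48,[[],[],[3]],[[2],[1,2],[3,3],[1,1,2]]),
    (-48,[[],[],[3]],[[2],[1,2],[2,3],[1,1,3]]), (-48,[[],[],[3]],[[2],[1,2],[1,3],[1,2,3]]),
    (48,[[],[],[1]],[[2],[1,2],[1,3],[2,3,3]]), (-48,[[],[],[1]],[[2],[1,2],[3,3],[1,2,3]]),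
    (-24,[[],[],[3]],[[2],[1,1],[3,3],[1,2,2]]), (24,[[],[],[3]],[[2],[1,3],[1,3],[1,2,2]])]"

definition g12 :: jpoly where
  "g12 = [
    (-24,[[],[3],[3]],[[2],[2],[1,2],[1,1,3]]), (48,[[],[1],[3]],[[2],[2],[1,2],[1,3,3]]),
    (-24,[[],[1],[1]],[[2],[2],[1,2],[3,3,3]]), (24,[[],[3],[3]],[[2],[2],[1,1],[1,2,3]]),
    (-24,[[],[1],[3]],[[2],[2],[1,1],[2,3,3]]), (-24,[[],[2],[3]],[[2],[2],[1,1],[1,3,3]]),
    (24,[[],[1],[2]],[[2],[2],[1,1],[3,3,3]]), (-24,[[],[3],[3]],[[2],[2],[1,3],[1,1,2]]),
    (48,[[],[2],[3]],[[2],[2],[1,3],[1,1,3]]), (24,[[],[3],[3]],[[1],[2],[2,2],[1,1,3]]),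
    (-48,[[],[1],[3]],[[1],[2],[2,2],[1,3,3]]), (24,[[],[1],[1]],[[1],[2],[2,2],[3,3,3]]),
    (48,[[],[3],[3]],[[1],[2],[1,3],[1,2,2]]), (-48,[[],[1],[3]],[[1],[2],[3,3],[1,2,2]]),
    (96,[[],[1],[3]],[[1],[2],[2,3],[1,2,3]]), (-48,[[],[1],[1]],[[1],[2],[2,3],[2,3,3]]),
    (24,[[],[1],[1]],[[1],[2],[3,3],[2,2,3]])]"

definition g03 :: jpoly where
  "g03 = [
    (8,[[3],[3],[3]],[[2],[2],[2],[1,1,1]]), (-24,[[1],[3],[3]],[[2],[2],[2],[1,1,3]]),
    (-24,[[3],[3],[3]],[[1],[2],[2],[1,1,2]]), (48,[[1],[3],[3]],[[1],[2],[2],[1,2,3]]),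
    (24,[[2],[3],[3]],[[1],[2],[2],[1,1,3]]), (-24,[[1],[1],[3]],[[1],[2],[2],[2,3,3]]),
    (-48,[[1],[2],[3]],[[1],[2],[2],[1,3,3]]), (24,[[1],[1],[2]],[[1],[2],[2],[3,3,3]]),
    (-48,[[1],[3],[3]],[[1],[2],[3],[1,2,2]])]"

definition g_poly :: jpoly where
  "g_poly = alternate (g21 @ g12 @ g03)"

definition f21 :: jpoly where
  "f21 = [
    (24,[[],[],[1],[3,3,3]],[[2],[1,1],[2,2]]), (-24,[[],[],[3],[1,3,3]],[[2],[1,1],[2,2]]),
    (-48,[[],[],[1],[1,3,3]],[[2],[1,3],[2,2]]), (-24,[[],[],[1],[3,3,3]],[[2],[1,2],[1,2]]),
    (24,[[],[],[3],[1,3,3]],[[2],[1,2],[1,2]]), (48,[[],[],[1],[1,3,3]],[[2],[1,2],[2,3]]),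
    (48,[[],[],[1],[2,3,3]],[[2],[1,2],[1,3]]), (-48,[[],[],[3],[1,2,3]],[[2],[1,2],[1,3]]),
    (-48,[[],[],[1],[1,2,3]],[[2],[1,2],[3,3]]), (48,[[],[],[3],[1,1,2]],[[2],[1,2],[3,3]]),
    (24,[[],[],[1],[2,2,3]],[[2],[1,1],[3,3]]), (-24,[[],[],[1],[2,2,3]],[[2],[1,3],[1,3]])]"

definition f12 :: jpoly where
  "f12 = [
    (-24,[[],[1],[1],[3,3,3]],[[2],[2],[1,2]]), (48,[[],[1],[3],[1,3,3]],[[2],[2],[1,2]]),
    (-24,[[],[3],[3],[1,1,3]],[[2],[2],[1,2]]), (24,[[],[1],[2],[3,3,3]],[[2],[2],[1,1]]),
    (-24,[[],[2],[3],[1,3,3]],[[2],[2],[1,1]]), (-24,[[],[1],[3],[2,3,3]],[[2],[2],[1,1]]),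
    (24,[[],[3],[3],[1,2,3]],[[2],[2],[1,1]]), (-48,[[],[1],[2],[1,3,3]],[[2],[2],[1,3]]),
    (24,[[],[1],[1],[2,3,3]],[[2],[2],[1,3]]), (24,[[],[1],[1],[3,3,3]],[[1],[2],[2,2]]),
    (-48,[[],[1],[3],[1,3,3]],[[1],[2],[2,2]]), (24,[[],[3],[3],[1,1,3]],[[1],[2],[2,2]]),
    (-48,[[],[1],[3],[3,3]],[[2],[1,1],[2,2]]), (48,[[],[3],[3],[1,3]],[[2],[1,1],[2,2]]),
    (48,[[],[1],[1],[3,3]],[[2],[1,3],[2,2]]), (-48,[[],[1],[1],[2,3,3]],[[1],[2],[2,3]]),
    (96,[[],[1],[3],[1,2,3]],[[1],[2],[2,3]]), (-48,[[],[3],[3],[1,1,2]],[[1],[2],[2,3]]),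
    (-24,[[],[2],[2],[1,1,3]],[[1],[2],[3,3]]), (48,[[],[2],[3],[1,1,2]],[[1],[2],[3,3]]),
    (48,[[],[1],[3],[3,3]],[[2],[1,2],[1,2]]), (-48,[[],[3],[3],[1,3]],[[2],[1,2],[1,2]]),
    (-48,[[],[1],[1],[3,3]],[[2],[1,2],[2,3]]), (-48,[[],[1],[2],[3,3]],[[2],[1,2],[1,3]]),
    (48,[[],[2],[3],[1,3]],[[2],[1,2],[1,3]]), (-48,[[],[1],[3],[2,3]],[[2],[1,2],[1,3]]),
    (48,[[],[3],[3],[1,2]],[[2],[1,2],[1,3]]), (48,[[],[1],[2],[1,3]],[[2],[1,2],[3,3]]),
    (-48,[[],[2],[3],[1,1]],[[2],[1,2],[3,3]]), (48,[[],[1],[1],[2,3]],[[2],[1,2],[3,3]]),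
    (-48,[[],[1],[3],[1,2]],[[2],[1,2],[3,3]]), (-48,[[],[1],[2],[2,3]],[[2],[1,1],[3,3]]),
    (48,[[],[1],[2],[2,3]],[[2],[1,3],[1,3]])]"

definition f03 :: jpoly where
  "f03 = [
    (-8,[[1],[1],[1],[3,3,3]],[[2],[2],[2]]), (24,[[1],[1],[3],[1,3,3]],[[2],[2],[2]]),
    (24,[[1],[1],[2],[3,3,3]],[[1],[2],[2]]), (-48,[[1],[2],[3],[1,3,3]],[[1],[2],[2]]),
    (24,[[2],[3],[3],[1,1,3]],[[1],[2],[2]]), (-24,[[1],[1],[3],[2,3,3]],[[1],[2],[2]]),
    (48,[[1],[3],[3],[1,2,3]],[[1],[2],[2]]), (-24,[[3],[3],[3],[1,1,2]],[[1],[2],[2]]),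
    (24,[[1],[1],[3],[3,3]],[[2],[2],[1,2]]), (-48,[[1],[3],[3],[1,3]],[[2],[2],[1,2]]),
    (24,[[3],[3],[3],[1,1]],[[2],[2],[1,2]]), (-24,[[1],[2],[3],[3,3]],[[2],[2],[1,1]]),
    (24,[[2],[3],[3],[1,3]],[[2],[2],[1,1]]), (24,[[1],[3],[3],[2,3]],[[2],[2],[1,1]]),
    (-24,[[3],[3],[3],[1,2]],[[2],[2],[1,1]]), (24,[[1],[1],[2],[3,3]],[[2],[2],[1,3]]),
    (-48,[[1],[1],[3],[2,3]],[[2],[2],[1,3]]), (-24,[[1],[1],[3],[3,3]],[[1],[2],[2,2]]),
    (48,[[1],[3],[3],[1,3]],[[1],[2],[2,2]]), (-24,[[3],[3],[3],[1,1]],[[1],[2],[2,2]]),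
    (48,[[1],[2],[2],[1,3,3]],[[1],[2],[3]]), (48,[[1],[1],[2],[3,3]],[[1],[2],[2,3]]),
    (-96,[[1],[2],[3],[1,3]],[[1],[2],[2,3]]), (48,[[2],[3],[3],[1,1]],[[1],[2],[2,3]]),
    (48,[[1],[2],[2],[1,3]],[[1],[2],[3,3]]), (-24,[[2],[2],[3],[1,1]],[[1],[2],[3,3]])]"

definition f_poly :: jpoly where
  "f_poly = alternate (f21 @ f12 @ f03)"

lemma eps2_simps: "eps2 1 h = h 2 3 - h 3 2" "eps2 2 h = h 3 1 - h 1 3" "eps2 3 h = h 1 2 - h 2 1"
  by (simp_all add: eps2_def)

definition dmono2 :: "3 \<Rightarrow> nat list \<Rightarrow> (3 list \<Rightarrow> real) \<Rightarrow> (3 list \<Rightarrow> real) \<Rightarrow> 3 list \<Rightarrow> real" where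
  "dmono2 l ts R A is =
     (R (l # word 1 ts is) * R (word 2 ts is) + R (word 1 ts is) * R (l # word 2 ts is)) *
     (A (word 3 ts is) * A (word 4 ts is)) +
     R (word 1 ts is) * R (word 2 ts is) *
     (A (l # word 3 ts is) * A (word 4 ts is) + A (word 3 ts is) * A (l # word 4 ts is))"

definition dcomp2 :: "3 \<Rightarrow> graph \<Rightarrow> (3 list \<Rightarrow> real) \<Rightarrow> (3 list \<Rightarrow> real) \<Rightarrow> real" where
  "dcomp2 l G R A = eps3 (\<lambda>i1 i2 i3. eps3 (\<lambda>i4 i5 i6.
     dmono2 l (concat G) R A [i1, i2, i3, i4, i5, i6]))"

text \<open>The component i of rho times the cross product of grad H and grad a, for H the
  evaluation of a graph without sink.\<close>

definition ham :: "graph \<Rightarrow> (3 list \<Rightarrow> real) \<Rightarrow> (3 list \<Rightarrow> real) \<Rightarrow> 3 \<Rightarrow> real" where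
  "ham G R A i = R [] * eps2 i (\<lambda>l k. A [k] * dcomp2 l G R A)"

lemmas poly_simps = jeval_def alternate_def jmap_def permute_def
lemmas dcomp_unfold = comp_unfold dcomp3_def dmono3_def

text \<open>The derivative of rho a_k along w, as a polynomial in formal jets.\<close>

definition V_jet :: "(3 list \<Rightarrow> real) \<Rightarrow> (3 list \<Rightarrow> real) \<Rightarrow> 3 \<Rightarrow> 3 list \<Rightarrow> real" where
  "V_jet R A k w = jeval R A (foldr jderiv w [(1, [[]], [[k]])])"

definition brk :: "graph \<Rightarrow> (3 list \<Rightarrow> real) \<Rightarrow> (3 list \<Rightarrow> real) \<Rightarrow> 3 \<Rightarrow> real" where
  "brk G R A k =
     - ((\<Sum>i\<in>UNIV. comp3 G R A i * R [i] - R [] * dcomp3 i G R A i) * A [k]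
        + R [] * (\<Sum>i\<in>UNIV. dcomp3 k G R A i * A [i] + comp3 G R A i * A [i, k]))"

section \<open>Splitting by the order of the derivatives of rho\<close>

fun dwords_at :: "(3 list \<Rightarrow> bool) \<Rightarrow> 3 \<Rightarrow> 3 list list \<Rightarrow> 3 list list list" where
  "dwords_at Q l [] = []"
| "dwords_at Q l (w # ws) = (if Q w then [(l # w) # ws] else []) @ map ((#) w) (dwords_at Q l ws)"

definition jderiv_R :: "(3 list \<Rightarrow> bool) \<Rightarrow> 3 \<Rightarrow> jpoly \<Rightarrow> jpoly" where
  "jderiv_R Q l p = concat (map (\<lambda>(c, us, vs). map (\<lambda>us'. (c, us', vs)) (dwords_at Q l us)) p)"

definition jderiv_A :: "3 \<Rightarrow> jpoly \<Rightarrow> jpoly" where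
  "jderiv_A l p = concat (map (\<lambda>(c, us, vs). map (\<lambda>vs'. (c, us, vs')) (dwords l vs)) p)"

lemma jeval_append: "jeval R A (p @ q) = jeval R A p + jeval R A q"
  by (simp add: jeval_def)

lemma jderiv_parts_append:
  "jderiv_R Q l (p @ q) = jderiv_R Q l p @ jderiv_R Q l q"
  "jderiv_A l (p @ q) = jderiv_A l p @ jderiv_A l q"
  by (simp_all add: jderiv_R_def jderiv_A_def)

lemma jderiv_append: "jderiv l (p @ q) = jderiv l p @ jderiv l q"
  by (simp add: jderiv_def)

lemma jmap_append: "jmap s f (p @ q) = jmap s f p @ jmap s f q"
  by (simp add: jmap_def)

text \<open>A derivative is sorted by what it hits. In rho dg, a part of g with i undifferentiated
  and j once differentiated factors rho lands in class (i, j+1) if an undifferentiated rho is hit,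
  in (i+1, j-1) if a once differentiated one is, and in (i+1, j) otherwise.\<close>

lemma jderiv_split:
  "jeval R A (jderiv l p) = jeval R A (jderiv_R (\<lambda>w. length w = 0) l p) +
    jeval R A (jderiv_R (\<lambda>w. length w = 1) l p) +
    (jeval R A (jderiv_R (\<lambda>w. 2 \<le> length w) l p) + jeval R A (jderiv_A l p))"
proof -
  have one: "(\<Sum>us'\<leftarrow>dwords l us. h us') = (\<Sum>us'\<leftarrow>dwords_at (\<lambda>w. length w = 0) l us. h us') +
      (\<Sum>us'\<leftarrow>dwords_at (\<lambda>w. length w = 1) l us. h us') + (\<Sum>us'\<leftarrow>dwords_at (\<lambda>w. 2 \<le> length w) l us. h us')"
    for h :: "3 list list \<Rightarrow> real" and us
  proof (induction us arbitrary: h)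
    case (Cons w us)
    have "length w = 0 \<or> length w = 1 \<or> 2 \<le> length w" by linarith
    then show ?case using Cons.IH[of "\<lambda>us'. h (w # us')"] by (auto simp: o_def)
  qed simp
  show ?thesis
  proof (induction p)
    case (Cons t p)
    obtain c us vs where t: "t = (c, us, vs)" by (cases t)
    have "jeval R A (jderiv l [t]) = jeval R A (jderiv_R (\<lambda>w. length w = 0) l [t]) +
      jeval R A (jderiv_R (\<lambda>w. length w = 1) l [t]) +
      (jeval R A (jderiv_R (\<lambda>w. 2 \<le> length w) l [t]) + jeval R A (jderiv_A l [t]))"
      using one[of "\<lambda>us'. c * (prod_list (map R us') * prod_list (map A vs))" us]
      by (simp add: t jeval_def jderiv_def jderiv_R_def jderiv_A_def o_def)
    moreover have "jderiv l (t # p) = jderiv l [t] @ jderiv l p"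
      "jderiv_R Q l (t # p) = jderiv_R Q l [t] @ jderiv_R Q l p"
      "jderiv_A l (t # p) = jderiv_A l [t] @ jderiv_A l p" for Q
      by (simp_all add: jderiv_def jderiv_R_def jderiv_A_def)
    ultimately show ?case using Cons.IH by (simp only: jeval_append)
  qed (simp add: jeval_def jderiv_def jderiv_R_def jderiv_A_def)
qed

text \<open>The part of the product of all P + Y + Z that takes i factors from P and j from Y. The
  guard stops the recursion as soon as more factors are requested than remain;
  \<open>split_prod_Cons\<close> is the recursion without it.\<close>

primrec split_prod ::
  "('v \<Rightarrow> real) \<Rightarrow> ('v \<Rightarrow> real) \<Rightarrow> ('v \<Rightarrow> real) \<Rightarrow> nat \<Rightarrow> nat \<Rightarrow> 'v list \<Rightarrow> real" where
  "split_prod P Y Z i j [] = (if i = 0 \<and> j = 0 then 1 else 0)"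
| "split_prod P Y Z i j (v # vs) = (if length vs + 1 < i + j then 0 else
     (if i = 0 then 0 else P v * split_prod P Y Z (i - 1) j vs) +
     (if j = 0 then 0 else Y v * split_prod P Y Z i (j - 1) vs) +
     Z v * split_prod P Y Z i j vs)"

lemma split_prod_eq_0: "length vs < i + j \<Longrightarrow> split_prod P Y Z i j vs = 0"
  by (cases vs) auto

lemma split_prod_Cons:
  "split_prod P Y Z i j (v # vs) =
     (if i = 0 then 0 else P v * split_prod P Y Z (i - 1) j vs) +
     (if j = 0 then 0 else Y v * split_prod P Y Z i (j - 1) vs) + Z v * split_prod P Y Z i j vs"
  by (auto simp: split_prod_eq_0)

lemma sum_split_prod:
  "length vs \<le> m \<Longrightarrow> length vs \<le> n \<Longrightarrow>
    prod_list (map (\<lambda>v. P v + Y v + Z v) vs) = (\<Sum>i\<le>m. \<Sum>j\<le>n. split_prod P Y Z i j vs)"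
proof (induction vs arbitrary: m n)
  case Nil
  have "(\<Sum>i\<le>m. \<Sum>j\<le>n. if i = 0 \<and> j = 0 then 1 else 0 :: real) = (\<Sum>i\<le>m. if i = 0 then 1 else 0)"
    by (intro sum.cong refl) (simp add: if_distrib cong: if_cong)
  then show ?case by simp
next
  case (Cons v vs)
  obtain m' n' where mn: "m = Suc m'" "n = Suc n'" "length vs \<le> m'" "length vs \<le> n'"
    using Cons.prems by (cases m; cases n) auto
  let ?e = "split_prod P Y Z"
  have shift: "(\<Sum>i\<le>Suc k. if i = 0 then 0 else h (i - 1)) = (\<Sum>i\<le>k. h i :: real)" for k h
    by (simp add: sum.atMost_Suc_shift del: sum.atMost_Suc)
  have "(\<Sum>i\<le>m. \<Sum>j\<le>n. ?e i j (v # vs)) =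
      (\<Sum>i\<le>m. if i = 0 then 0 else P v * (\<Sum>j\<le>n. ?e (i - 1) j vs)) +
      (\<Sum>i\<le>m. \<Sum>j\<le>n. if j = 0 then 0 else Y v * ?e i (j - 1) vs) +
      (\<Sum>i\<le>m. \<Sum>j\<le>n. Z v * ?e i j vs)"
    unfolding split_prod_Cons sum.distrib
    by (intro arg_cong2[of _ _ _ _ "(+)"] sum.cong refl) (auto simp: sum_distrib_left)
  also have "\<dots> = P v * (\<Sum>i\<le>m'. \<Sum>j\<le>n. ?e i j vs) + Y v * (\<Sum>i\<le>m. \<Sum>j\<le>n'. ?e i j vs) +
      Z v * (\<Sum>i\<le>m. \<Sum>j\<le>n. ?e i j vs)"
    unfolding mn(1,2) shift[of "\<lambda>i. P v * (\<Sum>j\<le>Suc n'. ?e i j vs)"] shift[of "\<lambda>j. Y v * ?e _ j vs"]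
    by (simp only: sum_distrib_left)
  also have "\<dots> = (P v + Y v + Z v) * prod_list (map (\<lambda>v. P v + Y v + Z v) vs)"
    using Cons.IH[of m' n] Cons.IH[of m n'] Cons.IH[of m n] mn by (simp add: distrib_right)
  finally show ?case by simp
qed

text \<open>Confines a comparison to the lists that occur in \<open>q_terms\<close>: four factors,
  derivatives of order at most three. The closed formulas for \<open>V_jet\<close> cover just this
  range.\<close>

lemma q_alternate_cong:
  assumes "\<And>vs. length vs \<le> 4 \<Longrightarrow> (\<And>v. v \<in> set vs \<Longrightarrow> length (snd v) \<le> 3) \<Longrightarrow> F vs = G vs"
  shows "q_alternate F = q_alternate G"
proof -
  have "list_all (\<lambda>(v, ts). length (snd v) \<le> 3 \<and>
      list_all (\<lambda>(c, vs). length vs = 3 \<and> list_all (\<lambda>v. length (snd v) \<le> 3) vs) ts) q_terms"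
    by (simp add: q_terms_def)
  then have small: "length (snd v) \<le> 3" "length vs = 3" "u \<in> set vs \<Longrightarrow> length (snd u) \<le> 3"
    if "(v, ts) \<in> set q_terms" "(c, vs) \<in> set ts" for v ts c vs u
    using that by (fastforce simp: list_all_iff)+
  have "F (v # vs) = G (v # vs)"
    "F (map (\<lambda>(k, w). (swap12 k, map swap12 w)) (v # vs)) = G (map (\<lambda>(k, w). (swap12 k, map swap12 w)) (v # vs))"
    if "(v, ts) \<in> set q_terms" "(c, vs) \<in> set ts" for v ts c vs
    using small[OF that] by (auto intro!: assms simp: case_prod_unfold)
  then show ?thesis
    unfolding q_alternate_def
    by (intro arg_cong[of _ _ sum_list] map_cong refl) (auto intro!: arg_cong[of _ _ sum_list] map_cong)
qed

lemma sum_sum_list: "(\<Sum>y\<leftarrow>ys. \<Sum>i\<in>I. f i y) = (\<Sum>i\<in>I. \<Sum>y\<leftarrow>ys. f i y :: real)"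
  by (induction ys) (simp_all add: sum.distrib)

lemma q_alternate_sum: "q_alternate (\<lambda>vs. \<Sum>i\<in>I. F i vs) = (\<Sum>i\<in>I. q_alternate (F i))"
  unfolding q_alternate_def
  by (simp only: sum_subtractf[symmetric] sum_distrib_left case_prod_unfold sum_sum_list)

lemma split_prod_4:
  "split_prod P Y Z 0 0 [a, b, c, d] =
     Z a * Z b * Z c * Z d"
  "split_prod P Y Z 0 1 [a, b, c, d] =
     Y a * Z b * Z c * Z d + Z a * Y b * Z c * Z d + Z a * Z b * Y c * Z d + Z a * Z b * Z c * Y d"
  "split_prod P Y Z 0 2 [a, b, c, d] =
     Y a * Y b * Z c * Z d + Y a * Z b * Y c * Z d + Y a * Z b * Z c * Y d +
     Z a * Y b * Y c * Z d + Z a * Y b * Z c * Y d + Z a * Z b * Y c * Y d"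
  "split_prod P Y Z 0 3 [a, b, c, d] =
     Y a * Y b * Y c * Z d + Y a * Y b * Z c * Y d + Y a * Z b * Y c * Y d + Z a * Y b * Y c * Y d"
  "split_prod P Y Z 0 4 [a, b, c, d] =
     Y a * Y b * Y c * Y d"
  "split_prod P Y Z 1 0 [a, b, c, d] =
     P a * Z b * Z c * Z d + Z a * P b * Z c * Z d + Z a * Z b * P c * Z d + Z a * Z b * Z c * P d"
  "split_prod P Y Z 1 1 [a, b, c, d] =
     P a * Y b * Z c * Z d + P a * Z b * Y c * Z d + P a * Z b * Z c * Y d +
     Y a * P b * Z c * Z d + Y a * Z b * P c * Z d + Y a * Z b * Z c * P d +
     Z a * P b * Y c * Z d + Z a * P b * Z c * Y d + Z a * Y b * P c * Z d +
     Z a * Y b * Z c * P d + Z a * Z b * P c * Y d + Z a * Z b * Y c * P d"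
  "split_prod P Y Z 1 2 [a, b, c, d] =
     P a * Y b * Y c * Z d + P a * Y b * Z c * Y d + P a * Z b * Y c * Y d +
     Y a * P b * Y c * Z d + Y a * P b * Z c * Y d + Y a * Y b * P c * Z d +
     Y a * Y b * Z c * P d + Y a * Z b * P c * Y d + Y a * Z b * Y c * P d +
     Z a * P b * Y c * Y d + Z a * Y b * P c * Y d + Z a * Y b * Y c * P d"
  "split_prod P Y Z 1 3 [a, b, c, d] =
     P a * Y b * Y c * Y d + Y a * P b * Y c * Y d + Y a * Y b * P c * Y d + Y a * Y b * Y c * P d"
  "split_prod P Y Z 2 0 [a, b, c, d] =
     P a * P b * Z c * Z d + P a * Z b * P c * Z d + P a * Z b * Z c * P d +
     Z a * P b * P c * Z d + Z a * P b * Z c * P d + Z a * Z b * P c * P d"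
  "split_prod P Y Z 2 1 [a, b, c, d] =
     P a * P b * Y c * Z d + P a * P b * Z c * Y d + P a * Y b * P c * Z d +
     P a * Y b * Z c * P d + P a * Z b * P c * Y d + P a * Z b * Y c * P d +
     Y a * P b * P c * Z d + Y a * P b * Z c * P d + Y a * Z b * P c * P d +
     Z a * P b * P c * Y d + Z a * P b * Y c * P d + Z a * Y b * P c * P d"
  "split_prod P Y Z 2 2 [a, b, c, d] =
     P a * P b * Y c * Y d + P a * Y b * P c * Y d + P a * Y b * Y c * P d +
     Y a * P b * P c * Y d + Y a * P b * Y c * P d + Y a * Y b * P c * P d"
  "split_prod P Y Z 3 0 [a, b, c, d] =
     P a * P b * P c * Z d + P a * P b * Z c * P d + P a * Z b * P c * P d + Z a * P b * P c * P d"
  "split_prod P Y Z 3 1 [a, b, c, d] =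
     P a * P b * P c * Y d + P a * P b * Y c * P d + P a * Y b * P c * P d + Y a * P b * P c * P d"
  "split_prod P Y Z 4 0 [a, b, c, d] =
     P a * P b * P c * P d"
  by (simp_all add: algebra_simps)

lemma jeval_alternate:
  "jeval R A (alternate p) =
    jeval R A (jmap 1 (permute 1 2 3) p) + jeval R A (jmap 1 (permute 2 3 1) p) +
    jeval R A (jmap 1 (permute 3 1 2) p) + (jeval R A (jmap (-1) (permute 1 3 2) p) +
    jeval R A (jmap (-1) (permute 3 2 1) p) + jeval R A (jmap (-1) (permute 2 1 3) p))"
  by (simp add: alternate_def jeval_append)

lemma jeval_alternate_append: "jeval R A (alternate (p @ q)) = jeval R A (alternate p) + jeval R A (alternate q)"
  by (simp add: alternate_def jeval_append jmap_append)

lemma jeval_jderiv_alternate_append: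
  "jeval R A (jderiv_R Q l (alternate (p @ q))) = jeval R A (jderiv_R Q l (alternate p)) + jeval R A (jderiv_R Q l (alternate q))"
  "jeval R A (jderiv_A l (alternate (p @ q))) = jeval R A (jderiv_A l (alternate p)) + jeval R A (jderiv_A l (alternate q))"
  by (simp_all add: alternate_def jeval_append jmap_append jderiv_parts_append)

lemma permute_simps: "permute i j k 1 = i" "permute i j k 2 = j" "permute i j k 3 = k"
  by (simp_all add: permute_def)

lemma swap12_simps: "swap12 1 = 2" "swap12 2 = 1" "swap12 3 = 3"
  by (simp_all add: swap12_def)

lemmas list_eval = list.map append.simps concat.simps sum_list.Cons sum_list.Nil prod_list.Cons
  prod_list.Nil prod.case list.sel

lemmas q_expand = q_alternate_def[of F, unfolded q_terms_def list_eval swap12_simps] for F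

lemma jderiv_alternate:
  "jeval R A (jderiv_R Q l (alternate p)) =
    jeval R A (jderiv_R Q l (jmap 1 (permute 1 2 3) p)) + jeval R A (jderiv_R Q l (jmap 1 (permute 2 3 1) p)) +
    jeval R A (jderiv_R Q l (jmap 1 (permute 3 1 2) p)) + (jeval R A (jderiv_R Q l (jmap (-1) (permute 1 3 2) p)) +
    jeval R A (jderiv_R Q l (jmap (-1) (permute 3 2 1) p)) + jeval R A (jderiv_R Q l (jmap (-1) (permute 2 1 3) p)))"
  "jeval R A (jderiv_A l (alternate p)) =
    jeval R A (jderiv_A l (jmap 1 (permute 1 2 3) p)) + jeval R A (jderiv_A l (jmap 1 (permute 2 3 1) p)) +
    jeval R A (jderiv_A l (jmap 1 (permute 3 1 2) p)) + (jeval R A (jderiv_A l (jmap (-1) (permute 1 3 2) p)) +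
    jeval R A (jderiv_A l (jmap (-1) (permute 3 2 1) p)) + jeval R A (jderiv_A l (jmap (-1) (permute 2 1 3) p)))"
  by (simp_all add: alternate_def jeval_append jderiv_parts_append)

lemma length_simps:
  "(length ([] :: 3 list) = 0) = True" "(length (x # xs :: 3 list) = 0) = False"
  "(length ([] :: 3 list) = 1) = False" "(length [x :: 3] = 1) = True" "(length (x # y # xs :: 3 list) = 1) = False"
  "(2 \<le> length ([] :: 3 list)) = False" "(2 \<le> length [x :: 3]) = False" "(2 \<le> length (x # y # xs :: 3 list)) = True"
  by simp_all

section \<open>Polynomial identities between formal jets\<close>

locale jets =
  fixes R A :: "3 list \<Rightarrow> real"
  assumes R_swap: "R (u @ i # j # w) = R (u @ j # i # w)"
    and A_swap: "A (u @ i # j # w) = A (u @ j # i # w)"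
begin

lemmas sort =
  R_swap[of "[]" 2 1, simplified append.simps] R_swap[of "[]" 3 1, simplified append.simps]
  R_swap[of "[]" 3 2, simplified append.simps]
  R_swap[of "[x]" 2 1 for x, simplified append.simps] R_swap[of "[x]" 3 1 for x, simplified append.simps]
  R_swap[of "[x]" 3 2 for x, simplified append.simps]
  R_swap[of "[x, y]" 2 1 for x y, simplified append.simps] R_swap[of "[x, y]" 3 1 for x y, simplified append.simps]
  R_swap[of "[x, y]" 3 2 for x y, simplified append.simps]
  A_swap[of "[]" 2 1, simplified append.simps] A_swap[of "[]" 3 1, simplified append.simps]
  A_swap[of "[]" 3 2, simplified append.simps]
  A_swap[of "[x]" 2 1 for x, simplified append.simps] A_swap[of "[x]" 3 1 for x, simplified append.simps]
  A_swap[of "[x]" 3 2 for x, simplified append.simps]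
  A_swap[of "[x, y]" 2 1 for x y, simplified append.simps] A_swap[of "[x, y]" 3 1 for x y, simplified append.simps]
  A_swap[of "[x, y]" 3 2 for x y, simplified append.simps]

text \<open>The last five relations, like several of the others, are relabellings exchanging the
  vertices 2 and 3. The rest are linear relations confirmed by complete expansion of component 1 in
  sorted jets.\<close>

lemma relations:
  "comp3 [[0,1,4],[1,6,5],[1,2,6]] R A 1 =
      comp3 [[0,1,4],[1,3,5],[1,5,6]] R A 1"
  "comp3 [[0,1,4],[1,6,5],[4,5,6]] R A 1 =
      0"
  "comp3 [[0,1,4],[4,3,5],[1,2,6]] R A 1 =
      comp3 [[0,1,4],[1,3,5],[4,2,6]] R A 1"
  "comp3 [[0,1,4],[4,3,5],[1,5,6]] R A 1 =
      comp3 [[0,1,4],[1,6,5],[4,2,6]] R A 1"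
  "comp3 [[0,1,4],[4,6,5],[1,2,6]] R A 1 =
      comp3 [[0,1,4],[1,3,5],[4,5,6]] R A 1"
  "comp3 [[0,1,4],[4,6,5],[1,5,6]] R A 1 =
      0"
  "comp3 [[0,1,4],[4,6,5],[4,2,6]] R A 1 =
      comp3 [[0,1,4],[4,3,5],[4,5,6]] R A 1"
  "comp3 [[0,3,4],[1,3,5],[4,2,6]] R A 1 =
      (-1) * comp3 [[0,1,4],[1,3,5],[4,2,6]] R A 1"
  "comp3 [[0,3,4],[1,3,5],[4,5,6]] R A 1 =
      (-1) * comp3 [[0,1,4],[1,3,5],[4,5,6]] R A 1"
  "comp3 [[0,3,4],[1,6,5],[4,5,6]] R A 1 =
      0"
  "comp3 [[0,3,4],[4,3,5],[1,2,6]] R A 1 =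
      0"
  "comp3 [[0,3,4],[4,3,5],[1,5,6]] R A 1 =
      (-1) * comp3 [[0,1,4],[1,3,5],[4,5,6]] R A 1 + comp3 [[0,1,4],[1,6,5],[4,2,6]] R A 1"
  "comp3 [[0,3,4],[4,6,5],[1,2,6]] R A 1 =
      0"
  "comp3 [[0,3,4],[4,6,5],[1,5,6]] R A 1 =
      0"
  "comp3 [[0,3,4],[4,6,5],[4,2,6]] R A 1 =
      comp3 [[0,1,4],[4,3,5],[4,5,6]] R A 1"
  "comp3 [[0,3,4],[4,6,5],[4,5,6]] R A 1 =
      comp3 [[0,1,4],[4,6,5],[4,5,6]] R A 1"
  "comp3 [[0,6,4],[1,3,5],[1,5,6]] R A 1 =
      comp3 [[0,1,4],[1,6,5],[4,2,6]] R A 1 + (1/2) * comp3 [[0,3,4],[1,6,5],[1,5,6]] R A 1"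
  "comp3 [[0,6,4],[1,3,5],[4,2,6]] R A 1 =
      0"
  "comp3 [[0,6,4],[1,3,5],[4,5,6]] R A 1 =
      0"
  "comp3 [[0,6,4],[1,6,5],[4,5,6]] R A 1 =
      (-1/2) * comp3 [[0,1,4],[4,6,5],[4,5,6]] R A 1"
  "comp3 [[0,6,4],[4,3,5],[1,2,6]] R A 1 =
      0"
  "comp3 [[0,6,4],[4,3,5],[1,5,6]] R A 1 =
      0"
  "comp3 [[0,6,4],[4,3,5],[4,2,6]] R A 1 =
      (-1) * comp3 [[0,6,4],[1,6,5],[4,2,6]] R A 1"
  "comp3 [[0,6,4],[4,3,5],[4,5,6]] R A 1 =
      (1/2) * comp3 [[0,1,4],[4,6,5],[4,5,6]] R A 1"
  "comp3 [[0,6,4],[4,6,5],[1,2,6]] R A 1 =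
      0"
  "comp3 [[0,6,4],[4,6,5],[1,5,6]] R A 1 =
      (-1/2) * comp3 [[0,1,4],[4,6,5],[4,5,6]] R A 1"
  "comp3 [[0,6,4],[4,6,5],[4,2,6]] R A 1 =
      0"
  "comp3 [[0,6,4],[4,6,5],[4,5,6]] R A 1 =
      0"
  "comp3 [[0,2,4],[1,3,5],[1,2,6]] R A 1 =
      comp3 [[0,3,4],[1,3,5],[1,2,6]] R A 1"
  "comp3 [[0,2,4],[1,3,5],[1,5,6]] R A 1 =
      comp3 [[0,3,4],[1,6,5],[1,2,6]] R A 1"
  "comp3 [[0,2,4],[1,6,5],[1,5,6]] R A 1 =
      comp3 [[0,3,4],[1,6,5],[1,5,6]] R A 1"
  "comp3 [[0,2,4],[4,3,5],[1,5,6]] R A 1 =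
      comp3 [[0,3,4],[1,6,5],[4,2,6]] R A 1"
  "comp3 [[0,5,4],[1,3,5],[1,2,6]] R A 1 =
      comp3 [[0,6,4],[1,3,5],[1,2,6]] R A 1"
  by (simp add: comp_unfold, simp only: eps2_simps eps3_def sort, algebra)+

lemma g_poly:
  "(\<Sum>(c, G)\<leftarrow>X_terms. c * (comp3 G R A 1 * A [1] + comp3 G R A 2 * A [2] + comp3 G R A 3 * A [3])) =
    jeval R A g_poly"
  apply (simp add: comp_unfold g_poly_def g21_def g12_def g03_def X_terms_def poly_simps del: mult_minus_left mult_minus_right)
  apply (simp only: eps2_simps eps3_def sort)
  apply algebra
  done

lemma f_poly:
  "(\<Sum>(c, G)\<leftarrow>X_terms. c * (comp3 G R A 1 * R [1] + comp3 G R A 2 * R [2] + comp3 G R A 3 * R [3]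
      - R [] * (dcomp3 1 G R A 1 + dcomp3 2 G R A 2 + dcomp3 3 G R A 3))) = jeval R A f_poly"
  apply (simp add: dcomp_unfold f_poly_def f21_def f12_def f03_def X_terms_def poly_simps del: mult_minus_left mult_minus_right)
  apply (simp only: eps2_simps eps3_def sort)
  apply algebra
  done

text \<open>Each of the last three graphs of \<open>basis\<close> occurs in exactly one of these
  fields, with coefficient 1, 2 and -2 respectively. The coefficients of a Hamiltonian combination
  can therefore be read off at these graphs.\<close>

lemma ham_relations:
  "ham [[1,2,3],[1,3,4]] R A 1 =
      comp3 [[0,1,4],[1,3,5],[1,5,6]] R A 1 + comp3 [[0,1,4],[1,6,5],[4,2,6]] R A 1 + comp3 [[0,3,4],[1,3,5],[1,5,6]] R A 1 + (1/2) * comp3 [[0,3,4],[1,6,5],[1,5,6]] R A 1 + comp3 [[0,6,4],[1,6,5],[1,2,6]] R A 1"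
  "ham [[1,4,3],[1,3,4]] R A 1 =
      comp3 [[0,1,4],[1,6,5],[1,5,6]] R A 1 + comp3 [[0,3,4],[1,6,5],[1,5,6]] R A 1 + (2) * comp3 [[0,6,4],[1,6,5],[1,5,6]] R A 1"
  "ham [[1,4,3],[2,3,4]] R A 1 =
      (-4) * comp3 [[0,1,4],[1,6,5],[4,2,6]] R A 1 + (-2) * comp3 [[0,1,4],[4,3,5],[4,5,6]] R A 1 + (-2) * comp3 [[0,6,4],[1,6,5],[4,2,6]] R A 1"
  by (simp add: ham_def dcomp2_def dmono2_def comp_unfold, simp only: eps2_simps eps3_def sort, algebra)+

lemma V_jet_words:
  "V_jet R A k [] = R [] * A [k]"
  "V_jet R A k [x] = R [x] * A [k] + R [] * A [x, k]"
  "V_jet R A k [x, y] = R [x, y] * A [k] + R [y] * A [x, k] + R [x] * A [y, k] + R [] * A [x, y, k]"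
  "V_jet R A k [x, y, z] =
    R [x, y, z] * A [k] + R [y, z] * A [x, k] + R [x, z] * A [y, k] + R [z] * A [x, y, k] +
    R [x, y] * A [z, k] + R [y] * A [x, z, k] + R [x] * A [y, z, k] + R [] * A [x, y, z, k]"
  by (simp_all add: V_jet_def jeval_def jderiv_def)

text \<open>The three parts collect the summands of \<open>V_jet\<close> whose factor rho is
  differentiated zero times, once, and at least twice. The last patterns of \<open>R1_part\<close>
  and \<open>R2_part\<close> are written for words of three letters, the highest order in
  \<open>q_terms\<close>.\<close>

definition R0_part :: "3 \<times> 3 list \<Rightarrow> real" where
  "R0_part = (\<lambda>(k, w). R [] * A (w @ [k]))"

definition R1_part :: "3 \<times> 3 list \<Rightarrow> real" where
  "R1_part = (\<lambda>(k, w). case w of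
     [] \<Rightarrow> 0
   | [x] \<Rightarrow> R [x] * A [k]
   | [x, y] \<Rightarrow> R [y] * A [x, k] + R [x] * A [y, k]
   | x # y # z # _ \<Rightarrow> R [z] * A [x, y, k] + R [y] * A [x, z, k] + R [x] * A [y, z, k])"

definition R2_part :: "3 \<times> 3 list \<Rightarrow> real" where
  "R2_part = (\<lambda>(k, w). case w of
     [] \<Rightarrow> 0
   | [x] \<Rightarrow> 0
   | [x, y] \<Rightarrow> R [x, y] * A [k]
   | x # y # z # _ \<Rightarrow>
       R [x, y, z] * A [k] + R [y, z] * A [x, k] + R [x, z] * A [y, k] + R [x, y] * A [z, k])"

lemma part_simps:
  "R0_part (k, w) = R [] * A (w @ [k])"
  "R1_part (k, []) = 0"
  "R1_part (k, [x]) = R [x] * A [k]"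
  "R1_part (k, [x, y]) = R [y] * A [x, k] + R [x] * A [y, k]"
  "R1_part (k, [x, y, z]) = R [z] * A [x, y, k] + R [y] * A [x, z, k] + R [x] * A [y, z, k]"
  "R2_part (k, []) = 0"
  "R2_part (k, [x]) = 0"
  "R2_part (k, [x, y]) = R [x, y] * A [k]"
  "R2_part (k, [x, y, z]) = R [x, y, z] * A [k] + R [y, z] * A [x, k] + R [x, z] * A [y, k] + R [x, y] * A [z, k]"
  by (simp_all add: R0_part_def R1_part_def R2_part_def)

lemma V_jet_parts:
  assumes "length w \<le> 3"
  shows "V_jet R A k w = R0_part (k, w) + R1_part (k, w) + R2_part (k, w)"
proof -
  from assms consider "w = []" | x where "w = [x]" | x y where "w = [x, y]" | x y z where "w = [x, y, z]"
    by (auto simp: numeral_3_eq_3 le_Suc_eq length_Suc_conv)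
  then show ?thesis by cases (simp_all add: V_jet_words part_simps)
qed

text \<open>The contribution to the flow with i undifferentiated and j once differentiated factors
  rho. It is to be matched with the terms of -(f a_3 + rho dg_3) in the same class.\<close>

definition q_class :: "nat \<Rightarrow> nat \<Rightarrow> real" where
  "q_class i j = q_alternate (split_prod R0_part R1_part R2_part i j)"

lemmas q_eval = q_class_def q_expand list.sel split_prod_4 part_simps append.simps
  mult_zero_left mult_zero_right add_0_left add_0_right diff_self

lemmas jderiv_eval = jderiv_R_def jderiv_A_def dwords_at.simps dwords.simps list_eval
  length_simps if_True if_False

lemma q_poly_classes: "q_poly (V_jet R A) = (\<Sum>i\<le>4. \<Sum>j\<le>4. q_class i j)"
proof -
  have "(\<Prod>(k, w)\<leftarrow>vs. V_jet R A k w) = (\<Sum>i\<le>4. \<Sum>j\<le>4. split_prod R0_part R1_part R2_part i j vs)"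
    if "length vs \<le> 4" "\<And>v. v \<in> set vs \<Longrightarrow> length (snd v) \<le> 3" for vs
  proof -
    have "map (\<lambda>(k, w). V_jet R A k w) vs = map (\<lambda>v. R0_part v + R1_part v + R2_part v) vs"
      using that(2) by (intro map_cong refl) (force simp: V_jet_parts)
    then show ?thesis
      by (simp only: sum_split_prod[OF that(1) that(1)])
  qed
  then have "q_poly (V_jet R A) = q_alternate (\<lambda>vs. \<Sum>i\<le>4. \<Sum>j\<le>4. split_prod R0_part R1_part R2_part i j vs)"
    unfolding q_poly_def by (intro q_alternate_cong) simp
  also have "\<dots> = (\<Sum>i\<le>4. \<Sum>j\<le>4. q_class i j)"
    by (simp add: q_alternate_sum q_class_def)
  finally show ?thesis .
qed

lemma q_class_eq_0: "4 < i + j \<Longrightarrow> q_class i j = 0"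
proof -
  assume "4 < i + j"
  then have "q_class i j = q_alternate (\<lambda>vs. 0)"
    unfolding q_class_def by (intro q_alternate_cong) (simp add: split_prod_eq_0)
  also have "\<dots> = 0"
    by (simp add: q_alternate_def case_prod_unfold)
  finally show ?thesis .
qed

text \<open>Replacing the jet coordinates by variables keeps the polynomial normalization fast.\<close>

lemma q_class_values:
  "q_class 0 0 =
  0"
  "q_class 0 1 =
  0"
  "q_class 0 2 =
  0"
  "q_class 0 3 =
  - (jeval R A (alternate f03) * A [3])"
  "q_class 0 4 =
  - (R [] * (jeval R A (jderiv_R (\<lambda>w. length w = 0) 3 (alternate g03))))"
  "q_class 1 0 =
  0"
  "q_class 1 1 =
  0"
  "q_class 1 2 =
  - (jeval R A (alternate f12) * A [3] +
    R [] * (jeval R A (jderiv_R (\<lambda>w. length w = 1) 3 (alternate g03))))"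
  "q_class 1 3 =
  - (R [] * (jeval R A (jderiv_R (\<lambda>w. length w = 0) 3 (alternate g12)) +
      jeval R A (jderiv_R (\<lambda>w. 2 \<le> length w) 3 (alternate g03)) +
      jeval R A (jderiv_A 3 (alternate g03))))"
  "q_class 2 0 =
  0"
  "q_class 2 1 =
  - (jeval R A (alternate f21) * A [3] +
    R [] * (jeval R A (jderiv_R (\<lambda>w. length w = 1) 3 (alternate g12))))"
  "q_class 2 2 =
  - (R [] * (jeval R A (jderiv_R (\<lambda>w. length w = 0) 3 (alternate g21)) +
      jeval R A (jderiv_R (\<lambda>w. 2 \<le> length w) 3 (alternate g12)) +
      jeval R A (jderiv_A 3 (alternate g12))))"
  "q_class 3 0 =
  - (R [] * (jeval R A (jderiv_R (\<lambda>w. length w = 1) 3 (alternate g21))))"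
  "q_class 3 1 =
  - (R [] * (jeval R A (jderiv_R (\<lambda>w. 2 \<le> length w) 3 (alternate g21)) +
      jeval R A (jderiv_A 3 (alternate g21))))"
  "q_class 4 0 =
  0"
proof -
  obtain r r1 r2 r3 r11 r12 r13 r22 r23 r33 r111 r112 r113 r122 r123 r133 r222 r223 r233 r333 a1 a2 a3
    a11 a12 a13 a22 a23 a33 a111 a112 a113 a122 a123 a133 a222 a223 a233 a333 a1111 a1112 a1113
    a1122 a1123 a1133 a1222 a1223 a1233 a1333 a2222 a2223 a2233 a2333 a3333
    where atoms: "R [] = r" "R [1] = r1" "R [2] = r2" "R [3] = r3" "R [1,1] = r11" "R [1,2] = r12"
    "R [1,3] = r13" "R [2,2] = r22" "R [2,3] = r23" "R [3,3] = r33" "R [1,1,1] = r111"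
    "R [1,1,2] = r112" "R [1,1,3] = r113" "R [1,2,2] = r122" "R [1,2,3] = r123" "R [1,3,3] = r133"
    "R [2,2,2] = r222" "R [2,2,3] = r223" "R [2,3,3] = r233" "R [3,3,3] = r333" "A [1] = a1"
    "A [2] = a2" "A [3] = a3" "A [1,1] = a11" "A [1,2] = a12" "A [1,3] = a13" "A [2,2] = a22"
    "A [2,3] = a23" "A [3,3] = a33" "A [1,1,1] = a111" "A [1,1,2] = a112" "A [1,1,3] = a113"
    "A [1,2,2] = a122" "A [1,2,3] = a123" "A [1,3,3] = a133" "A [2,2,2] = a222" "A [2,2,3] = a223"
    "A [2,3,3] = a233" "A [3,3,3] = a333" "A [1,1,1,1] = a1111" "A [1,1,1,2] = a1112"
    "A [1,1,1,3] = a1113" "A [1,1,2,2] = a1122" "A [1,1,2,3] = a1123" "A [1,1,3,3] = a1133"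
    "A [1,2,2,2] = a1222" "A [1,2,2,3] = a1223" "A [1,2,3,3] = a1233" "A [1,3,3,3] = a1333"
    "A [2,2,2,2] = a2222" "A [2,2,2,3] = a2223" "A [2,2,3,3] = a2233" "A [2,3,3,3] = a2333"
    "A [3,3,3,3] = a3333"
    by (rule that; rule refl)
  show "q_class 0 0 =
  0"
    by (simp only: q_eval)
  show "q_class 0 1 =
  0"
    by (simp only: q_eval)
  show "q_class 0 2 =
  0"
    by (simp only: q_eval,
      simp only: sort atoms mult_1_right add_0_right,
      algebra)
  show "q_class 0 3 =
  - (jeval R A (alternate f03) * A [3])"
    by (simp only: q_eval,
      simp only: jeval_alternate jderiv_alternate f03_def
        jmap_def list_eval permute_simps,
      simp only: jeval_def list_eval append.simps,
      simp only: sort atoms mult_1_right add_0_right,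
      algebra)
  \<comment> \<open>No factor rho in \<open>g03\<close> is undifferentiated, so the right side is an
    empty sum; it is kept in this shape because \<open>q_main\<close> reassembles the full
    derivative from all its parts.\<close>
  show "q_class 0 4 =
  - (R [] * (jeval R A (jderiv_R (\<lambda>w. length w = 0) 3 (alternate g03))))"
    by (simp only: q_eval,
      simp only: jeval_alternate jderiv_alternate g03_def
        jmap_def list_eval permute_simps,
      simp only: jderiv_eval,
      simp only: jeval_def list_eval append.simps,
      simp only: sort atoms mult_1_right add_0_right,
      algebra)
  show "q_class 1 0 =
  0"
    by (simp only: q_eval)
  show "q_class 1 1 =
  0"
    by (simp only: q_eval,
      simp only: sort atoms mult_1_right add_0_right,
      algebra)
  show "q_class 1 2 =
  - (jeval R A (alternate f12) * A [3] +
    R [] * (jeval R A (jderiv_R (\<lambda>w. length w = 1) 3 (alternate g03))))"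
    by (simp only: q_eval,
      simp only: jeval_alternate jderiv_alternate f12_def g03_def
        jmap_def list_eval permute_simps,
      simp only: jderiv_eval,
      simp only: jeval_def list_eval append.simps,
      simp only: sort atoms mult_1_right add_0_right,
      algebra)
  show "q_class 1 3 =
  - (R [] * (jeval R A (jderiv_R (\<lambda>w. length w = 0) 3 (alternate g12)) +
      jeval R A (jderiv_R (\<lambda>w. 2 \<le> length w) 3 (alternate g03)) +
      jeval R A (jderiv_A 3 (alternate g03))))"
    by (simp only: q_eval,
      simp only: jeval_alternate jderiv_alternate g03_def g12_def
        jmap_def list_eval permute_simps,
      simp only: jderiv_eval,
      simp only: jeval_def list_eval append.simps,
      simp only: sort atoms mult_1_right add_0_right,
      algebra)
  show "q_class 2 0 =
  0"
    by (simp only: q_eval,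
      simp only: sort atoms mult_1_right add_0_right,
      algebra)
  show "q_class 2 1 =
  - (jeval R A (alternate f21) * A [3] +
    R [] * (jeval R A (jderiv_R (\<lambda>w. length w = 1) 3 (alternate g12))))"
    by (simp only: q_eval,
      simp only: jeval_alternate jderiv_alternate f21_def g12_def
        jmap_def list_eval permute_simps,
      simp only: jderiv_eval,
      simp only: jeval_def list_eval append.simps,
      simp only: sort atoms mult_1_right add_0_right,
      algebra)
  show "q_class 2 2 =
  - (R [] * (jeval R A (jderiv_R (\<lambda>w. length w = 0) 3 (alternate g21)) +
      jeval R A (jderiv_R (\<lambda>w. 2 \<le> length w) 3 (alternate g12)) +
      jeval R A (jderiv_A 3 (alternate g12))))"
    by (simp only: q_eval,
      simp only: jeval_alternate jderiv_alternate g12_def g21_def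
        jmap_def list_eval permute_simps,
      simp only: jderiv_eval,
      simp only: jeval_def list_eval append.simps,
      simp only: sort atoms mult_1_right add_0_right,
      algebra)
  show "q_class 3 0 =
  - (R [] * (jeval R A (jderiv_R (\<lambda>w. length w = 1) 3 (alternate g21))))"
    by (simp only: q_eval,
      simp only: jeval_alternate jderiv_alternate g21_def
        jmap_def list_eval permute_simps,
      simp only: jderiv_eval,
      simp only: jeval_def list_eval append.simps,
      simp only: sort atoms mult_1_right add_0_right,
      algebra)
  show "q_class 3 1 =
  - (R [] * (jeval R A (jderiv_R (\<lambda>w. 2 \<le> length w) 3 (alternate g21)) +
      jeval R A (jderiv_A 3 (alternate g21))))"
    by (simp only: q_eval,
      simp only: jeval_alternate jderiv_alternate g21_def
        jmap_def list_eval permute_simps,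
      simp only: jderiv_eval,
      simp only: jeval_def list_eval append.simps,
      simp only: sort atoms mult_1_right add_0_right,
      algebra)
  show "q_class 4 0 =
  0"
    by (simp only: q_eval,
      simp only: sort atoms mult_1_right add_0_right,
      algebra)
qed

lemma sum_atMost_4: "(\<Sum>i\<le>4::nat. f i) = f 0 + f 1 + f 2 + f 3 + (f 4 :: real)"
  by (simp add: eval_nat_numeral)

text \<open>The class identities add up to the coefficient in direction 3; the other two directions
  come from shifted jets.\<close>

lemma q_main: "q_poly (V_jet R A) = - (jeval R A f_poly * A [3] + R [] * jeval R A (jderiv 3 g_poly))"
  unfolding q_poly_classes f_poly_def g_poly_def jeval_alternate_append jderiv_split
    jeval_jderiv_alternate_append sum_atMost_4 q_class_values
    by (simp add: q_class_eq_0) algebra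

end

section \<open>Brackets of the basis graphs on sparse jets\<close>

locale sparse_jets = jets +
  fixes a3 a13 a23 a123 r1 r12 r22 r122 :: real
  assumes R_values: "R [] = 1" "R [1] = r1" "R [2] = 0" "R [3] = 0" "R [1,1] = 0" "R [1,2] = r12" "R [1,3] = 0"
    "R [2,2] = r22" "R [2,3] = 0" "R [3,3] = 0" "R [1,1,1] = 0" "R [1,1,2] = 0" "R [1,1,3] = 0"
    "R [1,2,2] = r122" "R [1,2,3] = 0" "R [1,3,3] = 0" "R [2,2,2] = 0" "R [2,2,3] = 0"
    "R [2,3,3] = 0" "R [3,3,3] = 0" "R [1,1,1,1] = 0" "R [1,1,1,2] = 0" "R [1,1,1,3] = 0"
    "R [1,1,2,2] = 0" "R [1,1,2,3] = 0" "R [1,1,3,3] = 0" "R [1,2,2,2] = 0" "R [1,2,2,3] = 0"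
    "R [1,2,3,3] = 0" "R [1,3,3,3] = 0" "R [2,2,2,2] = 0" "R [2,2,2,3] = 0" "R [2,2,3,3] = 0"
    "R [2,3,3,3] = 0" "R [3,3,3,3] = 0"
    and A_values: "A [1] = 0" "A [2] = 1" "A [3] = a3" "A [1,1] = 0" "A [1,2] = 0" "A [1,3] = a13" "A [2,2] = 0"
    "A [2,3] = a23" "A [3,3] = 0" "A [1,1,1] = 0" "A [1,1,2] = 0" "A [1,1,3] = 0" "A [1,2,2] = 0"
    "A [1,2,3] = a123" "A [1,3,3] = 0" "A [2,2,2] = 0" "A [2,2,3] = 0" "A [2,3,3] = 0"
    "A [3,3,3] = 0" "A [1,1,1,1] = 0" "A [1,1,1,2] = 0" "A [1,1,1,3] = 0" "A [1,1,2,2] = 0"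
    "A [1,1,2,3] = 0" "A [1,1,3,3] = 0" "A [1,2,2,2] = 0" "A [1,2,2,3] = 0" "A [1,2,3,3] = 0"
    "A [1,3,3,3] = 0" "A [2,2,2,2] = 0" "A [2,2,2,3] = 0" "A [2,2,3,3] = 0" "A [2,3,3,3] = 0"
    "A [3,3,3,3] = 0"
begin

text \<open>Eight free values keep the brackets short, yet component 2 alone still separates the
  twenty graphs up to the three Hamiltonian directions, as \<open>brk_kernel\<close> shows.\<close>

lemma brk_sparse:
  "brk [[0,1,4],[1,3,5],[1,2,6]] R A 2 = (-4) * a3 * a3 * a3 * r1 * r12 * r122 + (-2) * a3 * a3 * a23 * r1 * r1 * r122"
  "brk [[0,1,4],[1,3,5],[1,5,6]] R A 2 = (-2) * a3 * a3 * a13 * r12 * r122 + (-2) * a3 * a3 * a123 * r1 * r122 + (-2) * a3 * a23 * a13 * r1 * r122"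
  "brk [[0,1,4],[1,3,5],[4,2,6]] R A 2 = 2 * a3 * a3 * a23 * r1 * r1 * r122 + 1 * a3 * a3 * a23 * r1 * r12 * r12 + (-1) * a3 * a3 * a23 * r22 * r1 * r1 * r1 + (-2) * a3 * a3 * a13 * r22 * r1 * r12 + (-1) * a3 * a3 * a123 * r22 * r1 * r1 + 1 * a3 * a23 * a23 * r1 * r1 * r12 + 1 * a3 * a23 * a13 * r22 * r1 * r1"
  "brk [[0,1,4],[1,3,5],[4,5,6]] R A 2 = 1 * a3 * a23 * a13 * r1 * r122 + 1 * a3 * a23 * a13 * r12 * r12 + (-3) * a3 * a13 * a123 * r22 * r1 + 1 * a23 * a23 * a13 * r1 * r12 + (-1) * a23 * a13 * a13 * r22 * r1"
  "brk [[0,1,4],[1,6,5],[1,5,6]] R A 2 = (-4) * a3 * a23 * a13 * r1 * r122 + (-8) * a3 * a13 * a123 * r122"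
  "brk [[0,1,4],[1,6,5],[4,2,6]] R A 2 = (-3) * a3 * a23 * a123 * r1 * r12 + 1 * a3 * a13 * a123 * r22 * r1"
  "brk [[0,1,4],[4,3,5],[4,2,6]] R A 2 = (-4) * a3 * a3 * a123 * r22 * r1 * r1"
  "brk [[0,1,4],[4,3,5],[4,5,6]] R A 2 = 1 * a3 * a23 * a123 * r1 * r12 + (-3) * a3 * a13 * a123 * r22 * r1"
  "brk [[0,1,4],[4,6,5],[4,5,6]] R A 2 = (-4) * a23 * a13 * a123 * r12 + (-4) * a23 * a123 * a123 * r1"
  "brk [[0,3,4],[1,3,5],[1,2,6]] R A 2 = 2 * a3 * a3 * a3 * r1 * r12 * r122 + 2 * a3 * a3 * a23 * r1 * r12 * r12"
  "brk [[0,3,4],[1,3,5],[1,5,6]] R A 2 = 2 * a3 * a3 * a13 * r12 * r122"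
  "brk [[0,3,4],[1,6,5],[1,2,6]] R A 2 = 1 * a3 * a3 * a23 * r1 * r1 * r122 + 1 * a3 * a3 * a23 * r1 * r12 * r12 + (-1) * a3 * a3 * a123 * r22 * r1 * r1 + 1 * a3 * a23 * a23 * r1 * r1 * r12 + (-1) * a3 * a23 * a13 * r22 * r1 * r1"
  "brk [[0,3,4],[1,6,5],[1,5,6]] R A 2 = 4 * a3 * a23 * a13 * r1 * r122 + 4 * a3 * a23 * a123 * r1 * r12 + (-4) * a3 * a13 * a123 * r22 * r1"
  "brk [[0,3,4],[1,6,5],[4,2,6]] R A 2 = 2 * a3 * a23 * a23 * r1 * r1 * r12 + (-2) * a3 * a23 * a13 * r22 * r1 * r1"
  "brk [[0,3,4],[4,3,5],[4,2,6]] R A 2 = (-4) * a3 * a3 * a123 * r1 * r122 + (-4) * a3 * a3 * a123 * r12 * r12 + (-3) * a3 * a23 * a123 * r1 * r12 + (-3) * a3 * a13 * a123 * r22 * r1"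
  "brk [[0,3,4],[4,3,5],[4,5,6]] R A 2 = (-1) * a3 * a23 * a123 * r1 * r12 + (-4) * a3 * a13 * a123 * r122 + (-1) * a3 * a13 * a123 * r22 * r1 + (-4) * a3 * a123 * a123 * r12 + (-4) * a23 * a13 * a123 * r12"
  "brk [[0,6,4],[1,3,5],[1,2,6]] R A 2 = 1 * a3 * a3 * a23 * r1 * r1 * r122 + (-2) * a3 * a3 * a23 * r1 * r12 * r12 + (-1) * a3 * a3 * a23 * r22 * r1 * r1 * r1"
  "brk [[0,6,4],[1,6,5],[1,2,6]] R A 2 = 2 * a3 * a3 * a123 * r1 * r122 + 1 * a3 * a23 * a123 * r1 * r12 + 1 * a3 * a13 * a123 * r22 * r1"
  "brk [[0,6,4],[1,6,5],[1,5,6]] R A 2 = (-2) * a3 * a23 * a123 * r1 * r12 + 4 * a3 * a13 * a123 * r122 + 2 * a3 * a13 * a123 * r22 * r1"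
  "brk [[0,6,4],[1,6,5],[4,2,6]] R A 2 = 5 * a3 * a23 * a123 * r1 * r12 + 1 * a3 * a13 * a123 * r22 * r1"
  by (simp add: brk_def sum_3 dcomp_unfold,
      simp only: eps2_simps eps3_def sort R_values A_values mult_zero_left mult_zero_right mult_1_left mult_1_right
        add_0_left add_0_right diff_zero diff_0 minus_zero diff_self, algebra?)+

end

section \<open>Differential polynomials along smooth functions\<close>

definition jet :: "(real^3 \<Rightarrow> real) \<Rightarrow> real^3 \<Rightarrow> 3 list \<Rightarrow> real" where
  "jet f x w = foldr pd w f x"

text \<open>Smoothness travels with the derivative, so that the sum and product rules compose by
  \<open>intro\<close> and the derivative is synthesized on the way.\<close>

definition has_pd :: "3 \<Rightarrow> (real^3 \<Rightarrow> real) \<Rightarrow> (real^3 \<Rightarrow> real) \<Rightarrow> bool" where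
  "has_pd l f f' \<longleftrightarrow> smooth f \<and> pd l f = f'"

lemma has_pd_cong: "has_pd l f f' \<Longrightarrow> (\<And>x. f' x = g' x) \<Longrightarrow> has_pd l f g'"
  by (simp add: has_pd_def fun_eq_iff)

lemma has_pd_jet: "smooth f \<Longrightarrow> has_pd l (\<lambda>x. jet f x w) (\<lambda>x. jet f x (l # w))"
  by (simp add: has_pd_def jet_def smooth_foldr_pd fun_eq_iff)

lemma has_pd_const: "has_pd l (\<lambda>x. c) (\<lambda>x. 0)"
  by (simp add: has_pd_def smooth_const pd_zero fun_eq_iff)

lemma has_pd_add: "has_pd l f f' \<Longrightarrow> has_pd l g g' \<Longrightarrow> has_pd l (\<lambda>x. f x + g x) (\<lambda>x. f' x + g' x)"
  by (auto simp: has_pd_def smooth_add pd_add smooth_differentiable fun_eq_iff)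

lemma has_pd_mult:
  "has_pd l f f' \<Longrightarrow> has_pd l g g' \<Longrightarrow> has_pd l (\<lambda>x. f x * g x) (\<lambda>x. f' x * g x + f x * g' x)"
  by (auto simp: has_pd_def smooth_mult pd_mult smooth_differentiable fun_eq_iff)

lemma has_pd_cmult: "has_pd l f f' \<Longrightarrow> has_pd l (\<lambda>x. c * f x) (\<lambda>x. c * f' x)"
  using has_pd_mult[OF has_pd_const, of l f f' c] by simp

lemma has_pd_diff: "has_pd l f f' \<Longrightarrow> has_pd l g g' \<Longrightarrow> has_pd l (\<lambda>x. f x - g x) (\<lambda>x. f' x - g' x)"
  using has_pd_add[OF _ has_pd_cmult, of l f f' g g' "-1"] by simp

lemma has_pd_eps3:
  "(\<And>i j k. has_pd l (h i j k) (h' i j k)) \<Longrightarrow>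
    has_pd l (\<lambda>x. eps3 (\<lambda>i j k. h i j k x)) (\<lambda>x. eps3 (\<lambda>i j k. h' i j k x))"
  unfolding eps3_def by (intro has_pd_add has_pd_diff)

lemma has_pd_eps2:
  "(\<And>j k. has_pd l (h j k) (h' j k)) \<Longrightarrow>
    has_pd l (\<lambda>x. eps2 i (\<lambda>j k. h j k x)) (\<lambda>x. eps2 i (\<lambda>j k. h' j k x))"
  using exhaust_3[of i] by (auto simp: eps2_simps intro!: has_pd_diff)

lemma has_pd_sum_list:
  "(\<And>y. y \<in> set ys \<Longrightarrow> has_pd l (f y) (f' y)) \<Longrightarrow>
    has_pd l (\<lambda>x. \<Sum>y\<leftarrow>ys. f y x) (\<lambda>x. \<Sum>y\<leftarrow>ys. f' y x)"
  by (induction ys) (auto intro: has_pd_const has_pd_add)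

context
  fixes \<rho> a :: "real^3 \<Rightarrow> real"
  assumes \<rho>: "smooth \<rho>" and a: "smooth a"
begin

lemma jets_jet: "jets (jet \<rho> x) (jet a x)"
  by unfold_locales (simp_all only: jet_def foldr_pd_swap[OF \<rho>] foldr_pd_swap[OF a])

lemma has_pd_comp3:
  "has_pd l (\<lambda>x. comp3 G (jet \<rho> x) (jet a x) i) (\<lambda>x. dcomp3 l G (jet \<rho> x) (jet a x) i)"
proof -
  have "has_pd l (\<lambda>x. mono3 ts (jet \<rho> x) (jet a x) is) (\<lambda>x. dmono3 l ts (jet \<rho> x) (jet a x) is)" for ts "is"
    unfolding mono3_def
    by (rule has_pd_cong, (rule has_pd_mult has_pd_jet \<rho> a)+) (simp add: dmono3_def algebra_simps)
  then show ?thesis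
    unfolding comp3_def dcomp3_def by (intro has_pd_eps2 has_pd_eps3)
qed

lemma has_pd_comp2:
  "has_pd l (\<lambda>x. comp2 G (jet \<rho> x) (jet a x)) (\<lambda>x. dcomp2 l G (jet \<rho> x) (jet a x))"
proof -
  have "has_pd l (\<lambda>x. mono2 ts (jet \<rho> x) (jet a x) is) (\<lambda>x. dmono2 l ts (jet \<rho> x) (jet a x) is)" for ts "is"
    unfolding mono2_def
    by (rule has_pd_cong, (rule has_pd_mult has_pd_jet \<rho> a)+) (simp add: dmono2_def algebra_simps)
  then show ?thesis
    unfolding comp2_def dcomp2_def by (intro has_pd_eps3)
qed

lemma has_pd_prod_list:
  assumes "smooth f"
  shows "has_pd l (\<lambda>x. prod_list (map (jet f x) us)) (\<lambda>x. \<Sum>us'\<leftarrow>dwords l us. prod_list (map (jet f x) us'))"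
proof (induction us)
  case Nil
  then show ?case using has_pd_const[of l 1] by simp
next
  case (Cons u us)
  show ?case
    by (simp, rule has_pd_cong[OF has_pd_mult[OF has_pd_jet[OF assms] Cons.IH]])
      (simp add: o_def sum_list_const_mult)
qed

lemma has_pd_jeval:
  "has_pd l (\<lambda>x. jeval (jet \<rho> x) (jet a x) p) (\<lambda>x. jeval (jet \<rho> x) (jet a x) (jderiv l p))"
proof (induction p)
  case Nil
  then show ?case using has_pd_const[of l 0] by (simp add: jeval_def jderiv_def)
next
  case (Cons t p)
  obtain c us vs where t: "t = (c, us, vs)" by (cases t)
  have h: "jeval R A (jderiv l (t # p)) =
      c * ((\<Sum>us'\<leftarrow>dwords l us. prod_list (map R us')) * prod_list (map A vs) +
        prod_list (map R us) * (\<Sum>vs'\<leftarrow>dwords l vs. prod_list (map A vs'))) + jeval R A (jderiv l p)" for R A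
    by (simp add: t jeval_def jderiv_def o_def sum_list_const_mult[symmetric] sum_list_mult_const[symmetric]
      distrib_left)
  have "jeval R A (t # p) = c * (prod_list (map R us) * prod_list (map A vs)) + jeval R A p" for R A
    by (simp add: t jeval_def)
  then show ?case
    unfolding h by (simp only:) (intro has_pd_add has_pd_cmult has_pd_mult has_pd_prod_list \<rho> a Cons.IH)
qed

lemma foldr_pd_jeval:
  "foldr pd w (\<lambda>x. jeval (jet \<rho> x) (jet a x) p) = (\<lambda>x. jeval (jet \<rho> x) (jet a x) (foldr jderiv w p))"
  by (induction w) (use has_pd_jeval in \<open>auto simp: has_pd_def\<close>)

lemma V_jet_jet: "foldr pd w (\<lambda>x. \<rho> x * pd k a x) x = V_jet (jet \<rho> x) (jet a x) k w"
proof -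
  have "(\<lambda>x. \<rho> x * pd k a x) = (\<lambda>x. jeval (jet \<rho> x) (jet a x) [(1, [[]], [[k]])])"
    by (simp add: jeval_def jet_def)
  then show ?thesis by (simp only: foldr_pd_jeval V_jet_def)
qed

end

section \<open>Cyclic relabelling of the coordinates\<close>

lemma jets_rotj: "jets R A \<Longrightarrow> jets (rotj R) (rotj A)"
  by (simp add: jets_def rotj_def)

lemma jeval_rotj: "jeval (rotj R) (rotj A) p = jeval R A (jmap 1 rot p)"
  by (simp add: jeval_def jmap_def rotj_def[abs_def] o_def case_prod_unfold)

lemma dwords_map: "dwords (f l) (map (map f) us) = map (map (map f)) (dwords l us)"
  by (induction us) (simp_all add: o_def)

lemma jderiv_jmap: "jderiv (f l) (jmap s f p) = jmap s f (jderiv l p)"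
  by (induction p) (auto simp: jderiv_def jmap_def dwords_map o_def)

lemma foldr_jderiv_jmap: "foldr jderiv (map f w) (jmap s f p) = jmap s f (foldr jderiv w p)"
  by (induction w) (simp_all add: jderiv_jmap)

lemma V_jet_rotj: "V_jet (rotj R) (rotj A) = (\<lambda>k w. V_jet R A (rot k) (map rot w))"
proof (intro ext)
  fix k w
  have "[(1, [[]], [[rot k]])] = jmap 1 rot [(1, [[]], [[k]])]" by (simp add: jmap_def)
  then show "V_jet (rotj R) (rotj A) k w = V_jet R A (rot k) (map rot w)"
    by (simp only: V_jet_def jeval_rotj foldr_jderiv_jmap)
qed

text \<open>Followed by the shift, a permutation becomes another one of the same sign; hence the
  shift only reorders the six summands of \<open>alternate\<close>.\<close>

lemma jmap_rot_permute: "jmap 1 rot (jmap s (permute i j k) p) = jmap s (permute (rot i) (rot j) (rot k)) p"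
proof -
  have "rot \<circ> permute i j k = permute (rot i) (rot j) (rot k)"
    by (auto simp: permute_def)
  then show ?thesis by (simp add: jmap_def o_def case_prod_unfold fun_eq_iff)
qed

lemma jeval_alternate_rotj: "jeval (rotj R) (rotj A) (alternate p) = jeval R A (alternate p)"
  by (simp add: jeval_rotj alternate_def jmap_append jmap_rot_permute jeval_append)

lemma jeval_jderiv_alternate_rotj:
  "jeval (rotj R) (rotj A) (jderiv l (alternate p)) = jeval R A (jderiv (rot l) (alternate p))"
  by (simp add: jeval_rotj jderiv_jmap[symmetric] alternate_def jmap_append jmap_rot_permute jderiv_append
      jeval_append)

section \<open>The trivialization of the flow\<close>

definition lin :: "(real \<times> graph) list \<Rightarrow> (3 list \<Rightarrow> real) \<Rightarrow> (3 list \<Rightarrow> real) \<Rightarrow> 3 \<Rightarrow> real" where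
  "lin L R A i = (\<Sum>(c, G)\<leftarrow>L. c * comp3 G R A i)"

definition dlin :: "3 \<Rightarrow> (real \<times> graph) list \<Rightarrow> (3 list \<Rightarrow> real) \<Rightarrow> (3 list \<Rightarrow> real) \<Rightarrow> 3 \<Rightarrow> real" where
  "dlin l L R A i = (\<Sum>(c, G)\<leftarrow>L. c * dcomp3 l G R A i)"

definition lbrk :: "(real \<times> graph) list \<Rightarrow> (3 list \<Rightarrow> real) \<Rightarrow> (3 list \<Rightarrow> real) \<Rightarrow> 3 \<Rightarrow> real" where
  "lbrk L R A k = (\<Sum>(c, G)\<leftarrow>L. c * brk G R A k)"

lemma lbrk_lin:
  "lbrk L R A k =
     - ((\<Sum>i\<in>UNIV. lin L R A i * R [i] - R [] * dlin i L R A i) * A [k]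
        + R [] * (\<Sum>i\<in>UNIV. dlin k L R A i * A [i] + lin L R A i * A [i, k]))"
proof (induction L)
  case (Cons t L)
  then show ?case
    by (cases t) (simp add: lbrk_def lin_def dlin_def brk_def sum_3 algebra_simps)
qed (simp add: lbrk_def lin_def dlin_def)

lemma lbrk_append: "lbrk (L @ M) R A k = lbrk L R A k + lbrk M R A k"
  by (simp add: lbrk_def)

lemma has_pd_lin:
  assumes "smooth \<rho>" "smooth a"
  shows "has_pd l (\<lambda>x. lin L (jet \<rho> x) (jet a x) i) (\<lambda>x. dlin l L (jet \<rho> x) (jet a x) i)"
  unfolding lin_def dlin_def case_prod_unfold
  by (intro has_pd_sum_list has_pd_cmult has_pd_comp3 assms)

lemma bracket_coeff_lin:
  assumes "smooth \<rho>" "smooth a" "\<And>i. X i = (\<lambda>x. lin L (jet \<rho> x) (jet a x) i)"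
  shows "bracket_coeff \<rho> a X k x = lbrk L (jet \<rho> x) (jet a x) k"
proof -
  have "pd l (X i) x = dlin l L (jet \<rho> x) (jet a x) i" for l i
    using has_pd_lin[OF assms(1,2), of l L i] by (simp add: assms(3) has_pd_def)
  then show ?thesis
    by (simp add: bracket_coeff_def lbrk_lin assms(3) jet_def)
qed

text \<open>Identifies f and g of the given field with the two explicit polynomials; the derivative
  of g then needs no expansion of its own.\<close>

lemma lbrk_X_terms:
  assumes "smooth \<rho>" "smooth a"
  shows "lbrk X_terms (jet \<rho> x) (jet a x) k =
    - (jeval (jet \<rho> x) (jet a x) f_poly * jet a x [k]
       + jet \<rho> x [] * jeval (jet \<rho> x) (jet a x) (jderiv k g_poly))"
proof -
  have f: "(\<Sum>i\<in>UNIV. lin X_terms R A i * R [i] - R [] * dlin i X_terms R A i) = jeval R A f_poly"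
    if "jets R A" for R A
  proof -
    have "(\<Sum>i\<in>UNIV. lin L R A i * R [i] - R [] * dlin i L R A i) =
      (\<Sum>(c, G)\<leftarrow>L. c * (comp3 G R A 1 * R [1] + comp3 G R A 2 * R [2] + comp3 G R A 3 * R [3]
        - R [] * (dcomp3 1 G R A 1 + dcomp3 2 G R A 2 + dcomp3 3 G R A 3)))" for L
      by (induction L) (auto simp: lin_def dlin_def sum_3 algebra_simps)
    then show ?thesis by (simp only: jets.f_poly[OF that])
  qed
  have g: "(\<Sum>i\<in>UNIV. lin X_terms R A i * A [i]) = jeval R A g_poly" if "jets R A" for R A
  proof -
    have "(\<Sum>i\<in>UNIV. lin L R A i * A [i]) =
      (\<Sum>(c, G)\<leftarrow>L. c * (comp3 G R A 1 * A [1] + comp3 G R A 2 * A [2] + comp3 G R A 3 * A [3]))" for L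
      by (induction L) (auto simp: lin_def sum_3 algebra_simps)
    then show ?thesis by (simp only: jets.g_poly[OF that])
  qed
  \<comment> \<open>The function g is differentiated in two ways, by the product rule on X.grad a
    and as a jet polynomial. Its derivative is unique, so the two results agree.\<close>
  have "has_pd k (\<lambda>x. \<Sum>i\<in>UNIV. lin X_terms (jet \<rho> x) (jet a x) i * jet a x [i])
    (\<lambda>x. \<Sum>i\<in>UNIV. dlin k X_terms (jet \<rho> x) (jet a x) i * jet a x [i] +
       lin X_terms (jet \<rho> x) (jet a x) i * jet a x [k, i])"
    unfolding sum_3 by (intro has_pd_add has_pd_mult has_pd_lin has_pd_jet assms)
  moreover have "has_pd k (\<lambda>x. \<Sum>i\<in>UNIV. lin X_terms (jet \<rho> x) (jet a x) i * jet a x [i])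
    (\<lambda>x. jeval (jet \<rho> x) (jet a x) (jderiv k g_poly))"
    unfolding g[OF jets_jet[OF assms]] by (rule has_pd_jeval[OF assms])
  ultimately have "(\<Sum>i\<in>UNIV. dlin k X_terms (jet \<rho> x) (jet a x) i * jet a x [i] +
       lin X_terms (jet \<rho> x) (jet a x) i * jet a x [k, i]) = jeval (jet \<rho> x) (jet a x) (jderiv k g_poly)"
    unfolding has_pd_def by metis
  moreover have "jet a x [k, i] = jet a x [i, k]" for i
    using foldr_pd_swap[OF assms(2), of "[]" k i "[]"] by (simp add: jet_def)
  ultimately show ?thesis
    unfolding lbrk_lin f[OF jets_jet[OF assms]] by simp
qed

text \<open>\<open>q_main\<close> concerns direction 3. Shifting the jets once turns it into
  direction 1, shifting twice into direction 2, while f and g stay the same because they are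
  alternating sums.\<close>

lemma tetrahedral_flow_X_terms:
  assumes "smooth \<rho>" "smooth a"
  shows "tetrahedral_flow (nambu \<rho> a) {1, 2} x = lbrk X_terms (jet \<rho> x) (jet a x) 3"
    "tetrahedral_flow (nambu \<rho> a) {3, 2} x = - lbrk X_terms (jet \<rho> x) (jet a x) 1"
    "tetrahedral_flow (nambu \<rho> a) {3, 1} x = lbrk X_terms (jet \<rho> x) (jet a x) 2"
proof -
  let ?R = "jet \<rho> x" and ?A = "jet a x"
  note rot_invariant = jeval_alternate_rotj jeval_jderiv_alternate_rotj rot_simps
  note flow = tetrahedral_flow_q_poly[OF assms, of x, unfolded V_jet_jet[OF assms]]
  have j: "jets ?R ?A" "jets (rotj ?R) (rotj ?A)" "jets (rotj (rotj ?R)) (rotj (rotj ?A))"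
    by (intro jets_rotj jets_jet[OF assms])+
  have r: "rotj R [] = R []" "rotj R [k] = R [rot k]" for R k
    by (simp_all add: rotj_def)
  have V: "(\<lambda>k w. V_jet ?R ?A k w) = V_jet ?R ?A" by simp
  have q: "q_poly (V_jet ?R ?A) = lbrk X_terms ?R ?A 3"
    "q_poly (V_jet (rotj ?R) (rotj ?A)) = lbrk X_terms ?R ?A 1"
    "q_poly (V_jet (rotj (rotj ?R)) (rotj (rotj ?A))) = lbrk X_terms ?R ?A 2"
    unfolding jets.q_main[OF j(1)] jets.q_main[OF j(2)] jets.q_main[OF j(3)] lbrk_X_terms[OF assms]
    by (simp_all only: f_poly_def g_poly_def rot_invariant r)
  show "tetrahedral_flow (nambu \<rho> a) {1, 2} x = lbrk X_terms ?R ?A 3"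
    using flow(1) q(1) by simp
  show "tetrahedral_flow (nambu \<rho> a) {3, 2} x = - lbrk X_terms ?R ?A 1"
    using flow(2) q(2) by (simp add: V_jet_rotj)
  show "tetrahedral_flow (nambu \<rho> a) {3, 1} x = lbrk X_terms ?R ?A 2"
    using flow(3) q(3) by (simp add: V_jet_rotj)
qed

section \<open>The span of the descendants\<close>

definition reducible :: "graph list" where
  "reducible = [
    [[0,1,4],[1,6,5],[1,2,6]], [[0,1,4],[1,6,5],[4,5,6]], [[0,1,4],[4,3,5],[1,2,6]],
    [[0,1,4],[4,3,5],[1,5,6]], [[0,1,4],[4,6,5],[1,2,6]], [[0,1,4],[4,6,5],[1,5,6]],
    [[0,1,4],[4,6,5],[4,2,6]], [[0,3,4],[1,3,5],[4,2,6]], [[0,3,4],[1,3,5],[4,5,6]],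
    [[0,3,4],[1,6,5],[4,5,6]], [[0,3,4],[4,3,5],[1,2,6]], [[0,3,4],[4,3,5],[1,5,6]],
    [[0,3,4],[4,6,5],[1,2,6]], [[0,3,4],[4,6,5],[1,5,6]], [[0,3,4],[4,6,5],[4,2,6]],
    [[0,3,4],[4,6,5],[4,5,6]], [[0,6,4],[1,3,5],[1,5,6]], [[0,6,4],[1,3,5],[4,2,6]],
    [[0,6,4],[1,3,5],[4,5,6]], [[0,6,4],[1,6,5],[4,5,6]], [[0,6,4],[4,3,5],[1,2,6]],
    [[0,6,4],[4,3,5],[1,5,6]], [[0,6,4],[4,3,5],[4,2,6]], [[0,6,4],[4,3,5],[4,5,6]],
    [[0,6,4],[4,6,5],[1,2,6]], [[0,6,4],[4,6,5],[1,5,6]], [[0,6,4],[4,6,5],[4,2,6]],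
    [[0,6,4],[4,6,5],[4,5,6]]]"

text \<open>The coefficients are chosen before the jets: the combination has to be the same at all
  points and for all rho and a.\<close>

definition in_span :: "((3 list \<Rightarrow> real) \<Rightarrow> (3 list \<Rightarrow> real) \<Rightarrow> real) \<Rightarrow> bool" where
  "in_span f \<longleftrightarrow> (\<exists>m. \<forall>R A. jets R A \<longrightarrow> f R A = (\<Sum>B\<in>set basis. m B * comp3 B R A 1))"

lemma in_span_cong: "(\<And>R A. jets R A \<Longrightarrow> f R A = g R A) \<Longrightarrow> in_span g \<Longrightarrow> in_span f"
  by (simp add: in_span_def)

lemma in_span_0: "in_span (\<lambda>R A. 0)"
  unfolding in_span_def by (rule exI[of _ "\<lambda>B. 0"]) simp

lemma in_span_basis:
  assumes "B \<in> set basis"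
  shows "in_span (\<lambda>R A. comp3 B R A 1)"
  unfolding in_span_def
proof (intro exI allI impI)
  fix R A
  show "comp3 B R A 1 = (\<Sum>C\<in>set basis. (if C = B then 1 else 0) * comp3 C R A 1)"
    using assms by (simp add: if_distrib[of "\<lambda>c. c * _"] cong: if_cong)
qed

lemma in_span_cmult:
  assumes "in_span f"
  shows "in_span (\<lambda>R A. c * f R A)"
proof -
  obtain m where "\<And>R A. jets R A \<Longrightarrow> f R A = (\<Sum>B\<in>set basis. m B * comp3 B R A 1)"
    using assms by (auto simp: in_span_def)
  then show ?thesis
    unfolding in_span_def by (intro exI[of _ "\<lambda>B. c * m B"]) (simp add: sum_distrib_left mult.assoc)
qed

lemma in_span_add:
  assumes "in_span f" "in_span g"
  shows "in_span (\<lambda>R A. f R A + g R A)"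
proof -
  obtain m n where "\<And>R A. jets R A \<Longrightarrow> f R A = (\<Sum>B\<in>set basis. m B * comp3 B R A 1)"
    "\<And>R A. jets R A \<Longrightarrow> g R A = (\<Sum>B\<in>set basis. n B * comp3 B R A 1)"
    using assms by (auto simp: in_span_def)
  then show ?thesis
    unfolding in_span_def
    by (intro exI[of _ "\<lambda>B. m B + n B"]) (simp add: sum.distrib[symmetric] distrib_right)
qed

lemma in_span_sum: "(\<And>y. y \<in> Y \<Longrightarrow> in_span (f y)) \<Longrightarrow> in_span (\<lambda>R A. \<Sum>y\<in>Y. f y R A)"
  by (induction Y rule: infinite_finite_induct) (auto intro: in_span_0 in_span_add)

lemma in_span_sum_list: "(\<And>y. y \<in> set ys \<Longrightarrow> in_span (f y)) \<Longrightarrow> in_span (\<lambda>R A. \<Sum>y\<leftarrow>ys. f y R A)"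
  by (induction ys) (auto intro: in_span_0 in_span_add)

lemma in_span_descendant:
  assumes "G \<in> set basis \<union> set reducible"
  shows "in_span (\<lambda>R A. comp3 G R A 1)"
proof -
  have "\<forall>G\<in>set reducible. in_span (\<lambda>R A. comp3 G R A 1)"
    unfolding reducible_def list.set ball_simps
    by (intro conjI TrueI; ((rule in_span_cong, erule jets.relations,
        (intro in_span_add in_span_cmult in_span_0 in_span_basis; simp add: basis_def))?))
  with assms show ?thesis by (auto intro: in_span_basis)
qed

text \<open>Components 2 and 3 of an identity are its component 1 at shifted jets, which are again
  jets.\<close>

lemma jets_rot_extend:
  assumes "jets R A" and eq: "\<And>R A. jets R A \<Longrightarrow> f R A 1 = g R A 1"
    and f: "\<And>R A i. f (rotj R) (rotj A) i = f R A (rot i)"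
    and g: "\<And>R A i. g (rotj R) (rotj A) i = g R A (rot i)"
  shows "f R A i = (g R A i :: real)"
proof -
  have "f R A 2 = g R A 2"
    using eq[OF jets_rotj[OF assms(1)]] f[of R A 1] g[of R A 1] by simp
  moreover have "f R A 3 = g R A 3"
    using eq[OF jets_rotj[OF jets_rotj[OF assms(1)]]] f[of "rotj R" "rotj A" 1] g[of "rotj R" "rotj A" 1]
      f[of R A 2] g[of R A 2] by simp
  ultimately show ?thesis using eq[OF assms(1)] exhaust_3[of i] by auto
qed

lemma phi_jet:
  assumes "sink_first G"
  shows "phi G \<rho> a {i} x = comp3 G (jet \<rho> x) (jet a x) i"
  using phi_comp3(1)[OF assms] by (simp add: jet_def[abs_def])

lemma graph_3_cases:
  assumes "nambu_micrograph True 3 G"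
  obtains t1 t2 t3 t4 t5 t6 t7 t8 t9 where "G = [[t1, t2, t3], [t4, t5, t6], [t7, t8, t9]]"
    "distinct [t1, t2, t3]" "distinct [t4, t5, t6]" "distinct [t7, t8, t9]"
proof -
  have "length G = 3" using assms by (simp add: nambu_micrograph_def)
  then obtain r1 r2 r3 where G: "G = [r1, r2, r3]"
    by (auto simp: numeral_3_eq_3 length_Suc_conv)
  have row: "length (G ! (k - 1)) = 3 \<and> distinct (G ! (k - 1))" if "k \<in> {1..3}" for k
    using assms that by (auto simp: nambu_micrograph_def)
  have "length r1 = 3 \<and> distinct r1" "length r2 = 3 \<and> distinct r2" "length r3 = 3 \<and> distinct r3"
    using row[of 1] row[of 2] row[of 3] by (simp_all add: G)
  moreover from this obtain t1 t2 t3 t4 t5 t6 t7 t8 t9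
    where "r1 = [t1, t2, t3]" "r2 = [t4, t5, t6]" "r3 = [t7, t8, t9]"
    by (auto simp: numeral_3_eq_3 length_Suc_conv)
  ultimately show ?thesis using that G by blast
qed

lemma ball_1_3: "(\<forall>k\<in>{1..3::nat}. P k) \<longleftrightarrow> P 1 \<and> P 2 \<and> P 3"
proof -
  have "{1..3::nat} = {1, 2, 3}" by auto
  then show ?thesis by simp
qed

lemma ball_1_2: "(\<forall>k\<in>{1..2::nat}. P k) \<longleftrightarrow> P 1 \<and> P 2"
proof -
  have "{1..2::nat} = {1, 2}" by auto
  then show ?thesis by simp
qed

text \<open>The rows of vertices 2 and 3 allow sixteen choices. The free target of vertex 1 allows
  three, since 4 already is its Casimir and targets are distinct. These 48 encodings make up the two
  lists.\<close>

lemma descendants_cases: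
  assumes "G \<in> descendants [[0,1],[1,3],[1,2]] \<union> descendants [[0,3],[1,3],[1,2]]"
  shows "G \<in> set basis \<union> set reducible"
proof -
  from assms have "nambu_micrograph True 3 G" by (auto simp: descendants_def)
  then obtain t1 t2 t3 t4 t5 t6 t7 t8 t9 where G: "G = [[t1, t2, t3], [t4, t5, t6], [t7, t8, t9]]"
    and d: "distinct [t1, t2, t3]" "distinct [t4, t5, t6]" "distinct [t7, t8, t9]"
    by (rule graph_3_cases)
  have t: "target G 1 1 = t1" "target G 1 2 = t2" "target G 1 3 = t3"
    "target G 2 1 = t4" "target G 2 2 = t5" "target G 2 3 = t6"
    "target G 3 1 = t7" "target G 3 2 = t8" "target G 3 3 = t9"
    by (simp_all add: G target_def)
  have "t1 = 0 \<and> t3 = 4 \<and> t6 = 5 \<and> t9 = 6 \<and> t4 \<in> {1, 4} \<and> t5 \<in> {3, 6} \<and>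
      t7 \<in> {1, 4} \<and> t8 \<in> {2, 5} \<and> t2 \<in> {1, 4, 3, 6}"
    using assms unfolding descendants_def ball_1_3 Un_iff mem_Collect_eq by (auto simp: G target_def)
  with d show ?thesis
    by (elim conjE insertE emptyE) (simp_all add: G basis_def reducible_def)
qed

section \<open>Membership of explicit encodings in the classes of graphs\<close>

lemma connectedI:
  assumes "\<And>u. u \<in> V \<Longrightarrow> (v, u) \<in> (E \<union> E\<inverse>)\<^sup>*"
  shows "\<forall>u\<in>V. \<forall>w\<in>V. (u, w) \<in> (E \<union> E\<inverse>)\<^sup>*"
proof (intro ballI)
  fix u w assume "u \<in> V" "w \<in> V"
  have "sym ((E \<union> E\<inverse>)\<^sup>*)" by (intro sym_rtrancl sym_Un_converse)
  then have "(u, v) \<in> (E \<union> E\<inverse>)\<^sup>*" using assms[OF \<open>u \<in> V\<close>] by (rule symD)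
  then show "(u, w) \<in> (E \<union> E\<inverse>)\<^sup>*" using assms[OF \<open>w \<in> V\<close>] by (rule rtrancl_trans)
qed

text \<open>Connectedness is checked from vertex 1: it reaches 0 and 4, the vertices 2 and 3 each
  have an edge to 1 or 4, and their Casimirs hang on them. Positive targets elsewhere leave a single
  edge into the sink.\<close>

lemma nambu_micrograph_3I:
  assumes G: "G = [[0, t2, 4], [t4, t5, 5], [t7, t8, 6]]"
    and t: "t4 \<in> {1, 4}" "t7 \<in> {1, 4}"
    and d: "distinct [0, t2, 4]" "distinct [t4, t5, 5]" "distinct [t7, t8, 6]"
    and le: "0 < t5" "0 < t8" "t2 \<le> 6" "t5 \<le> 6" "t8 \<le> 6"
  shows "nambu_micrograph True 3 G"
proof -
  let ?E = "adjacency G \<union> (adjacency G)\<inverse>"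
  have r: "vertices True 3 = {0, 1, 2, 3, 4, 5, 6}"
    by (auto simp: vertices_def)
  have adj: "(1, 0) \<in> ?E" "(1, 4) \<in> ?E" "(t4, 2) \<in> ?E" "(2, 5) \<in> ?E" "(t7, 3) \<in> ?E" "(3, 6) \<in> ?E"
    by (auto simp: adjacency_def G)
  have e: "(1, 0) \<in> ?E\<^sup>*" "(1, 1) \<in> ?E\<^sup>*" "(1, 4) \<in> ?E\<^sup>*"
    using adj by auto
  then have "(1, t4) \<in> ?E\<^sup>*" "(1, t7) \<in> ?E\<^sup>*" using t by auto
  then have e2: "(1, 2) \<in> ?E\<^sup>*" "(1, 3) \<in> ?E\<^sup>*"
    by (auto intro: rtrancl_into_rtrancl[OF _ adj(3)] rtrancl_into_rtrancl[OF _ adj(5)])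
  have e3: "(1, 5) \<in> ?E\<^sup>*" "(1, 6) \<in> ?E\<^sup>*"
    by (rule rtrancl_into_rtrancl[OF e2(1) adj(4)], rule rtrancl_into_rtrancl[OF e2(2) adj(6)])
  have "\<forall>u\<in>vertices True 3. \<forall>v\<in>vertices True 3. (u, v) \<in> ?E\<^sup>*"
    by (rule connectedI[of _ 1]) (use e e2 e3 in \<open>unfold r, elim insertE emptyE, simp_all only:\<close>)
  moreover have "length (incoming G 0) = 1"
  proof -
    have "List.product [1..<length G + 1] [1..<4] = [(1,1), (1,2), (1,3), (2,1), (2,2), (2,3), (3,1), (3,2), (3,3)]"
      by (simp add: G upt_rec)
    moreover have "t2 \<noteq> 0" "t4 \<noteq> 0" "t5 \<noteq> 0" "t7 \<noteq> 0" "t8 \<noteq> 0" using t d(1) le(1,2) by auto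
    ultimately show ?thesis by (simp add: incoming_def target_def G)
  qed
  moreover have "\<forall>k\<in>{1..3}. length (G ! (k - 1)) = 3 \<and> distinct (G ! (k - 1)) \<and>
      3 + k \<in> set (G ! (k - 1)) \<and> set (G ! (k - 1)) \<subseteq> vertices True 3"
  proof -
    have "t4 \<le> 6" "t7 \<le> 6" using t by auto
    then show ?thesis unfolding ball_1_3 vertices_def using d le by (auto simp: G)
  qed
  moreover have "length G = 3" by (simp add: G)
  ultimately show ?thesis unfolding nambu_micrograph_def by blast
qed

text \<open>Both Levi-Civita vertices send an edge to 3, which serves as the root for
  connectedness.\<close>

lemma nambu_micrograph_2I:
  assumes G: "G = [[1, t2, 3], [t4, 3, 4]]" and t: "t2 \<in> {2, 4}" "t4 \<in> {1, 2}"
  shows "nambu_micrograph False 2 G"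
proof -
  let ?E = "adjacency G \<union> (adjacency G)\<inverse>"
  have r: "vertices False 2 = {1, 2, 3, 4}"
    by (auto simp: vertices_def)
  have adj: "(3, 1) \<in> ?E" "(3, 2) \<in> ?E" "(2, 4) \<in> ?E"
    by (auto simp: adjacency_def G)
  have e: "(3, 1) \<in> ?E\<^sup>*" "(3, 2) \<in> ?E\<^sup>*" "(3, 3) \<in> ?E\<^sup>*" using adj by auto
  have e2: "(3, 4) \<in> ?E\<^sup>*" by (rule rtrancl_into_rtrancl[OF e(2) adj(3)])
  have "\<forall>u\<in>vertices False 2. \<forall>v\<in>vertices False 2. (u, v) \<in> ?E\<^sup>*"
    by (rule connectedI[of _ 3]) (use e e2 in \<open>unfold r, elim insertE emptyE, simp_all only:\<close>)
  moreover have "\<forall>k\<in>{1..2}. length (G ! (k - 1)) = 3 \<and> distinct (G ! (k - 1)) \<and>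
      2 + k \<in> set (G ! (k - 1)) \<and> set (G ! (k - 1)) \<subseteq> vertices False 2"
    unfolding ball_1_2 r using t by (auto simp: G)
  moreover have "length G = 2" by (simp add: G)
  ultimately show ?thesis unfolding nambu_micrograph_def by blast
qed

lemma X_terms_descendants:
  assumes "G \<in> snd ` set X_terms"
  shows "G \<in> descendants [[0,1],[1,3],[1,2]] \<union> descendants [[0,3],[1,3],[1,2]]"
  using assms unfolding X_terms_def list.set image_insert image_empty snd_conv
  by (elim insertE emptyE; hypsubst; unfold descendants_def ball_1_3 Un_iff mem_Collect_eq;
      simp add: target_def nambu_micrograph_3I[OF refl])

lemma sink_first_graphs:
  "G \<in> set basis \<union> set reducible \<Longrightarrow> sink_first G"
  by (auto simp: basis_def reducible_def sink_first_def)

lemma sum_if_graph: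
  assumes "finite F" "G \<in> F"
  shows "(\<Sum>\<Gamma>\<in>F. (if \<Gamma> = G then c else 0) * f \<Gamma>) = c * (f G :: real)"
proof -
  have "(if \<Gamma> = G then c else 0) * f \<Gamma> = (if \<Gamma> = G then c * f G else 0)" for \<Gamma> by simp
  with assms show ?thesis by simp
qed

text \<open>A list may repeat a graph, while a span is a sum over a set; the coefficient of a graph
  is therefore collected over the whole list.\<close>

lemma graph_span_lin:
  assumes "snd ` set L \<subseteq> \<G>"
  shows "(\<lambda>\<rho> a S x. \<Sum>(c, G)\<leftarrow>L. c * phi G \<rho> a S x) \<in> graph_span \<G>"
proof -
  have "finite F \<Longrightarrow> snd ` set L \<subseteq> F \<Longrightarrow>
    (\<Sum>(c, G)\<leftarrow>L. c * f G) = (\<Sum>\<Gamma>\<in>F. (\<Sum>(c, G)\<leftarrow>L. if \<Gamma> = G then c else 0) * (f \<Gamma> :: real))" for F f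
    by (induction L) (auto simp: distrib_right sum.distrib sum_if_graph)
  then have "(\<Sum>(c, G)\<leftarrow>L. c * phi G \<rho> a S x) =
    (\<Sum>\<Gamma>\<in>snd ` set L. (\<Sum>(c, G)\<leftarrow>L. if \<Gamma> = G then c else 0) * phi \<Gamma> \<rho> a S x)" for \<rho> a S x
    by simp
  then show ?thesis
    unfolding graph_span_def generic_eq_def mem_Collect_eq
    using assms by (intro exI[of _ "snd ` set L"] exI[of _ "\<lambda>\<Gamma>. \<Sum>(c, G)\<leftarrow>L. if \<Gamma> = G then c else 0"])
      (simp add: fun_eq_iff)
qed

lemma phi_relabel:
  assumes "sink_first G" "sink_first H" "\<And>R A. jets R A \<Longrightarrow> comp3 G R A 1 = comp3 H R A 1"
    "smooth \<rho>" "smooth a"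
  shows "phi G \<rho> a S x = phi H \<rho> a S x"
proof (cases "card S = 1")
  case True
  then obtain i where S: "S = {i}" by (auto simp: card_1_singleton_iff)
  have "comp3 G (jet \<rho> x) (jet a x) i = comp3 H (jet \<rho> x) (jet a x) i"
    by (rule jets_rot_extend[of _ _ "comp3 G" "comp3 H", OF jets_jet[OF assms(4,5)] assms(3)]) (simp_all add: comp3_rot)
  then show ?thesis by (simp add: S phi_jet assms(1,2))
next
  case False
  then show ?thesis by (simp add: phi_comp3(2) assms(1,2))
qed

lemma X3D_terms:
  assumes "smooth \<rho>" "smooth a"
  shows "X3D \<rho> a S x = (\<Sum>(c, G)\<leftarrow>X_terms. c * phi G \<rho> a S x)"
proof -
  have eq: "phi [[0,2,4],[1,3,5],[1,2,6]] \<rho> a S x = phi [[0,3,4],[1,3,5],[1,2,6]] \<rho> a S x"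
    "phi [[0,2,4],[1,3,5],[1,5,6]] \<rho> a S x = phi [[0,3,4],[1,6,5],[1,2,6]] \<rho> a S x"
    "phi [[0,2,4],[1,6,5],[1,5,6]] \<rho> a S x = phi [[0,3,4],[1,6,5],[1,5,6]] \<rho> a S x"
    "phi [[0,2,4],[4,3,5],[1,5,6]] \<rho> a S x = phi [[0,3,4],[1,6,5],[4,2,6]] \<rho> a S x"
    "phi [[0,5,4],[1,3,5],[1,2,6]] \<rho> a S x = phi [[0,6,4],[1,3,5],[1,2,6]] \<rho> a S x"
    by (rule phi_relabel[OF _ _ _ assms]; (erule jets.relations)?; simp add: sink_first_def)+
  show ?thesis unfolding X3D_def eq by (simp add: X_terms_def)
qed

lemma vector_field_lin:
  assumes "smooth \<rho>" "smooth a" "\<And>i. X {i} = (\<lambda>x. lin L (jet \<rho> x) (jet a x) i)"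
    "\<And>S. card S \<noteq> 1 \<Longrightarrow> X S = (\<lambda>x. 0)"
  shows "vector_field X"
  using has_pd_lin[OF assms(1,2)] assms(3,4)
  by (simp add: vector_field_def has_pd_def smooth_differentiable)

lemma X3D_lin:
  assumes "smooth \<rho>" "smooth a"
  shows "X3D \<rho> a {i} = (\<lambda>x. lin X_terms (jet \<rho> x) (jet a x) i)"
    "card S \<noteq> 1 \<Longrightarrow> X3D \<rho> a S = (\<lambda>x. 0)"
proof -
  have sf: "sink_first G" if "G \<in> snd ` set X_terms" for G
    using descendants_cases[OF X_terms_descendants[OF that]] by (rule sink_first_graphs)
  have "(\<Sum>(c, G)\<leftarrow>X_terms. c * phi G \<rho> a {i} x) = lin X_terms (jet \<rho> x) (jet a x) i" for x
    unfolding lin_def by (rule arg_cong[of _ _ sum_list], rule map_cong[OF refl]) (use sf in \<open>force simp: phi_jet\<close>)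
  then show "X3D \<rho> a {i} = (\<lambda>x. lin X_terms (jet \<rho> x) (jet a x) i)"
    by (simp add: fun_eq_iff X3D_terms[OF assms])
  assume S: "card S \<noteq> 1"
  have "(\<Sum>(c, G)\<leftarrow>X_terms. c * phi G \<rho> a S x) = (\<Sum>_\<leftarrow>X_terms. 0)" for x
    by (rule arg_cong[of _ _ sum_list], rule map_cong[OF refl]) (use sf S in \<open>force simp: phi_comp3(2)\<close>)
  then show "X3D \<rho> a S = (\<lambda>x. 0)"
    by (simp add: fun_eq_iff X3D_terms[OF assms])
qed

lemma schouten_lin:
  assumes "smooth \<rho>" "smooth a" "\<And>i. X {i} = (\<lambda>x. lin L (jet \<rho> x) (jet a x) i)"
    "\<And>S. card S \<noteq> 1 \<Longrightarrow> X S = (\<lambda>x. 0)"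
  shows "schouten (nambu \<rho> a) X {3, 1} x = lbrk L (jet \<rho> x) (jet a x) 2"
    "schouten (nambu \<rho> a) X {3, 2} x = - lbrk L (jet \<rho> x) (jet a x) 1"
    "schouten (nambu \<rho> a) X {1, 2} x = lbrk L (jet \<rho> x) (jet a x) 3"
    "card S \<noteq> 2 \<Longrightarrow> schouten (nambu \<rho> a) X S x = 0"
  using schouten_vector_field[OF assms(1,2) vector_field_lin[OF assms]]
    schouten_vector_field_eq_0[OF vector_field_lin[OF assms]]
    bracket_coeff_lin[OF assms(1,2), of "\<lambda>i. X {i}", OF assms(3)]
  by simp_all

lemma trivialization:
  assumes "smooth \<rho>" "smooth a"
  shows "tetrahedral_flow (nambu \<rho> a) S x = schouten (nambu \<rho> a) (X3D \<rho> a) S x"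
  using tetrahedral_flow_X_terms[OF assms] tetrahedral_flow_eq_0[OF assms]
    schouten_lin[OF assms X3D_lin[OF assms]]
  by (cases S rule: set3_cases) simp_all

text \<open>The field is written as the given one plus a combination of basis graphs. The flow
  equation then cancels \<open>X_terms\<close> and leaves a linear homogeneous condition on
  d.\<close>

lemma W3D_cases:
  assumes "X \<in> W3D"
  obtains d where
    "\<And>\<rho> a i. smooth \<rho> \<Longrightarrow> smooth a \<Longrightarrow>
      X \<rho> a {i} = (\<lambda>x. lin (X_terms @ map (\<lambda>B. (d B, B)) basis) (jet \<rho> x) (jet a x) i)"
    "\<And>\<rho> a S. smooth \<rho> \<Longrightarrow> smooth a \<Longrightarrow> card S \<noteq> 1 \<Longrightarrow> X \<rho> a S = (\<lambda>x. 0)"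
proof -
  obtain F c where F: "finite F"
      "F \<subseteq> descendants [[0,1],[1,3],[1,2]] \<union> descendants [[0,3],[1,3],[1,2]]"
    and X: "\<And>\<rho> a. smooth \<rho> \<Longrightarrow> smooth a \<Longrightarrow> X \<rho> a = (\<lambda>S x. \<Sum>\<Gamma>\<in>F. c \<Gamma> * phi \<Gamma> \<rho> a S x)"
    using assms by (auto simp: W3D_def graph_span_def generic_eq_def)
  have red: "\<Gamma> \<in> set basis \<union> set reducible" if "\<Gamma> \<in> F" for \<Gamma>
    using F(2) that descendants_cases by blast
  let ?f = "\<lambda>R A i. (\<Sum>\<Gamma>\<in>F. c \<Gamma> * comp3 \<Gamma> R A i)"
  have "in_span (\<lambda>R A. ?f R A 1 + (-1) * (\<Sum>t\<leftarrow>X_terms. fst t * comp3 (snd t) R A 1))"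
  proof -
    have "in_span (\<lambda>R A. comp3 (snd t) R A 1)" if "t \<in> set X_terms" for t
      by (rule in_span_descendant, rule descendants_cases, rule X_terms_descendants) (use that in simp)
    moreover have "in_span (\<lambda>R A. comp3 \<Gamma> R A 1)" if "\<Gamma> \<in> F" for \<Gamma>
      by (rule in_span_descendant[OF red[OF that]])
    ultimately show ?thesis
      by (intro in_span_add in_span_cmult in_span_sum in_span_sum_list)
  qed
  then obtain d where d: "\<And>R A. jets R A \<Longrightarrow>
      ?f R A 1 - lin X_terms R A 1 = (\<Sum>B\<in>set basis. d B * comp3 B R A 1)"
    by (auto simp: in_span_def lin_def case_prod_unfold)
  have "distinct basis" by (simp add: basis_def)
  then have l: "lin (map (\<lambda>B. (d B, B)) basis) R A i = (\<Sum>B\<in>set basis. d B * comp3 B R A i)" for R A i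
    by (simp add: lin_def o_def sum_list_distinct_conv_sum_set)
  have "?f R A i - lin X_terms R A i = lin (map (\<lambda>B. (d B, B)) basis) R A i" if "jets R A" for R A i
    by (rule jets_rot_extend[OF that], simp add: d l) (simp_all add: comp3_rot lin_def)
  then have lin: "?f R A i = lin (X_terms @ map (\<lambda>B. (d B, B)) basis) R A i" if "jets R A" for R A i
    using that by (simp add: lin_def algebra_simps)
  show ?thesis
  proof (rule that[of d])
    fix \<rho> a :: "real^3 \<Rightarrow> real" and i assume s: "smooth \<rho>" "smooth a"
    have "X \<rho> a {i} x = ?f (jet \<rho> x) (jet a x) i" for x
      unfolding X[OF s] by (rule sum.cong[OF refl]) (simp add: phi_jet sink_first_graphs[OF red])
    then show "X \<rho> a {i} = (\<lambda>x. lin (X_terms @ map (\<lambda>B. (d B, B)) basis) (jet \<rho> x) (jet a x) i)"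
      by (simp only: fun_eq_iff lin[OF jets_jet[OF s]]) simp
  next
    fix \<rho> a :: "real^3 \<Rightarrow> real" and S :: "3 set" assume s: "smooth \<rho>" "smooth a" and S: "card S \<noteq> 1"
    show "X \<rho> a S = (\<lambda>x. 0)"
      unfolding X[OF s] by (intro ext sum.neutral ballI) (simp add: phi_comp3(2)[OF sink_first_graphs[OF red] S])
  qed
qed

section \<open>Test functions with prescribed derivatives\<close>

text \<open>Divided powers, so that the derivatives at the origin are 0 or 1.\<close>

definition monomial :: "nat \<Rightarrow> nat \<Rightarrow> nat \<Rightarrow> real^3 \<Rightarrow> real" where
  "monomial m n k x = x $ 1 ^ m / fact m * (x $ 2 ^ n / fact n) * (x $ 3 ^ k / fact k)"

lemma smooth_component: "smooth (\<lambda>x. x $ i)"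
proof -
  have d: "(\<lambda>x :: real^3. x $ i) differentiable_on UNIV"
    by (rule linear_imp_differentiable_on[OF bounded_linear.linear[OF bounded_linear_vec_nth]])
  have p: "pd j (\<lambda>x. x $ i) = (\<lambda>x. axis j 1 $ i)" for j
    by (intro ext pd_eqI) (auto intro!: derivative_eq_intros)
  have "smooth_upto n (\<lambda>x. c)" for n c
    using smooth_const smooth_iff_upto by blast
  then have "smooth_upto n (\<lambda>x. x $ i)" for n
    by (cases n) (simp_all add: d p)
  then show ?thesis by (simp add: smooth_iff_upto)
qed

lemma smooth_power: "smooth f \<Longrightarrow> smooth (\<lambda>x. f x ^ n)"
  by (induction n) (simp_all add: smooth_const smooth_mult)

lemma smooth_monomial: "smooth (monomial m n k)"
proof -
  have "smooth (\<lambda>x. inverse (fact m) * x $ 1 ^ m * (inverse (fact n) * x $ 2 ^ n) * (inverse (fact k) * x $ 3 ^ k))"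
    by (intro smooth_mult smooth_const smooth_power smooth_component)
  then show ?thesis by (simp add: monomial_def[abs_def] field_simps)
qed

lemma DERIV_divided_power:
  "((\<lambda>t. (c + t) ^ m / fact m) has_real_derivative (if m = 0 then 0 else c ^ (m - 1) / fact (m - 1))) (at 0)"
proof (cases m)
  case (Suc m')
  have "((\<lambda>t. (c + t) ^ Suc m' / fact (Suc m')) has_real_derivative
      real (Suc m') * (c + 0) ^ m' * 1 / fact (Suc m')) (at 0)"
    by (auto intro!: derivative_eq_intros simp del: power_Suc fact_Suc)
  moreover have "real (Suc m') * (c + 0) ^ m' * 1 / fact (Suc m') = c ^ m' / fact m'"
    by (simp add: nonzero_divide_eq_eq nonzero_eq_divide_eq)
  ultimately show ?thesis by (simp only: Suc diff_Suc_1 nat.distinct if_False)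
qed simp

lemma pd_monomial:
  "pd 1 (monomial m n k) = (\<lambda>x. if m = 0 then 0 else monomial (m - 1) n k x)"
  "pd 2 (monomial m n k) = (\<lambda>x. if n = 0 then 0 else monomial m (n - 1) k x)"
  "pd 3 (monomial m n k) = (\<lambda>x. if k = 0 then 0 else monomial m n (k - 1) x)"
proof -
  have "(\<lambda>t. monomial m n k (x + t *\<^sub>R axis 1 1)) =
      (\<lambda>t. (x $ 1 + t) ^ m / fact m * (x $ 2 ^ n / fact n * (x $ 3 ^ k / fact k)))"
    "(\<lambda>t. monomial m n k (x + t *\<^sub>R axis 2 1)) =
      (\<lambda>t. (x $ 2 + t) ^ n / fact n * (x $ 1 ^ m / fact m * (x $ 3 ^ k / fact k)))"
    "(\<lambda>t. monomial m n k (x + t *\<^sub>R axis 3 1)) =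
      (\<lambda>t. (x $ 3 + t) ^ k / fact k * (x $ 1 ^ m / fact m * (x $ 2 ^ n / fact n)))" for x
    by (simp_all add: monomial_def axis_def fun_eq_iff mult_ac)
  note line = this
  have "pd 1 (monomial m n k) x =
      (if m = 0 then 0 else x $ 1 ^ (m - 1) / fact (m - 1)) * (x $ 2 ^ n / fact n * (x $ 3 ^ k / fact k))"
    "pd 2 (monomial m n k) x =
      (if n = 0 then 0 else x $ 2 ^ (n - 1) / fact (n - 1)) * (x $ 1 ^ m / fact m * (x $ 3 ^ k / fact k))"
    "pd 3 (monomial m n k) x =
      (if k = 0 then 0 else x $ 3 ^ (k - 1) / fact (k - 1)) * (x $ 1 ^ m / fact m * (x $ 2 ^ n / fact n))" for x
    by (rule pd_eqI; unfold line; rule DERIV_cmult_right[OF DERIV_divided_power])+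
  then show "pd 1 (monomial m n k) = (\<lambda>x. if m = 0 then 0 else monomial (m - 1) n k x)"
    "pd 2 (monomial m n k) = (\<lambda>x. if n = 0 then 0 else monomial m (n - 1) k x)"
    "pd 3 (monomial m n k) = (\<lambda>x. if k = 0 then 0 else monomial m n (k - 1) x)"
    by (auto simp: monomial_def fun_eq_iff mult_ac)
qed

lemma jet_monomial:
  "jet (monomial m n k) 0 w = (if count_list w 1 = m \<and> count_list w 2 = n \<and> count_list w 3 = k then 1 else 0)"
proof (induction w arbitrary: m n k rule: rev_induct)
  case Nil
  then show ?case by (auto simp: jet_def monomial_def power_0_left)
next
  case (snoc i w)
  have z: "foldr pd w (\<lambda>x. 0) = (\<lambda>x. 0)"
    by (induction w) (simp_all add: pd_zero)
  have p: "pd 1 (monomial 0 n k) = (\<lambda>x. 0)" "pd 1 (monomial (Suc m) n k) = monomial m n k"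
    "pd 2 (monomial m 0 k) = (\<lambda>x. 0)" "pd 2 (monomial m (Suc n) k) = monomial m n k"
    "pd 3 (monomial m n 0) = (\<lambda>x. 0)" "pd 3 (monomial m n (Suc k)) = monomial m n k" for m n k
    by (simp_all add: pd_monomial fun_eq_iff)
  note IH = snoc.IH[unfolded jet_def]
  consider "i = 1" | "i = 2" | "i = 3" using exhaust_3[of i] by auto
  then show ?case
  proof cases
    case 1
    then show ?thesis by (cases m) (simp_all add: jet_def p z IH)
  next
    case 2
    then show ?thesis by (cases n) (simp_all add: jet_def p z IH)
  next
    case 3
    then show ?thesis by (cases k) (simp_all add: jet_def p z IH)
  qed
qed

text \<open>The Taylor polynomial whose derivative along w at the origin is c for every entry (w,
  c); entries whose words agree up to order add up.\<close>

definition poly_of_jets :: "(3 list \<times> real) list \<Rightarrow> real^3 \<Rightarrow> real" where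
  "poly_of_jets L x = (\<Sum>(w, c)\<leftarrow>L. c * monomial (count_list w 1) (count_list w 2) (count_list w 3) x)"

lemma smooth_poly_of_jets: "smooth (poly_of_jets L)"
proof (induction L)
  case (Cons t L)
  obtain w c where "t = (w, c)" by (cases t)
  then have "poly_of_jets (t # L) =
    (\<lambda>x. c * monomial (count_list w 1) (count_list w 2) (count_list w 3) x + poly_of_jets L x)"
    by (simp add: poly_of_jets_def fun_eq_iff)
  then show ?case
    by (simp only:) (intro smooth_add smooth_mult smooth_const smooth_monomial Cons.IH)
qed (simp add: poly_of_jets_def[abs_def] smooth_const)

lemma jet_add_cmult:
  assumes "smooth f" "smooth g"
  shows "jet (\<lambda>x. c * f x + g x) x w = c * jet f x w + jet g x w"
proof -
  have "foldr pd w (\<lambda>x. c * f x + g x) = (\<lambda>x. c * foldr pd w f x + foldr pd w g x)"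
  proof (induction w)
    case (Cons i w)
    have "has_pd i (\<lambda>x. c * foldr pd w f x + foldr pd w g x) (\<lambda>x. c * pd i (foldr pd w f) x + pd i (foldr pd w g) x)"
      by (intro has_pd_add has_pd_cmult) (simp_all add: has_pd_def smooth_foldr_pd assms)
    with Cons show ?case by (simp add: has_pd_def)
  qed simp
  then show ?thesis by (simp add: jet_def)
qed

lemma jet_poly_of_jets:
  "jet (poly_of_jets L) 0 w = (\<Sum>(v, c)\<leftarrow>L. if count_list w 1 = count_list v 1 \<and>
     count_list w 2 = count_list v 2 \<and> count_list w 3 = count_list v 3 then c else 0)"
proof (induction L)
  case Nil
  have "foldr pd w (\<lambda>x. 0) = (\<lambda>x. 0)" by (induction w) (simp_all add: pd_zero)
  then show ?case by (simp add: jet_def poly_of_jets_def[abs_def])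
next
  case (Cons t L)
  obtain v c where t: "t = (v, c)" by (cases t)
  have "poly_of_jets (t # L) =
    (\<lambda>x. c * monomial (count_list v 1) (count_list v 2) (count_list v 3) x + poly_of_jets L x)"
    by (simp add: t poly_of_jets_def fun_eq_iff)
  then show ?case
    by (simp only: jet_add_cmult[OF smooth_monomial smooth_poly_of_jets] Cons.IH)
      (simp add: t jet_monomial)
qed

section \<open>Uniqueness\<close>

lemma dcomp2_rot: "dcomp2 l G (rotj R) (rotj A) = dcomp2 (rot l) G R A"
proof -
  let ?m = "dmono2 (rot l) (concat G) R A"
  have m: "dmono2 l ts (rotj R) (rotj A) is = dmono2 (rot l) ts R A (map rot is)" for ts "is"
    by (simp add: dmono2_def rotj_def word_rot)
  let ?h = "\<lambda>i1 i2 i3. eps3 (\<lambda>i4 i5 i6. ?m [i1, i2, i3, i4, i5, i6])"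
  have "dcomp2 (rot l) G R A = eps3 (\<lambda>i1 i2 i3. ?h (rot i1) (rot i2) (rot i3))"
    unfolding dcomp2_def by (rule eps3_rot[of ?h, symmetric])
  also have "\<dots> = eps3 (\<lambda>i1 i2 i3. eps3 (\<lambda>i4 i5 i6. ?m [rot i1, rot i2, rot i3, rot i4, rot i5, rot i6]))"
    by (rule arg_cong[of _ _ eps3], intro ext)
      (rule eps3_rot[of "\<lambda>i4 i5 i6. ?m [rot _, rot _, rot _, i4, i5, i6]", symmetric])
  finally show ?thesis by (simp only: dcomp2_def m list.map)
qed

lemma ham_rot: "ham G (rotj R) (rotj A) i = ham G R A (rot i)"
proof -
  have "rotj R [] = R []" "rotj A [k] = A [rot k]" for k by (simp_all add: rotj_def)
  then show ?thesis
    unfolding ham_def dcomp2_rot eps2_rot[symmetric] by simp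
qed

text \<open>Seventeen independent conditions on twenty unknowns: all coefficients are expressed
  through those of the last three graphs of \<open>basis\<close>. The hypothesis is linear in d, so
  each choice of test jets contributes one linear equation.\<close>

lemma brk_kernel:
  assumes "\<forall>\<rho> a. smooth \<rho> \<longrightarrow> smooth a \<longrightarrow> lbrk (map (\<lambda>B. (d B, B)) basis) (jet \<rho> 0) (jet a 0) 2 = 0"
  shows
    "d [[0,1,4],[1,3,5],[1,2,6]] = 0"
    "d [[0,1,4],[1,3,5],[4,2,6]] = 0"
    "d [[0,1,4],[1,3,5],[4,5,6]] = 0"
    "d [[0,1,4],[4,3,5],[4,2,6]] = 0"
    "d [[0,1,4],[4,6,5],[4,5,6]] = 0"
    "d [[0,3,4],[1,3,5],[1,2,6]] = 0"
    "d [[0,3,4],[1,6,5],[1,2,6]] = 0"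
    "d [[0,3,4],[1,6,5],[4,2,6]] = 0"
    "d [[0,3,4],[4,3,5],[4,2,6]] = 0"
    "d [[0,3,4],[4,3,5],[4,5,6]] = 0"
    "d [[0,6,4],[1,3,5],[1,2,6]] = 0"
    "d [[0,1,4],[1,3,5],[1,5,6]] = d [[0,6,4],[1,6,5],[1,2,6]]"
    "d [[0,3,4],[1,3,5],[1,5,6]] = d [[0,6,4],[1,6,5],[1,2,6]]"
    "d [[0,1,4],[1,6,5],[4,2,6]] = d [[0,6,4],[1,6,5],[1,2,6]] + 2 * d [[0,6,4],[1,6,5],[4,2,6]]"
    "d [[0,3,4],[1,6,5],[1,5,6]] = 1/2 * d [[0,6,4],[1,6,5],[1,2,6]] + 1/2 * d [[0,6,4],[1,6,5],[1,5,6]]"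
    "d [[0,1,4],[1,6,5],[1,5,6]] = 1/2 * d [[0,6,4],[1,6,5],[1,5,6]]"
    "d [[0,1,4],[4,3,5],[4,5,6]] = d [[0,6,4],[1,6,5],[4,2,6]]"
proof -
  have P: "d [[0,1,4],[1,3,5],[1,2,6]] * ((-4) * a3 * a3 * a3 * r1 * r12 * r122 + (-2) * a3 * a3 * a23 * r1 * r1 * r122) +
    (d [[0,1,4],[1,3,5],[1,5,6]] * ((-2) * a3 * a3 * a13 * r12 * r122 + (-2) * a3 * a3 * a123 * r1 * r122 + (-2) * a3 * a23 * a13 * r1 * r122) +
    (d [[0,1,4],[1,3,5],[4,2,6]] * (2 * a3 * a3 * a23 * r1 * r1 * r122 + 1 * a3 * a3 * a23 * r1 * r12 * r12 + (-1) * a3 * a3 * a23 * r22 * r1 * r1 * r1 + (-2) * a3 * a3 * a13 * r22 * r1 * r12 + (-1) * a3 * a3 * a123 * r22 * r1 * r1 + 1 * a3 * a23 * a23 * r1 * r1 * r12 + 1 * a3 * a23 * a13 * r22 * r1 * r1) +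
    (d [[0,1,4],[1,3,5],[4,5,6]] * (1 * a3 * a23 * a13 * r1 * r122 + 1 * a3 * a23 * a13 * r12 * r12 + (-3) * a3 * a13 * a123 * r22 * r1 + 1 * a23 * a23 * a13 * r1 * r12 + (-1) * a23 * a13 * a13 * r22 * r1) +
    (d [[0,1,4],[1,6,5],[1,5,6]] * ((-4) * a3 * a23 * a13 * r1 * r122 + (-8) * a3 * a13 * a123 * r122) +
    (d [[0,1,4],[1,6,5],[4,2,6]] * ((-3) * a3 * a23 * a123 * r1 * r12 + 1 * a3 * a13 * a123 * r22 * r1) +
    (d [[0,1,4],[4,3,5],[4,2,6]] * ((-4) * a3 * a3 * a123 * r22 * r1 * r1) +
    (d [[0,1,4],[4,3,5],[4,5,6]] * (1 * a3 * a23 * a123 * r1 * r12 + (-3) * a3 * a13 * a123 * r22 * r1) +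
    (d [[0,1,4],[4,6,5],[4,5,6]] * ((-4) * a23 * a13 * a123 * r12 + (-4) * a23 * a123 * a123 * r1) +
    (d [[0,3,4],[1,3,5],[1,2,6]] * (2 * a3 * a3 * a3 * r1 * r12 * r122 + 2 * a3 * a3 * a23 * r1 * r12 * r12) +
    (d [[0,3,4],[1,3,5],[1,5,6]] * (2 * a3 * a3 * a13 * r12 * r122) +
    (d [[0,3,4],[1,6,5],[1,2,6]] * (1 * a3 * a3 * a23 * r1 * r1 * r122 + 1 * a3 * a3 * a23 * r1 * r12 * r12 + (-1) * a3 * a3 * a123 * r22 * r1 * r1 + 1 * a3 * a23 * a23 * r1 * r1 * r12 + (-1) * a3 * a23 * a13 * r22 * r1 * r1) +
    (d [[0,3,4],[1,6,5],[1,5,6]] * (4 * a3 * a23 * a13 * r1 * r122 + 4 * a3 * a23 * a123 * r1 * r12 + (-4) * a3 * a13 * a123 * r22 * r1) +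
    (d [[0,3,4],[1,6,5],[4,2,6]] * (2 * a3 * a23 * a23 * r1 * r1 * r12 + (-2) * a3 * a23 * a13 * r22 * r1 * r1) +
    (d [[0,3,4],[4,3,5],[4,2,6]] * ((-4) * a3 * a3 * a123 * r1 * r122 + (-4) * a3 * a3 * a123 * r12 * r12 + (-3) * a3 * a23 * a123 * r1 * r12 + (-3) * a3 * a13 * a123 * r22 * r1) +
    (d [[0,3,4],[4,3,5],[4,5,6]] * ((-1) * a3 * a23 * a123 * r1 * r12 + (-4) * a3 * a13 * a123 * r122 + (-1) * a3 * a13 * a123 * r22 * r1 + (-4) * a3 * a123 * a123 * r12 + (-4) * a23 * a13 * a123 * r12) +
    (d [[0,6,4],[1,3,5],[1,2,6]] * (1 * a3 * a3 * a23 * r1 * r1 * r122 + (-2) * a3 * a3 * a23 * r1 * r12 * r12 + (-1) * a3 * a3 * a23 * r22 * r1 * r1 * r1) +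
    (d [[0,6,4],[1,6,5],[1,2,6]] * (2 * a3 * a3 * a123 * r1 * r122 + 1 * a3 * a23 * a123 * r1 * r12 + 1 * a3 * a13 * a123 * r22 * r1) +
    (d [[0,6,4],[1,6,5],[1,5,6]] * ((-2) * a3 * a23 * a123 * r1 * r12 + 4 * a3 * a13 * a123 * r122 + 2 * a3 * a13 * a123 * r22 * r1) +
    (d [[0,6,4],[1,6,5],[4,2,6]] * (5 * a3 * a23 * a123 * r1 * r12 + 1 * a3 * a13 * a123 * r22 * r1)))))))))))))))))))) = 0" for a3 a13 a23 a123 r1 r12 r22 r122 :: real
  proof -
    let ?\<rho> = "poly_of_jets [([], 1), ([1], r1), ([1,2], r12), ([2,2], r22), ([1,2,2], r122)]"
    let ?a = "poly_of_jets [([2], 1), ([3], a3), ([1,3], a13), ([2,3], a23), ([1,2,3], a123)]"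
    interpret jets "jet ?\<rho> 0" "jet ?a 0"
      by (rule jets_jet; rule smooth_poly_of_jets)
    interpret sparse_jets "jet ?\<rho> 0" "jet ?a 0" a3 a13 a23 a123 r1 r12 r22 r122
      by unfold_locales (simp_all add: jet_poly_of_jets)
    show ?thesis
      using assms[rule_format, OF smooth_poly_of_jets smooth_poly_of_jets, of "[([], 1), ([1], r1), ([1,2], r12), ([2,2], r22), ([1,2,2], r122)]" "[([2], 1), ([3], a3), ([1,3], a13), ([2,3], a23), ([1,2,3], a123)]"]
      unfolding lbrk_def basis_def list.map map_map o_def sum_list.Cons sum_list.Nil case_prod_conv brk_sparse
      by (simp only: add.assoc add_0_right)
  qed
  note eval = mult_zero_left mult_zero_right mult_1_right mult_minus1_right minus_minus minus_zero
    distrib_left add_0_left add_0_right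
  \<comment> \<open>The values are given in the order of first occurrence in \<open>P\<close>: a3,
    r1, r12, r122, a23, a13, a123, r22. Most are zero, so that few unknowns survive; the first point
    isolates the coefficient of \<open>[[0,1,4],[4,6,5],[4,5,6]]\<close>. Points differing only in
    the sign of r12 separate its odd powers from its even ones.\<close>
  note points = P[of 0 1 0 0 1 0 1 0, unfolded eval]
    P[of 1 0 1 0 0 0 1 0, unfolded eval]
    P[of 1 0 "-1" 0 0 0 1 0, unfolded eval]
    P[of 0 1 0 0 1 1 0 1, unfolded eval]
    P[of 1 1 1 1 0 0 0 0, unfolded eval]
    P[of 1 1 0 1 0 0 1 0, unfolded eval]
    P[of 1 1 0 0 0 0 1 1, unfolded eval]
    P[of 1 1 0 1 1 0 0 0, unfolded eval]
    P[of 1 1 0 0 1 0 0 1, unfolded eval]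
    P[of 1 1 1 0 1 0 0 0, unfolded eval]
    P[of 1 0 1 1 0 1 0 0, unfolded eval]
    P[of 1 0 0 1 0 1 1 0, unfolded eval]
    P[of 1 1 "-1" 0 1 0 0 0, unfolded eval]
    P[of 1 1 1 0 1 0 1 0, unfolded eval]
    P[of 1 1 1 0 0 1 0 1, unfolded eval]
    P[of 1 1 0 0 0 1 1 1, unfolded eval]
    P[of 1 1 0 1 1 1 0 0, unfolded eval]
  show "d [[0,1,4],[1,3,5],[1,2,6]] = 0"
    using points(5,8,9,10,13,15) by linarith
  show "d [[0,1,4],[1,3,5],[4,2,6]] = 0"
    using points(15) by linarith
  show "d [[0,1,4],[1,3,5],[4,5,6]] = 0"
    using points(4) by linarith
  show "d [[0,1,4],[4,3,5],[4,2,6]] = 0"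
    using points(5,7,8,10,13,15) by linarith
  show "d [[0,1,4],[4,6,5],[4,5,6]] = 0"
    using points(1) by linarith
  show "d [[0,3,4],[1,3,5],[1,2,6]] = 0"
    using points(5,8,9,10,13,15) by linarith
  show "d [[0,3,4],[1,6,5],[1,2,6]] = 0"
    using points(5,8,10,13,15) by linarith
  show "d [[0,3,4],[1,6,5],[4,2,6]] = 0"
    using points(5,8,10,13,15) by linarith
  show "d [[0,3,4],[4,3,5],[4,2,6]] = 0"
    using points(2,3) by linarith
  show "d [[0,3,4],[4,3,5],[4,5,6]] = 0"
    using points(2,3) by linarith
  show "d [[0,6,4],[1,3,5],[1,2,6]] = 0"
    using points(9,15) by linarith
  show "d [[0,1,4],[1,3,5],[1,5,6]] = d [[0,6,4],[1,6,5],[1,2,6]]"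
    using points(2,3,6) by linarith
  show "d [[0,3,4],[1,3,5],[1,5,6]] = d [[0,6,4],[1,6,5],[1,2,6]]"
    using points(2,3,6,11) by linarith
  show "d [[0,1,4],[1,6,5],[4,2,6]] = d [[0,6,4],[1,6,5],[1,2,6]] + 2 * d [[0,6,4],[1,6,5],[4,2,6]]"
    using points(1,2,3,4,6,7,8,10,12,14,16,17) by linarith
  show "d [[0,3,4],[1,6,5],[1,5,6]] = 1/2 * d [[0,6,4],[1,6,5],[1,2,6]] + 1/2 * d [[0,6,4],[1,6,5],[1,5,6]]"
    using points(2,3,4,6,8,12,17) by linarith
  show "d [[0,1,4],[1,6,5],[1,5,6]] = 1/2 * d [[0,6,4],[1,6,5],[1,5,6]]"
    using points(2,3,12) by linarith
  show "d [[0,1,4],[4,3,5],[4,5,6]] = d [[0,6,4],[1,6,5],[4,2,6]]"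
    using points(1,2,3,4,6,7,8,10,12,14,16,17) by linarith
qed

text \<open>The three coefficients left free by the test jets match three Hamiltonian fields, so the
  necessary conditions obtained at the origin already give the field everywhere.\<close>

lemma lin_kernel:
  assumes "\<And>\<rho> a. smooth \<rho> \<Longrightarrow> smooth a \<Longrightarrow> lbrk (map (\<lambda>B. (d B, B)) basis) (jet \<rho> 0) (jet a 0) 2 = 0"
  shows "\<exists>s1 s2 s3. \<forall>R A i. jets R A \<longrightarrow> lin (map (\<lambda>B. (d B, B)) basis) R A i =
    s1 * ham [[1,2,3],[1,3,4]] R A i + s2 * ham [[1,4,3],[1,3,4]] R A i + s3 * ham [[1,4,3],[2,3,4]] R A i"
proof -
  have zero: "\<forall>\<rho> a. smooth \<rho> \<longrightarrow> smooth a \<longrightarrow> lbrk (map (\<lambda>B. (d B, B)) basis) (jet \<rho> 0) (jet a 0) 2 = 0"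
    using assms by blast
  \<comment> \<open>The free coefficients, divided by the 1, 2 and -2 with which their graphs occur
    in \<open>jets.ham_relations\<close>.\<close>
  let ?s1 = "d [[0,6,4],[1,6,5],[1,2,6]]" and ?s2 = "1/2 * d [[0,6,4],[1,6,5],[1,5,6]]" and ?s3 = "- 1/2 * d [[0,6,4],[1,6,5],[4,2,6]]"
  have "lin (map (\<lambda>B. (d B, B)) basis) R A i =
      ?s1 * ham [[1,2,3],[1,3,4]] R A i + ?s2 * ham [[1,4,3],[1,3,4]] R A i + ?s3 * ham [[1,4,3],[2,3,4]] R A i"
    if j: "jets R A" for R A i
  proof (rule jets_rot_extend[OF j])
    fix R A assume "jets R A"
    then show "lin (map (\<lambda>B. (d B, B)) basis) R A 1 =
        ?s1 * ham [[1,2,3],[1,3,4]] R A 1 + ?s2 * ham [[1,4,3],[1,3,4]] R A 1 + ?s3 * ham [[1,4,3],[2,3,4]] R A 1"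
      unfolding jets.ham_relations[OF \<open>jets R A\<close>] lin_def basis_def list.map sum_list.Cons sum_list.Nil
        case_prod_conv brk_kernel[OF zero]
      by algebra
  qed (simp_all add: lin_def comp3_rot ham_rot)
  then show ?thesis by blast
qed

definition H_expr :: "real \<Rightarrow> real \<Rightarrow> real \<Rightarrow> expression" where
  "H_expr s1 s2 s3 = (\<lambda>\<rho> a S x. \<Sum>(c, G)\<leftarrow>[(s1, [[1,2,3],[1,3,4]]), (s2, [[1,4,3],[1,3,4]]),
     (s3, [[1,4,3],[2,3,4]])]. c * phi G \<rho> a S x)"

lemma H_expr_H3D: "H_expr s1 s2 s3 \<in> H3D"
  unfolding H_expr_def H3D_def by (rule graph_span_lin) (simp add: nambu_micrograph_2I[OF refl] del: One_nat_def)

lemma schouten_H_expr: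
  assumes "smooth \<rho>" "smooth a"
  shows "schouten (nambu \<rho> a) (H_expr s1 s2 s3 \<rho> a) {i} x =
      s1 * ham [[1,2,3],[1,3,4]] (jet \<rho> x) (jet a x) i + s2 * ham [[1,4,3],[1,3,4]] (jet \<rho> x) (jet a x) i
      + s3 * ham [[1,4,3],[2,3,4]] (jet \<rho> x) (jet a x) i"
    "card S \<noteq> 1 \<Longrightarrow> schouten (nambu \<rho> a) (H_expr s1 s2 s3 \<rho> a) S x = 0"
proof -
  let ?c = "\<lambda>G x. comp2 G (jet \<rho> x) (jet a x)" and ?dc = "\<lambda>l G x. dcomp2 l G (jet \<rho> x) (jet a x)"
  have p: "phi G \<rho> a S x = (if S = {} then ?c G x else 0)"
    if "G \<in> {[[1,2,3],[1,3,4]], [[1,4,3],[1,3,4]], [[1,4,3],[2,3,4]]}" for G S x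
    using that unfolding insert_iff empty_iff
    by (elim disjE FalseE; simp add: phi_2[OF refl] comp2_def jet_def[abs_def] del: One_nat_def)
  have H: "H_expr s1 s2 s3 \<rho> a S = (\<lambda>x. 0)" if "S \<noteq> {}" for S
    using that by (simp add: H_expr_def p del: One_nat_def)
  have H0: "H_expr s1 s2 s3 \<rho> a {} = (\<lambda>x. s1 * ?c [[1,2,3],[1,3,4]] x + s2 * ?c [[1,4,3],[1,3,4]] x
      + s3 * ?c [[1,4,3],[2,3,4]] x)"
    by (simp add: H_expr_def p add.assoc del: One_nat_def)
  have "has_pd l (\<lambda>x. s1 * ?c [[1,2,3],[1,3,4]] x + s2 * ?c [[1,4,3],[1,3,4]] x + s3 * ?c [[1,4,3],[2,3,4]] x)
      (\<lambda>x. s1 * ?dc l [[1,2,3],[1,3,4]] x + s2 * ?dc l [[1,4,3],[1,3,4]] x + s3 * ?dc l [[1,4,3],[2,3,4]] x)" for l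
    by (intro has_pd_add has_pd_cmult has_pd_comp2 assms)
  then have d: "pd l (H_expr s1 s2 s3 \<rho> a {}) x =
      s1 * ?dc l [[1,2,3],[1,3,4]] x + s2 * ?dc l [[1,4,3],[1,3,4]] x + s3 * ?dc l [[1,4,3],[2,3,4]] x" for l
    unfolding H0 by (simp add: has_pd_def)
  have j: "\<rho> x = jet \<rho> x []" "pd k a x = jet a x [k]" for k by (simp_all add: jet_def)
  have f:
    "schouten (nambu \<rho> a) (H_expr s1 s2 s3 \<rho> a) {1} x = \<rho> x * (pd 3 a x * pd 2 (H_expr s1 s2 s3 \<rho> a {}) x - pd 2 a x * pd 3 (H_expr s1 s2 s3 \<rho> a {}) x)"
    "schouten (nambu \<rho> a) (H_expr s1 s2 s3 \<rho> a) {2} x = \<rho> x * (pd 1 a x * pd 3 (H_expr s1 s2 s3 \<rho> a {}) x - pd 3 a x * pd 1 (H_expr s1 s2 s3 \<rho> a {}) x)"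
    "schouten (nambu \<rho> a) (H_expr s1 s2 s3 \<rho> a) {3} x = \<rho> x * (pd 2 a x * pd 1 (H_expr s1 s2 s3 \<rho> a {}) x - pd 1 a x * pd 2 (H_expr s1 s2 s3 \<rho> a {}) x)"
    by (rule schouten_function, rule H, assumption)+
  consider "i = 1" | "i = 2" | "i = 3" using exhaust_3[of i] by auto
  then show "schouten (nambu \<rho> a) (H_expr s1 s2 s3 \<rho> a) {i} x =
      s1 * ham [[1,2,3],[1,3,4]] (jet \<rho> x) (jet a x) i + s2 * ham [[1,4,3],[1,3,4]] (jet \<rho> x) (jet a x) i
      + s3 * ham [[1,4,3],[2,3,4]] (jet \<rho> x) (jet a x) i"
    by cases (simp_all only: f d ham_def eps2_simps j, simp_all add: algebra_simps)
  show "card S \<noteq> 1 \<Longrightarrow> schouten (nambu \<rho> a) (H_expr s1 s2 s3 \<rho> a) S x = 0"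
    by (rule schouten_function(1)[OF H])
qed

text \<open>The given field solves the equation too, so the bracket of the difference vanishes. Its
  coefficient at \<open>{3, 1}\<close> in the origin suffices to put the difference into the
  Hamiltonian kernel.\<close>

lemma uniqueness:
  assumes X: "X \<in> W3D" and flow: "generic_eq (\<lambda>\<rho> a S x. 1 * tetrahedral_flow (nambu \<rho> a) S x)
    (\<lambda>\<rho> a. schouten (nambu \<rho> a) (X \<rho> a))"
  shows "\<exists>H\<in>H3D. generic_eq (\<lambda>\<rho> a S x. X \<rho> a S x - X3D \<rho> a S x)
    (\<lambda>\<rho> a. schouten (nambu \<rho> a) (H \<rho> a))"
proof -
  obtain d where d: "\<And>\<rho> a i. smooth \<rho> \<Longrightarrow> smooth a \<Longrightarrow>
      X \<rho> a {i} = (\<lambda>x. lin (X_terms @ map (\<lambda>B. (d B, B)) basis) (jet \<rho> x) (jet a x) i)"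
    and X0: "\<And>\<rho> a S. smooth \<rho> \<Longrightarrow> smooth a \<Longrightarrow> card S \<noteq> 1 \<Longrightarrow> X \<rho> a S = (\<lambda>x. 0)"
    using W3D_cases[OF X] by blast
  let ?L = "map (\<lambda>B. (d B, B)) basis"
  have "lbrk ?L (jet \<rho> 0) (jet a 0) 2 = 0" if s: "smooth \<rho>" "smooth a" for \<rho> a
  proof -
    have "lbrk X_terms (jet \<rho> 0) (jet a 0) 2 = schouten (nambu \<rho> a) (X \<rho> a) {3, 1} 0"
      using flow s tetrahedral_flow_X_terms(3)[OF s] by (auto simp: generic_eq_def fun_eq_iff)
    also have "\<dots> = lbrk (X_terms @ ?L) (jet \<rho> 0) (jet a 0) 2"
      by (rule schouten_lin(1)[OF s d[OF s] X0[OF s]])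
    finally show ?thesis by (simp add: lbrk_append)
  qed
  then obtain s1 s2 s3 where s: "\<And>R A i. jets R A \<Longrightarrow> lin ?L R A i =
      s1 * ham [[1,2,3],[1,3,4]] R A i + s2 * ham [[1,4,3],[1,3,4]] R A i + s3 * ham [[1,4,3],[2,3,4]] R A i"
    using lin_kernel by blast
  have "X \<rho> a S x - X3D \<rho> a S x = schouten (nambu \<rho> a) (H_expr s1 s2 s3 \<rho> a) S x"
    if sm: "smooth \<rho>" "smooth a" for \<rho> a S x
  proof (cases "card S = 1")
    case True
    then obtain i where S: "S = {i}" by (auto simp: card_1_singleton_iff)
    have "X \<rho> a {i} x - X3D \<rho> a {i} x = lin ?L (jet \<rho> x) (jet a x) i"
      by (simp add: d[OF sm] X3D_lin[OF sm] lin_def)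
    then show ?thesis by (simp only: S s[OF jets_jet[OF sm]] schouten_H_expr(1)[OF sm])
  next
    case False
    then show ?thesis by (simp add: X0[OF sm] X3D_lin(2)[OF sm] schouten_H_expr(2)[OF sm])
  qed
  then have "generic_eq (\<lambda>\<rho> a S x. X \<rho> a S x - X3D \<rho> a S x)
      (\<lambda>\<rho> a. schouten (nambu \<rho> a) (H_expr s1 s2 s3 \<rho> a))"
    by (simp add: generic_eq_def fun_eq_iff)
  then show ?thesis using H_expr_H3D by blast
qed

theorem corollary13:
  shows "X3D \<in> W3D \<and>
    (\<exists>\<kappa>::real. \<kappa> \<noteq> 0 \<and>
      generic_eq (\<lambda>\<rho> a S x. \<kappa> * tetrahedral_flow (nambu \<rho> a) S x)
                 (\<lambda>\<rho> a. schouten (nambu \<rho> a) (X3D \<rho> a)) \<and>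
      (\<forall>X\<in>W3D.
         generic_eq (\<lambda>\<rho> a S x. \<kappa> * tetrahedral_flow (nambu \<rho> a) S x)
                    (\<lambda>\<rho> a. schouten (nambu \<rho> a) (X \<rho> a)) \<longrightarrow>
         (\<exists>H\<in>H3D. generic_eq (\<lambda>\<rho> a S x. X \<rho> a S x - X3D \<rho> a S x)
                             (\<lambda>\<rho> a. schouten (nambu \<rho> a) (H \<rho> a)))))"
\<comment> \<open>With these orderings of edges and variables the flow equals the bracket exactly,
  so the normalization constant is 1.\<close>
proof (intro conjI exI[of _ "1::real"] ballI impI)
  have "(\<lambda>\<rho> a S x. \<Sum>(c, G)\<leftarrow>X_terms. c * phi G \<rho> a S x) \<in> W3D"
    unfolding W3D_def by (rule graph_span_lin) (use X_terms_descendants in blast)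
  then obtain F c where "finite F"
    "F \<subseteq> descendants [[0,1],[1,3],[1,2]] \<union> descendants [[0,3],[1,3],[1,2]]"
    "generic_eq (\<lambda>\<rho> a S x. \<Sum>(c, G)\<leftarrow>X_terms. c * phi G \<rho> a S x) (\<lambda>\<rho> a S x. \<Sum>\<Gamma>\<in>F. c \<Gamma> * phi \<Gamma> \<rho> a S x)"
    unfolding W3D_def graph_span_def by blast
  moreover from this(3) have "generic_eq X3D (\<lambda>\<rho> a S x. \<Sum>\<Gamma>\<in>F. c \<Gamma> * phi \<Gamma> \<rho> a S x)"
    by (simp add: generic_eq_def fun_eq_iff X3D_terms)
  ultimately show "X3D \<in> W3D"
    unfolding W3D_def graph_span_def by blast
  show "(1::real) \<noteq> 0" by simp
  show "generic_eq (\<lambda>\<rho> a S x. 1 * tetrahedral_flow (nambu \<rho> a) S x) (\<lambda>\<rho> a. schouten (nambu \<rho> a) (X3D \<rho> a))"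
    by (simp add: generic_eq_def fun_eq_iff trivialization)
qed (rule uniqueness)

end
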